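(* Let $T>0$, $s\in(1/2,1)$, let $\omega\subset(-1,1)$ have nonempty interior, let $\sigma\in W^{1,\infty}(0,T)$ with $\sigma(T)\neq 0$, let $f\in L^2(-1,1)$, and let $u$ be the finite-energy solution of $$\begin{cases}\partial_t u+(-\partial_x^2)^s u=f(x)\sigma(t) & \text{in }(-1,1)\times(0,T),\\ u=0 & \text{in }(\mathbb{R}\setminus(-1,1))\times(0,T),\\ u(\cdot,0)=0 & \text{in }(-1,1).\end{cases}$$ Let $\{\lambda_n\}_{n\in\mathbb{N}}$ and $\{\varphi_n\}_{n\in\mathbb{N}}$ be the eigenvalues and the orthonormal basis of eigenfunctions of the fractional Laplacian $(-\partial_x^2)^s$ in $(-1,1)$ with homogeneous Dirichlet exterior condition. For $n\in\mathbb{N}$ and each $0<\tau\le T$, let $h^{(\tau)}\in L^2(0,\tau;L^2(\omega))$ (depending on $n$) be a null control for the datum $\varphi_n$, i.e. the solution $\phi$ of $$\begin{cases}-\partial_t\phi+(-\partial_x^2)^s\phi=h^{(\tau)}\chi_{\omega\times(0,\tau)} & \text{in }(-1,1)\times(0,\tau),\\ \phi=0 & \text{in }(\mathbb{R}\setminus(-1,1))\times(0,\tau),\\ \phi(\cdot,\tau)=\varphi_n & \text{in }(-1,1)\end{cases}$$ satisfies $\phi(\cdot,0)=0$ in $(-1,1)$; extend $h^{(\tau)}$ by zero to $(\tau,T]$. Let $\theta^{(\tau)}\in H^1(0,\tau;L^2(-1,1))$ be the solution of the Volterra integral equation $$\begin{cases}h^{(\tau)}(x,t)=\sigma(0)\,\theta^{(\tau)}_t(x,t)+\displaystyle\int_t^{\tau}\Big(\sigma(r-t)\,\theta^{(\tau)}(x,r)+\sigma'(r-t)\,\theta^{(\tau)}_t(x,r)\Big)dr,\quad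 0<t<\tau,\\ \theta^{(\tau)}(x,\tau)=0,\end{cases}$$ also extended by zero to $(\tau,T]$. If, for each $n\in\mathbb{N}$, $$c_n:=\sigma(T)-\lambda_n\int_0^T e^{\lambda_n(r-T)}\sigma(r)\,dr\neq 0,$$ then for each $n\in\mathbb{N}$ $$(f,\varphi_n)_{L^2(-1,1)}=c_n^{-1}\Big(-\sigma(0)\langle u,\theta^{(T)}\rangle_{H^1(0,T;L^2(\omega))}-\int_0^T\sigma'(T-\tau)\langle u,\theta^{(\tau)}\rangle_{H^1(0,T;L^2(\omega))}\,d\tau\Big).$$
   Context: All functions are real-valued. For $0<s<1$, $(-\partial_x^2)^s u(x)=C_s\,\mathrm{P.V.}\int_{\mathbb{R}}\frac{u(x)-u(y)}{|x-y|^{1+2s}}\,dy$ with $C_s=\frac{s2^{2s}\Gamma((2s+1)/2)}{\pi^{1/2}\Gamma(1-s)}$. $H_0^s(-1,1)$ is the space of $u\in H^s(\mathbb{R})$ with $u=0$ a.e. in $\mathbb{R}\setminus(-1,1)$, and $H^{-s}(-1,1)$ is its dual with pivot space $L^2(-1,1)$. Set $\mathcal{F}(u,v)=\frac{C_s}{2}\int_{\mathbb{R}}\int_{\mathbb{R}}\frac{(u(x)-u(y))(v(x)-v(y))}{|x-y|^{1+2s}}\,dx\,dy$ for $u,v\in H_0^s(-1,1)$. The fractional Laplacian with homogeneous Dirichlet exterior condition is the selfadjoint operator in $L^2(-1,1)$ associated with $\mathcal{F}$; it has compact resolvent, eigenvalues $0<\lambda_1\le\lambda_2\le\cdots\to\infty$,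 and an orthonormal basis $\{\varphi_n\}$ of $L^2(-1,1)$ of eigenfunctions: $(-\partial_x^2)^s\varphi_n=\lambda_n\varphi_n$ in $(-1,1)$, $\varphi_n=0$ in $\mathbb{R}\setminus(-1,1)$. A finite-energy solution of $\partial_t u+(-\partial_x^2)^su=F$, $u=0$ outside $(-1,1)$, with given initial datum in $L^2(-1,1)$, where $F\in L^2(0,T;H^{-s}(-1,1))$, is a function $u\in L^2(0,T;H_0^s(-1,1))$ with $u_t\in L^2(0,T;H^{-s}(-1,1))$ (hence $u\in C([0,T];L^2(-1,1))$) attaining the initial datum and satisfying $\int_0^T\langle u_t,w\rangle\,dt+\int_0^T\mathcal{F}(u,w)\,dt=\int_0^T\langle F,w\rangle\,dt$ for all $w\in L^2(0,T;H_0^s(-1,1))$, with $\langle\cdot,\cdot\rangle$ the $H^{-s}$–$H_0^s$ duality. Solutions of backward problems (with a datum at time $\tau$) are understood in the same sense after time reversal. For $F=f(x)\sigma(t)$ as in the claim and zero initial datum, one has $u_t\in L^2((-1,1)\times(0,T))$. $\langle v,\theta\rangle_{H^1(0,T;L^2(\omega))}=\int_0^T\int_\omega(v\theta+v_t\theta_t)\,dx\,dt$. $\sigma$ is identified with its continuous representative on $[0,T]$. $h^{(\tau)}$ is regarded as zero for $x\notin\omega$. Known fact: for $s\in(1/2,1)$ a null control $h^{(\tau)}$ exists for every datum in $L^2(-1,1)$ and every $\tau\in(0,T]$. *)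

theory Defs
  imports "HOL-Analysis.Analysis"
begin

text \<open>
  Elements of Lebesgue, Sobolev and Bochner spaces are represented by functions, and all notions
  below depend only on the almost-everywhere classes. A function \<open>u\<close> of time and space is curried
  as \<open>u t x\<close>; the sequences of eigenvalues and eigenfunctions are indexed from \<open>0\<close>.
\<close>

section \<open>Square-integrable functions\<close>

definition L2_space :: "'a measure \<Rightarrow> ('a \<Rightarrow> real) set" where
  "L2_space M = {f \<in> borel_measurable M. integrable M (\<lambda>x. (f x)\<^sup>2)}"

definition L2_inner :: "'a measure \<Rightarrow> ('a \<Rightarrow> real) \<Rightarrow> ('a \<Rightarrow> real) \<Rightarrow> real" where
  "L2_inner M f g = (LINT x|M. f x * g x)"

definition L2_norm :: "'a measure \<Rightarrow> ('a \<Rightarrow> real) \<Rightarrow> real" where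
  "L2_norm M f = sqrt (L2_inner M f f)"

definition L2_orthonormal_basis :: "'a measure \<Rightarrow> (nat \<Rightarrow> 'a \<Rightarrow> real) \<Rightarrow> bool" where
  "L2_orthonormal_basis M e \<longleftrightarrow>
     (\<forall>n. e n \<in> L2_space M) \<and>
     (\<forall>m n. L2_inner M (e m) (e n) = (if m = n then 1 else 0)) \<and>
     (\<forall>g \<in> L2_space M.
        (\<lambda>N. L2_norm M (\<lambda>x. g x - (\<Sum>k<N. L2_inner M g (e k) * e k x))) \<longlonglongrightarrow> 0)"

abbreviation leb_D :: "real measure" where
  "leb_D \<equiv> lebesgue_on {-1<..<1}"


section \<open>Bochner spaces over a time interval\<close>

text \<open>
  \<open>V\<close> is a vector space of representatives with seminorm \<open>N\<close>; strong measurability is almost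
  everywhere approximation by \<open>V\<close>-valued simple functions.
\<close>

definition strongly_measurable ::
    "'v set \<Rightarrow> ('v \<Rightarrow> real) \<Rightarrow> real \<Rightarrow> real \<Rightarrow> (real \<Rightarrow> 'v::minus) \<Rightarrow> bool" where
  "strongly_measurable V N a b f \<longleftrightarrow>
     (\<exists>S :: nat \<Rightarrow> real \<Rightarrow> 'v.
        (\<forall>k. simple_function (lebesgue_on {a<..<b}) (S k) \<and> (\<forall>t\<in>{a<..<b}. S k t \<in> V)) \<and>
        (AE t in lebesgue_on {a<..<b}. (\<lambda>k. N (S k t - f t)) \<longlonglongrightarrow> 0))"

definition bochner_L2 ::
    "'v set \<Rightarrow> ('v \<Rightarrow> real) \<Rightarrow> real \<Rightarrow> real \<Rightarrow> (real \<Rightarrow> 'v::minus) set" where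
  "bochner_L2 V N a b =
     {f. (AE t in lebesgue_on {a<..<b}. f t \<in> V) \<and>
         strongly_measurable V N a b f \<and>
         integrable (lebesgue_on {a<..<b}) (\<lambda>t. (N (f t))\<^sup>2)}"

abbreviation bochner_L2_L2 :: "'a measure \<Rightarrow> real \<Rightarrow> real \<Rightarrow> (real \<Rightarrow> 'a \<Rightarrow> real) set" where
  "bochner_L2_L2 M \<equiv> bochner_L2 (L2_space M) (L2_norm M)"

text \<open>The value at time \<open>t0\<close> of the continuous \<open>L\<^sup>2(M)\<close>-valued representative of \<open>u\<close>.\<close>

definition L2_has_value_at ::
    "'a measure \<Rightarrow> real \<Rightarrow> real \<Rightarrow> (real \<Rightarrow> 'a \<Rightarrow> real) \<Rightarrow> real \<Rightarrow> ('a \<Rightarrow> real) \<Rightarrow> bool" where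
  "L2_has_value_at M a b u t0 g \<longleftrightarrow>
     (\<exists>v. (\<forall>t\<in>{a..b}. v t \<in> L2_space M \<and>
              ((\<lambda>r. L2_norm M (v r - v t)) \<longlongrightarrow> 0) (at t within {a..b})) \<and>
          (AE t in lebesgue_on {a<..<b}. AE x in M. v t x = u t x) \<and>
          (AE x in M. v t0 x = g x))"

text \<open>The integral over \<open>S\<close> of an \<open>L\<^sup>2(M)\<close>-valued function of time. It is tested against
  \<open>L\<^sup>2(M)\<close>, since for a fixed \<open>x\<close> the section \<open>\<lambda>r. g r x\<close> has no meaning for an equivalence class.\<close>

definition L2_has_integral ::
    "'a measure \<Rightarrow> real set \<Rightarrow> (real \<Rightarrow> 'a \<Rightarrow> real) \<Rightarrow> ('a \<Rightarrow> real) \<Rightarrow> bool" where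
  "L2_has_integral M S g J \<longleftrightarrow>
     J \<in> L2_space M \<and>
     (\<forall>w \<in> L2_space M.
        integrable (lebesgue_on S) (\<lambda>r. L2_inner M (g r) w) \<and>
        L2_inner M J w = (LINT r|lebesgue_on S. L2_inner M (g r) w))"


section \<open>Weak derivatives in time\<close>

text \<open>Test functions are taken in \<open>C\<^sub>c\<^sup>1\<close>; by density this is the same as using smooth ones.\<close>

definition test_functions :: "real \<Rightarrow> real \<Rightarrow> (real \<Rightarrow> real) set" where
  "test_functions a b =
     {\<psi>. (\<forall>t. \<psi> differentiable (at t)) \<and> continuous_on UNIV (deriv \<psi>) \<and>
         (\<exists>c d. a < c \<and> d < b \<and> (\<forall>t. t \<notin> {c..d} \<longrightarrow> \<psi> t = 0))}"

definition weak_deriv :: "real \<Rightarrow> real \<Rightarrow> (real \<Rightarrow> real) \<Rightarrow> (real \<Rightarrow> real) \<Rightarrow> bool" where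
  "weak_deriv a b g g' \<longleftrightarrow>
     (\<forall>\<psi> \<in> test_functions a b.
        (LINT t|lebesgue_on {a<..<b}. g t * deriv \<psi> t) =
        - (LINT t|lebesgue_on {a<..<b}. g' t * \<psi> t))"

definition Linf :: "real \<Rightarrow> real \<Rightarrow> (real \<Rightarrow> real) set" where
  "Linf a b = {g \<in> borel_measurable (lebesgue_on {a<..<b}).
                 \<exists>C. AE t in lebesgue_on {a<..<b}. \<bar>g t\<bar> \<le> C}"

text \<open>\<open>\<sigma>\<close> is the continuous representative of an element of \<open>W\<^sup>1\<^sup>,\<^sup>\<infinity>(a,b)\<close> with weak
  derivative \<open>\<sigma>'\<close>.\<close>

definition W1inf_with_deriv :: "real \<Rightarrow> real \<Rightarrow> (real \<Rightarrow> real) \<Rightarrow> (real \<Rightarrow> real) \<Rightarrow> bool" where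
  "W1inf_with_deriv a b \<sigma> \<sigma>' \<longleftrightarrow>
     \<sigma> \<in> Linf a b \<and> \<sigma>' \<in> Linf a b \<and> weak_deriv a b \<sigma> \<sigma>' \<and> continuous_on {a..b} \<sigma>"

definition has_time_deriv_L2 ::
    "'a measure \<Rightarrow> real \<Rightarrow> real \<Rightarrow> (real \<Rightarrow> 'a \<Rightarrow> real) \<Rightarrow> (real \<Rightarrow> 'a \<Rightarrow> real) \<Rightarrow> bool" where
  "has_time_deriv_L2 M a b v v' \<longleftrightarrow>
     v' \<in> bochner_L2_L2 M a b \<and>
     (\<forall>w \<in> L2_space M. weak_deriv a b (\<lambda>t. L2_inner M (v t) w) (\<lambda>t. L2_inner M (v' t) w))"

definition H1_L2 :: "'a measure \<Rightarrow> real \<Rightarrow> real \<Rightarrow> (real \<Rightarrow> 'a \<Rightarrow> real) set" where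
  "H1_L2 M a b = {v \<in> bochner_L2_L2 M a b. \<exists>v'. has_time_deriv_L2 M a b v v'}"

text \<open>Unique up to null sets when it exists; arbitrary otherwise.\<close>

definition time_deriv ::
    "'a measure \<Rightarrow> real \<Rightarrow> real \<Rightarrow> (real \<Rightarrow> 'a \<Rightarrow> real) \<Rightarrow> real \<Rightarrow> 'a \<Rightarrow> real" where
  "time_deriv M a b v = (SOME v'. has_time_deriv_L2 M a b v v')"

definition H1_L2_inner ::
    "'a measure \<Rightarrow> real \<Rightarrow> real \<Rightarrow> (real \<Rightarrow> 'a \<Rightarrow> real) \<Rightarrow> (real \<Rightarrow> 'a \<Rightarrow> real) \<Rightarrow> real" where
  "H1_L2_inner M a b v \<theta> =
     (LINT t|lebesgue_on {a<..<b}. LINT x|M.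
        v t x * \<theta> t x + time_deriv M a b v t x * time_deriv M a b \<theta> t x)"

definition extend_by_zero :: "real \<Rightarrow> (real \<Rightarrow> 'a \<Rightarrow> real) \<Rightarrow> real \<Rightarrow> 'a \<Rightarrow> real" where
  "extend_by_zero \<tau> v = (\<lambda>t x. if t \<le> \<tau> then v t x else 0)"


section \<open>Fractional Sobolev spaces on \<open>(-1,1)\<close> and the fractional Laplacian\<close>

definition gagliardo :: "real \<Rightarrow> (real \<Rightarrow> real) \<Rightarrow> ennreal" where
  "gagliardo s u =
     (\<integral>\<^sup>+ y. \<integral>\<^sup>+ x. ennreal ((u x - u y)\<^sup>2 / \<bar>x - y\<bar> powr (1 + 2 * s)) \<partial>lebesgue \<partial>lebesgue)"

definition Hs :: "real \<Rightarrow> (real \<Rightarrow> real) set" where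
  "Hs s = {u \<in> L2_space lebesgue. gagliardo s u < \<infinity>}"

definition Hs_norm :: "real \<Rightarrow> (real \<Rightarrow> real) \<Rightarrow> real" where
  "Hs_norm s u = sqrt ((L2_norm lebesgue u)\<^sup>2 + enn2real (gagliardo s u))"

definition H0s :: "real \<Rightarrow> (real \<Rightarrow> real) set" where
  "H0s s = {u \<in> Hs s. AE x in lebesgue. x \<notin> {-1<..<1} \<longrightarrow> u x = 0}"

text \<open>Only the values of a functional on \<open>H0s s\<close> are relevant.\<close>

definition Hdual :: "real \<Rightarrow> ((real \<Rightarrow> real) \<Rightarrow> real) set" where
  "Hdual s =
     {l. (\<forall>v \<in> H0s s. \<forall>w \<in> H0s s. \<forall>a b. l (\<lambda>x. a * v x + b * w x) = a * l v + b * l w) \<and>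
         (\<exists>C. \<forall>w \<in> H0s s. \<bar>l w\<bar> \<le> C * Hs_norm s w)}"

definition Hdual_norm :: "real \<Rightarrow> ((real \<Rightarrow> real) \<Rightarrow> real) \<Rightarrow> real" where
  "Hdual_norm s l = (SUP w \<in> {w \<in> H0s s. Hs_norm s w \<le> 1}. \<bar>l w\<bar>)"

text \<open>The embedding of the pivot space \<open>L\<^sup>2(-1,1)\<close> into the dual.\<close>

definition pivot :: "(real \<Rightarrow> real) \<Rightarrow> (real \<Rightarrow> real) \<Rightarrow> real" where
  "pivot g = (\<lambda>w. L2_inner leb_D g w)"

definition frac_const :: "real \<Rightarrow> real" where
  "frac_const s = s * 2 powr (2 * s) * Gamma ((2 * s + 1) / 2) / (pi powr (1 / 2) * Gamma (1 - s))"

definition frac_form :: "real \<Rightarrow> (real \<Rightarrow> real) \<Rightarrow> (real \<Rightarrow> real) \<Rightarrow> real" where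
  "frac_form s u v =
     frac_const s / 2 *
     (LINT y|lebesgue. LINT x|lebesgue.
        (u x - u y) * (v x - v y) / \<bar>x - y\<bar> powr (1 + 2 * s))"

text \<open>The graph of the operator in \<open>L\<^sup>2(-1,1)\<close> associated with the form: the fractional Laplacian
  with homogeneous Dirichlet exterior condition maps \<open>u\<close> to \<open>g\<close>.\<close>

definition dirichlet_frac_laplacian :: "real \<Rightarrow> (real \<Rightarrow> real) \<Rightarrow> (real \<Rightarrow> real) \<Rightarrow> bool" where
  "dirichlet_frac_laplacian s u g \<longleftrightarrow>
     u \<in> H0s s \<and> g \<in> L2_space leb_D \<and> (\<forall>v \<in> H0s s. frac_form s u v = L2_inner leb_D g v)"

definition dirichlet_eigensystem :: "real \<Rightarrow> (nat \<Rightarrow> real) \<Rightarrow> (nat \<Rightarrow> real \<Rightarrow> real) \<Rightarrow> bool" where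
  "dirichlet_eigensystem s lam \<phi> \<longleftrightarrow>
     (\<forall>n. 0 < lam n) \<and> incseq lam \<and> filterlim lam at_top sequentially \<and>
     L2_orthonormal_basis leb_D \<phi> \<and>
     (\<forall>n. dirichlet_frac_laplacian s (\<phi> n) (\<lambda>x. lam n * \<phi> n x))"


section \<open>Fractional heat equation\<close>

definition finite_energy_solution ::
    "real \<Rightarrow> real \<Rightarrow> (real \<Rightarrow> (real \<Rightarrow> real) \<Rightarrow> real) \<Rightarrow> (real \<Rightarrow> real) \<Rightarrow> (real \<Rightarrow> real \<Rightarrow> real) \<Rightarrow> bool" where
  "finite_energy_solution s T F u0 u \<longleftrightarrow>
     u \<in> bochner_L2 (H0s s) (Hs_norm s) 0 T \<and>
     L2_has_value_at leb_D 0 T u 0 u0 \<and>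
     (\<exists>u' \<in> bochner_L2 (Hdual s) (Hdual_norm s) 0 T.
        (\<forall>w \<in> H0s s. weak_deriv 0 T (\<lambda>t. pivot (u t) w) (\<lambda>t. u' t w)) \<and>
        (\<forall>w \<in> bochner_L2 (H0s s) (Hs_norm s) 0 T.
           (LINT t|lebesgue_on {0<..<T}. u' t (w t)) +
           (LINT t|lebesgue_on {0<..<T}. frac_form s (u t) (w t)) =
           (LINT t|lebesgue_on {0<..<T}. F t (w t))))"

definition backward_finite_energy_solution ::
    "real \<Rightarrow> real \<Rightarrow> (real \<Rightarrow> (real \<Rightarrow> real) \<Rightarrow> real) \<Rightarrow> (real \<Rightarrow> real) \<Rightarrow> (real \<Rightarrow> real \<Rightarrow> real) \<Rightarrow> bool" where
  "backward_finite_energy_solution s \<tau> F g v \<longleftrightarrow>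
     finite_energy_solution s \<tau> (\<lambda>t. F (\<tau> - t)) g (\<lambda>t. v (\<tau> - t))"

definition null_control ::
    "real \<Rightarrow> real set \<Rightarrow> real \<Rightarrow> (real \<Rightarrow> real) \<Rightarrow> (real \<Rightarrow> real \<Rightarrow> real) \<Rightarrow> bool" where
  "null_control s \<omega> \<tau> g h \<longleftrightarrow>
     h \<in> bochner_L2_L2 (lebesgue_on \<omega>) 0 \<tau> \<and>
     (\<exists>v. backward_finite_energy_solution s \<tau> (\<lambda>t. pivot (\<lambda>x. indicator \<omega> x * h t x)) g v \<and>
          L2_has_value_at leb_D 0 \<tau> v 0 (\<lambda>x. 0))"

definition volterra_solution ::
    "(real \<Rightarrow> real) \<Rightarrow> (real \<Rightarrow> real) \<Rightarrow> real set \<Rightarrow> real \<Rightarrow> (real \<Rightarrow> real \<Rightarrow> real) \<Rightarrow> (real \<Rightarrow> real \<Rightarrow> real) \<Rightarrow> bool" where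
  "volterra_solution \<sigma> \<sigma>' \<omega> \<tau> h \<theta> \<longleftrightarrow>
     \<theta> \<in> H1_L2 leb_D 0 \<tau> \<and>
     (let \<theta>\<^sub>t = time_deriv leb_D 0 \<tau> \<theta> in
        AE t in lebesgue_on {0<..<\<tau>}.
          \<exists>J. L2_has_integral leb_D {t<..<\<tau>}
                 (\<lambda>r x. \<sigma> (r - t) * \<theta> r x + \<sigma>' (r - t) * \<theta>\<^sub>t r x) J \<and>
              (AE x in leb_D. indicator \<omega> x * h t x = \<sigma> 0 * \<theta>\<^sub>t t x + J x)) \<and>
     L2_has_value_at leb_D 0 \<tau> \<theta> \<tau> (\<lambda>x. 0)"

definition source_coeff :: "real \<Rightarrow> (real \<Rightarrow> real) \<Rightarrow> real \<Rightarrow> real" where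
  "source_coeff T \<sigma> l =
     \<sigma> T - l * (LINT r|lebesgue_on {0<..<T}. exp (l * (r - T)) * \<sigma> r)"

end

theory Submission
  imports Defs
begin

text \<open>
  Let \<open>a\<^sub>k = (f, \<phi>\<^sub>k)\<close> and \<open>e\<^sub>k(t) = exp(- \<lambda>\<^sub>k t)\<close>. By Duhamel's principle \<open>u\<close> is the convolution of \<open>\<sigma>\<close> with
  the solution \<open>w = \<Sum> a\<^sub>k e\<^sub>k \<phi>\<^sub>k\<close> of the homogeneous equation that starts from \<open>f\<close>, so
  \<open>u(t) = \<integral>\<^sub>0\<^sup>t \<sigma>(t - r) w(r) dr\<close> and \<open>u\<^sub>t(t) = \<sigma>(0) w(t) + \<integral>\<^sub>0\<^sup>t \<sigma>'(t - r) w(r) dr\<close>. The Volterra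
  equation is the adjoint relation: exchanging the order of integration in
  \<open>\<integral>\<^sub>0\<^sup>\<tau> (u, \<theta>) + (u\<^sub>t, \<theta>\<^sub>t) dt\<close> moves both convolutions onto \<open>\<theta>\<close> and leaves \<open>\<integral>\<^sub>0\<^sup>\<tau> (w, h) dr\<close>, with all
  inner products taken over \<open>\<omega>\<close>. The null control \<open>h\<close> of \<open>\<phi>\<^sub>n\<close> is dual to the homogeneous equation,
  and the last integral equals \<open>- a\<^sub>n e\<^sub>n(\<tau>)\<close>, minus the \<open>L\<^sup>2(-1,1)\<close> inner product of \<open>w(\<tau>)\<close> and \<open>\<phi>\<^sub>n\<close>. Hence the \<open>H\<^sup>1\<close> inner product of \<open>u\<close> with
  \<open>\<theta>\<close> is \<open>- a\<^sub>n e\<^sub>n(\<tau>)\<close> for every \<open>\<tau>\<close> (\<open>H1_L2_inner_control\<close>), and the claim follows from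
  \<open>\<sigma>(0) e\<^sub>n(T) + \<integral>\<^sub>0\<^sup>T \<sigma>'(T - \<tau>) e\<^sub>n(\<tau>) d\<tau> = c\<^sub>n\<close>, which is an integration by parts (\<open>exp_conv_deriv\<close>).

  All of this is carried out on Fourier coefficients. Testing a weak formulation with \<open>\<psi>(t) \<phi>\<^sub>k(x)\<close>
  gives a scalar equation \<open>z' + \<lambda>\<^sub>k z = p\<close> in the weak sense (\<open>finite_energy_solution_coefficient\<close>); the
  du Bois-Reymond lemma (\<open>weak_deriv_primitive\<close>) and an integrating factor solve it. For the controlled
  equation, the vanishing of the final state becomes a family of moment identities for \<open>h\<close>
  (\<open>null_control_moment\<close>), and the exchange of integrals is Fubini's theorem for real functions on a
  triangle (\<open>Fubini_triangle\<close>). The coefficients of \<open>u\<^sub>t\<close> are bounded by a multiple of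
  \<open>\<bar>a\<^sub>k\<bar>\<close> uniformly in time, and the Riesz-Fischer theorem turns them into an \<open>L\<^sup>2\<close> function
  (\<open>source_solution_time_deriv\<close>). Parseval's identity, integrated in time by dominated convergence
  (\<open>Parseval_integral\<close>), returns from the coefficients to the inner product.
\<close>

section \<open>The inner product space of square-integrable functions\<close>

lemma L2_spaceD:
  assumes "f \<in> L2_space M"
  shows "f \<in> borel_measurable M" "integrable M (\<lambda>x. (f x)\<^sup>2)"
  using assms by (auto simp: L2_space_def)

lemma L2_mult_integrable:
  assumes "f \<in> L2_space M" "g \<in> L2_space M"
  shows "integrable M (\<lambda>x. f x * g x)"
proof (rule Bochner_Integration.integrable_bound[where f="\<lambda>x. (f x)\<^sup>2 + (g x)\<^sup>2"])
  have "\<bar>a * b\<bar> \<le> a\<^sup>2 + b\<^sup>2" for a b :: real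
  proof -
    have "2 * (\<bar>a\<bar> * \<bar>b\<bar>) \<le> a\<^sup>2 + b\<^sup>2" using sum_squares_bound[of "\<bar>a\<bar>" "\<bar>b\<bar>"] by simp
    moreover have "0 \<le> \<bar>a\<bar> * \<bar>b\<bar>" by simp
    ultimately show ?thesis unfolding abs_mult by linarith
  qed
  then show "AE x in M. norm (f x * g x) \<le> norm ((f x)\<^sup>2 + (g x)\<^sup>2)"
    by simp
qed (use L2_spaceD[OF assms(1)] L2_spaceD[OF assms(2)] in auto)

lemma L2_space_add:
  assumes f: "f \<in> L2_space M" and g: "g \<in> L2_space M"
  shows "(\<lambda>x. f x + g x) \<in> L2_space M"
proof -
  have "(\<lambda>x. (f x + g x)\<^sup>2) = (\<lambda>x. (f x)\<^sup>2 + (g x)\<^sup>2 + 2 * (f x * g x))"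
    by (simp add: power2_sum mult.assoc)
  then show ?thesis
    using L2_spaceD[OF f] L2_spaceD[OF g] L2_mult_integrable[OF f g]
    by (simp add: L2_space_def)
qed

lemma L2_space_scale: "f \<in> L2_space M \<Longrightarrow> (\<lambda>x. c * f x) \<in> L2_space M"
  by (auto simp: L2_space_def power_mult_distrib)

lemma L2_space_zero: "(\<lambda>x. 0) \<in> L2_space M"
  by (simp add: L2_space_def)

lemma L2_space_diff:
  "f \<in> L2_space M \<Longrightarrow> g \<in> L2_space M \<Longrightarrow> (\<lambda>x. f x - g x) \<in> L2_space M"
  using L2_space_add[of f M "\<lambda>x. -1 * g x"] L2_space_scale[of g M "-1"] by simp

lemma L2_space_sum:
  "finite A \<Longrightarrow> (\<And>i. i \<in> A \<Longrightarrow> f i \<in> L2_space M) \<Longrightarrow> (\<lambda>x. \<Sum>i\<in>A. f i x) \<in> L2_space M"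
  by (induction A rule: finite_induct) (auto intro: L2_space_zero L2_space_add)

lemma L2_inner_commute: "L2_inner M f g = L2_inner M g f"
  by (simp add: L2_inner_def mult.commute)

lemma L2_inner_scale_left: "L2_inner M (\<lambda>x. c * f x) g = c * L2_inner M f g"
  by (simp add: L2_inner_def mult.assoc)

lemma L2_inner_scale_right: "L2_inner M g (\<lambda>x. c * f x) = c * L2_inner M g f"
  by (simp add: L2_inner_commute[of M g] L2_inner_scale_left)

lemma L2_inner_zero_left [simp]: "L2_inner M (\<lambda>x. 0) g = 0"
  by (simp add: L2_inner_def)

lemma L2_inner_add_left:
  assumes "f \<in> L2_space M" "g \<in> L2_space M" "w \<in> L2_space M"
  shows "L2_inner M (\<lambda>x. f x + g x) w = L2_inner M f w + L2_inner M g w"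
  using L2_mult_integrable[OF assms(1,3)] L2_mult_integrable[OF assms(2,3)]
  by (simp add: L2_inner_def algebra_simps)

lemma L2_inner_diff_left:
  assumes "f \<in> L2_space M" "g \<in> L2_space M" "w \<in> L2_space M"
  shows "L2_inner M (\<lambda>x. f x - g x) w = L2_inner M f w - L2_inner M g w"
  using L2_mult_integrable[OF assms(1,3)] L2_mult_integrable[OF assms(2,3)]
  by (simp add: L2_inner_def algebra_simps)

lemma L2_inner_add_right:
  assumes "f \<in> L2_space M" "g \<in> L2_space M" "w \<in> L2_space M"
  shows "L2_inner M w (\<lambda>x. f x + g x) = L2_inner M w f + L2_inner M w g"
  using L2_inner_add_left[OF assms] by (simp only: L2_inner_commute[of M w])

lemma L2_inner_diff_right:
  assumes "f \<in> L2_space M" "g \<in> L2_space M" "w \<in> L2_space M"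
  shows "L2_inner M w (\<lambda>x. f x - g x) = L2_inner M w f - L2_inner M w g"
  using L2_inner_diff_left[OF assms] by (simp only: L2_inner_commute[of M w])

lemma L2_inner_sum_left:
  assumes "finite A" "\<And>i. i \<in> A \<Longrightarrow> f i \<in> L2_space M" "w \<in> L2_space M"
  shows "L2_inner M (\<lambda>x. \<Sum>i\<in>A. f i x) w = (\<Sum>i\<in>A. L2_inner M (f i) w)"
  using assms
  by (induction A rule: finite_induct) (simp_all add: L2_inner_add_left L2_space_sum)

lemma L2_inner_self_nonneg: "0 \<le> L2_inner M f f"
  by (simp add: L2_inner_def)

lemma L2_norm_nonneg: "0 \<le> L2_norm M f"
  by (simp add: L2_norm_def L2_inner_self_nonneg)

lemma L2_norm_sq: "(L2_norm M f)\<^sup>2 = L2_inner M f f"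
  by (simp add: L2_norm_def L2_inner_self_nonneg)

lemma L2_norm_sq_integral: "(L2_norm M f)\<^sup>2 = (LINT x|M. (f x)\<^sup>2)"
  unfolding L2_norm_sq by (simp add: L2_inner_def power2_eq_square)

lemma L2_norm_scale: "L2_norm M (\<lambda>x. c * f x) = \<bar>c\<bar> * L2_norm M f"
  by (simp add: L2_norm_def L2_inner_scale_left L2_inner_scale_right real_sqrt_mult
      flip: mult.assoc)

lemma L2_Cauchy_Schwarz:
  assumes f: "f \<in> L2_space M" and g: "g \<in> L2_space M"
  shows "\<bar>L2_inner M f g\<bar> \<le> L2_norm M f * L2_norm M g"
proof -
  define A B C where "A = L2_inner M f f" and "B = L2_inner M f g" and "C = L2_inner M g g"
  \<comment> \<open>The quadratic polynomial \<open>A - 2 t B + t\<^sup>2 C\<close> is a squared norm, hence nonnegative.\<close>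
  have pos: "0 \<le> A - 2 * t * B + t\<^sup>2 * C" for t
  proof -
    have tg: "(\<lambda>x. t * g x) \<in> L2_space M" by (rule L2_space_scale[OF g])
    note d = L2_space_diff[OF f tg]
    have "0 \<le> L2_inner M (\<lambda>x. f x - t * g x) (\<lambda>x. f x - t * g x)"
      by (rule L2_inner_self_nonneg)
    also have "\<dots> = A - t * B - t * (B - t * C)"
      by (simp add: L2_inner_diff_left[OF f tg d] L2_inner_diff_right[OF f tg f]
          L2_inner_diff_right[OF f tg g] L2_inner_scale_left L2_inner_scale_right A_def B_def C_def
          L2_inner_commute[of M g f])
    also have "\<dots> = A - 2 * t * B + t\<^sup>2 * C" by (simp add: algebra_simps power2_eq_square)
    finally show ?thesis .
  qed
  have C0: "0 \<le> C" and A0: "0 \<le> A" by (simp_all add: A_def C_def L2_inner_self_nonneg)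
  have "B\<^sup>2 \<le> A * C"
  proof (cases "C = 0")
    case True
    have "B = 0"
    proof (rule ccontr)
      assume "B \<noteq> 0"
      \<comment> \<open>At this \<open>t\<close> the polynomial, now affine, has the value \<open>-1\<close>.\<close>
      with pos[of "(A + 1) / (2 * B)"] True show False by simp
    qed
    then show ?thesis using True by simp
  next
    case False
    then have "C > 0" using C0 by simp
    have "0 \<le> A - B\<^sup>2 / C"
      using pos[of "B / C"] \<open>C > 0\<close> by (simp add: power2_eq_square field_simps)
    then show ?thesis using \<open>C > 0\<close> by (simp add: field_simps)
  qed
  then have "sqrt (B\<^sup>2) \<le> sqrt (A * C)" by (rule real_sqrt_le_mono)
  then show ?thesis by (simp add: real_sqrt_mult L2_norm_def A_def B_def C_def)
qed

lemma L2_triangle: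
  assumes f: "f \<in> L2_space M" and g: "g \<in> L2_space M"
  shows "L2_norm M (\<lambda>x. f x + g x) \<le> L2_norm M f + L2_norm M g"
proof (rule power2_le_imp_le)
  have "(L2_norm M (\<lambda>x. f x + g x))\<^sup>2 = (L2_norm M f)\<^sup>2 + 2 * L2_inner M f g + (L2_norm M g)\<^sup>2"
    unfolding L2_norm_sq
    by (simp add: L2_inner_add_left[OF f g L2_space_add[OF f g]] L2_inner_add_right[OF f g f]
        L2_inner_add_right[OF f g g] L2_inner_commute[of M g f])
  also have "\<dots> \<le> (L2_norm M f + L2_norm M g)\<^sup>2"
    using L2_Cauchy_Schwarz[OF f g] by (simp add: power2_sum)
  finally show "(L2_norm M (\<lambda>x. f x + g x))\<^sup>2 \<le> (L2_norm M f + L2_norm M g)\<^sup>2" .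
qed (simp add: L2_norm_nonneg)

lemma L2_norm_diff_commute: "L2_norm M (\<lambda>x. f x - g x) = L2_norm M (\<lambda>x. g x - f x)"
  by (simp add: L2_norm_def L2_inner_def algebra_simps)

lemma L2_triangle_via:
  assumes f: "f \<in> L2_space M" and g: "g \<in> L2_space M" and h: "h \<in> L2_space M"
  shows "L2_norm M (\<lambda>x. f x - h x) \<le> L2_norm M (\<lambda>x. f x - g x) + L2_norm M (\<lambda>x. g x - h x)"
  using L2_triangle[OF L2_space_diff[OF f g] L2_space_diff[OF g h]] by simp

lemma L2_reverse_triangle:
  assumes f: "f \<in> L2_space M" and g: "g \<in> L2_space M"
  shows "\<bar>L2_norm M f - L2_norm M g\<bar> \<le> L2_norm M (\<lambda>x. f x - g x)"
  using L2_triangle[OF L2_space_diff[OF f g] g] L2_triangle[OF L2_space_diff[OF g f] f]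
    L2_norm_diff_commute[of M f g] by simp

lemma L2_inner_tendsto:
  assumes S: "\<And>k. S k \<in> L2_space M" and v: "v \<in> L2_space M" and w: "w \<in> L2_space M"
    and lim: "(\<lambda>k. L2_norm M (\<lambda>x. S k x - v x)) \<longlonglongrightarrow> 0"
  shows "(\<lambda>k. L2_inner M (S k) w) \<longlonglongrightarrow> L2_inner M v w"
proof (rule LIM_zero_cancel, rule Lim_null_comparison)
  have "\<bar>L2_inner M (S k) w - L2_inner M v w\<bar> \<le> L2_norm M (\<lambda>x. S k x - v x) * L2_norm M w" for k
    using L2_Cauchy_Schwarz[OF L2_space_diff[OF S v] w] L2_inner_diff_left[OF S v w] by simp
  then show "\<forall>\<^sub>F k in sequentially. norm (L2_inner M (S k) w - L2_inner M v w)
      \<le> L2_norm M (\<lambda>x. S k x - v x) * L2_norm M w" by simp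
  show "(\<lambda>k. L2_norm M (\<lambda>x. S k x - v x) * L2_norm M w) \<longlonglongrightarrow> 0"
    using tendsto_mult[OF lim tendsto_const[of "L2_norm M w"]] by simp
qed

lemma L2_norm_tendsto:
  assumes S: "\<And>k. S k \<in> L2_space M" and v: "v \<in> L2_space M"
    and lim: "(\<lambda>k. L2_norm M (\<lambda>x. S k x - v x)) \<longlonglongrightarrow> 0"
  shows "(\<lambda>k. L2_norm M (S k)) \<longlonglongrightarrow> L2_norm M v"
proof (rule LIM_zero_cancel, rule Lim_null_comparison)
  show "\<forall>\<^sub>F k in sequentially. norm (L2_norm M (S k) - L2_norm M v) \<le> L2_norm M (\<lambda>x. S k x - v x)"
    using L2_reverse_triangle[OF S v] by simp
qed (rule lim)

lemma L2_norm_zero_imp_AE: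
  assumes "f \<in> L2_space M" "L2_norm M f = 0"
  shows "AE x in M. f x = 0"
proof -
  have "(LINT x|M. (f x)\<^sup>2) = 0"
    using assms(2) L2_norm_sq_integral[of M f] by simp
  then have "AE x in M. (f x)\<^sup>2 = 0"
    using integral_nonneg_eq_0_iff_AE[of M "\<lambda>x. (f x)\<^sup>2"] L2_spaceD[OF assms(1)] by simp
  then show ?thesis by simp
qed

section \<open>Orthonormal bases\<close>

lemma orthonormal_basisD:
  assumes "L2_orthonormal_basis M e"
  shows "e n \<in> L2_space M" "L2_inner M (e m) (e n) = (if m = n then 1 else 0)"
    "g \<in> L2_space M \<Longrightarrow>
      (\<lambda>N. L2_norm M (\<lambda>x. g x - (\<Sum>k<N. L2_inner M g (e k) * e k x))) \<longlonglongrightarrow> 0"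
  using assms by (auto simp: L2_orthonormal_basis_def)

lemma basis_sum_L2:
  assumes "L2_orthonormal_basis M e" "finite A"
  shows "(\<lambda>x. \<Sum>k\<in>A. c k * e k x) \<in> L2_space M"
  by (intro L2_space_sum L2_space_scale orthonormal_basisD(1) assms)

lemma basis_sum_inner:
  assumes "L2_orthonormal_basis M e" "finite A" "w \<in> L2_space M"
  shows "L2_inner M (\<lambda>x. \<Sum>k\<in>A. c k * e k x) w = (\<Sum>k\<in>A. c k * L2_inner M (e k) w)"
  using L2_inner_sum_left[of A "\<lambda>k x. c k * e k x" M w] assms
  by (simp add: L2_space_scale orthonormal_basisD(1) L2_inner_scale_left)

lemma basis_sum_coeff:
  assumes "L2_orthonormal_basis M e" "finite A"
  shows "L2_inner M (\<lambda>x. \<Sum>k\<in>A. c k * e k x) (e j) = (if j \<in> A then c j else 0)"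
proof -
  have "L2_inner M (\<lambda>x. \<Sum>k\<in>A. c k * e k x) (e j) = (\<Sum>k\<in>A. if k = j then c k else 0)"
    unfolding basis_sum_inner[OF assms orthonormal_basisD(1)[OF assms(1)]]
    by (rule sum.cong) (auto simp: orthonormal_basisD(2)[OF assms(1)])
  then show ?thesis using assms(2) by (simp add: sum.delta)
qed

lemma basis_sum_norm_sq:
  assumes "L2_orthonormal_basis M e" "finite A"
  shows "(L2_norm M (\<lambda>x. \<Sum>k\<in>A. c k * e k x))\<^sup>2 = (\<Sum>k\<in>A. (c k)\<^sup>2)"
  unfolding L2_norm_sq basis_sum_inner[OF assms basis_sum_L2[OF assms]]
  by (rule sum.cong)
    (auto simp: L2_inner_commute[of M "e _"] basis_sum_coeff[OF assms] power2_eq_square)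

lemma Bessel:
  assumes e: "L2_orthonormal_basis M e" and g: "g \<in> L2_space M"
  shows "(\<Sum>k<N. (L2_inner M g (e k))\<^sup>2) \<le> (L2_norm M g)\<^sup>2"
proof -
  let ?P = "\<lambda>x. \<Sum>k<N. L2_inner M g (e k) * e k x"
  have P: "?P \<in> L2_space M" by (rule basis_sum_L2[OF e]) simp
  have Pg: "L2_inner M ?P g = (\<Sum>k<N. (L2_inner M g (e k))\<^sup>2)"
    using basis_sum_inner[OF e _ g, of "{..<N}"]
    by (simp add: L2_inner_commute[of M "e _"] power2_eq_square)
  have PP: "L2_inner M ?P ?P = (\<Sum>k<N. (L2_inner M g (e k))\<^sup>2)"
    using basis_sum_norm_sq[OF e, of "{..<N}"] by (simp add: L2_norm_sq)
  have "0 \<le> L2_inner M (\<lambda>x. g x - ?P x) (\<lambda>x. g x - ?P x)"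
    by (rule L2_inner_self_nonneg)
  also have "\<dots> = L2_inner M g g - (\<Sum>k<N. (L2_inner M g (e k))\<^sup>2)"
    by (simp only: L2_inner_diff_left[OF g P L2_space_diff[OF g P]] L2_inner_diff_right[OF g P g]
        L2_inner_diff_right[OF g P P] Pg PP L2_inner_commute[of M g ?P])
  finally show ?thesis by (simp add: L2_norm_sq)
qed

text \<open>The bound does not depend on the number of terms; it provides the dominating function when
  Parseval's identity is integrated in time.\<close>

lemma basis_partial_inner_bound:
  assumes e: "L2_orthonormal_basis M e" and g: "g \<in> L2_space M" and w: "w \<in> L2_space M"
  shows "\<bar>\<Sum>k<N. L2_inner M g (e k) * L2_inner M w (e k)\<bar> \<le> L2_norm M g * L2_norm M w"
proof -
  have "(\<Sum>k<N. L2_inner M g (e k) * L2_inner M w (e k))\<^sup>2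
      \<le> (\<Sum>k<N. (L2_inner M g (e k))\<^sup>2) * (\<Sum>k<N. (L2_inner M w (e k))\<^sup>2)"
    by (rule Cauchy_Schwarz_ineq_sum)
  also have "\<dots> \<le> (L2_norm M g)\<^sup>2 * (L2_norm M w)\<^sup>2"
    by (intro mult_mono Bessel e g w sum_nonneg) auto
  finally have "\<bar>\<Sum>k<N. L2_inner M g (e k) * L2_inner M w (e k)\<bar>\<^sup>2 \<le> (L2_norm M g * L2_norm M w)\<^sup>2"
    by (simp add: power_mult_distrib)
  then show ?thesis by (rule power2_le_imp_le) (simp add: L2_norm_nonneg)
qed

lemma Parseval:
  assumes e: "L2_orthonormal_basis M e" and g: "g \<in> L2_space M" and w: "w \<in> L2_space M"
  shows "(\<lambda>k. L2_inner M g (e k) * L2_inner M w (e k)) sums L2_inner M g w"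
proof -
  have "(\<lambda>N. L2_inner M (\<lambda>x. \<Sum>k<N. L2_inner M g (e k) * e k x) w) \<longlonglongrightarrow> L2_inner M g w"
    by (rule L2_inner_tendsto[OF basis_sum_L2[OF e] g w])
      (use orthonormal_basisD(3)[OF e g] in \<open>simp_all add: L2_norm_diff_commute[of M g]\<close>)
  then show ?thesis
    unfolding sums_def using basis_sum_inner[OF e _ w]
    by (simp add: L2_inner_commute[of M "e _"])
qed

text \<open>The partial sums along a subsequence with rapidly decreasing tails converge almost
  everywhere, since the series of \<open>2\<^sup>j d\<^sub>j\<^sup>2\<close> over their successive differences \<open>d\<^sub>j\<close> is integrable and
  \<open>2 \<bar>d\<^sub>j\<bar> \<le> 2\<^sup>-\<^sup>j + 2\<^sup>j d\<^sub>j\<^sup>2\<close>. By Fatou's lemma the pointwise limit is also the limit in the mean.\<close>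

theorem Riesz_Fischer:
  assumes e: "L2_orthonormal_basis M e" and c: "summable (\<lambda>k. (c k)\<^sup>2)"
  shows "\<exists>g \<in> L2_space M. \<forall>k. L2_inner M g (e k) = c k"
proof -
  define G where "G N = (\<lambda>x. \<Sum>k<N. c k * e k x)" for N
  have G: "G N \<in> L2_space M" for N unfolding G_def by (rule basis_sum_L2[OF e]) simp
  have GM[measurable]: "G N \<in> borel_measurable M" for N using L2_spaceD[OF G] by auto
  have diff_G: "(\<lambda>x. G n x - G m x) = (\<lambda>x. \<Sum>k\<in>{m..<n}. c k * e k x)" if "m \<le> n" for m n
  proof
    fix x
    have "{..<n} = {..<m} \<union> {m..<n}" using that by auto
    then show "G n x - G m x = (\<Sum>k\<in>{m..<n}. c k * e k x)"
      unfolding G_def by (simp add: sum.union_disjoint ivl_disj_int)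
  qed
  define R where "R m = (\<Sum>k. (c (k + m))\<^sup>2)" for m
  have R: "(LINT x|M. (G n x - G m x)\<^sup>2) \<le> R m" if "m \<le> n" for m n
  proof -
    have "(LINT x|M. (G n x - G m x)\<^sup>2) = (L2_norm M (\<lambda>x. G n x - G m x))\<^sup>2"
      by (rule L2_norm_sq_integral[symmetric])
    also have "\<dots> = (\<Sum>k\<in>{m..<n}. (c k)\<^sup>2)"
      unfolding diff_G[OF that] by (rule basis_sum_norm_sq[OF e]) simp
    also have "\<dots> = (\<Sum>k<n-m. (c (k + m))\<^sup>2)"
      using sum.shift_bounds_nat_ivl[of "\<lambda>k. (c k)\<^sup>2" 0 m "n - m"] that
      by (simp add: atLeast0LessThan)
    also have "\<dots> \<le> R m"
      unfolding R_def by (rule sum_le_suminf) (use c in \<open>auto simp: summable_iff_shift[of "\<lambda>k. (c k)\<^sup>2"]\<close>)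
    finally show ?thesis .
  qed
  have R_lim: "R \<longlonglongrightarrow> 0"
  proof -
    have "(\<lambda>m. suminf (\<lambda>k. (c k)\<^sup>2) - (\<Sum>k<m. (c k)\<^sup>2)) \<longlonglongrightarrow> suminf (\<lambda>k. (c k)\<^sup>2) - suminf (\<lambda>k. (c k)\<^sup>2)"
      by (intro tendsto_diff tendsto_const summable_LIMSEQ c)
    moreover have "R = (\<lambda>m. suminf (\<lambda>k. (c k)\<^sup>2) - (\<Sum>k<m. (c k)\<^sup>2))"
      unfolding R_def using suminf_minus_initial_segment[OF c] by auto
    ultimately show ?thesis by simp
  qed
  have "\<exists>N. \<forall>j. R (N j) \<le> (1/4)^j \<and> N j < N (Suc j)"
  proof (rule dependent_nat_choice)
    show "\<exists>x. R x \<le> (1/4)^0"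
      using order_tendstoD(2)[OF R_lim, of 1] by (auto simp: eventually_sequentially intro: less_imp_le)
  next
    fix x :: nat and n :: nat
    have "\<forall>\<^sub>F m in sequentially. R m < (1/4)^Suc n \<and> x < m"
      by (intro eventually_conj order_tendstoD(2)[OF R_lim] eventually_gt_at_top) simp
    then show "\<exists>y. R y \<le> (1/4)^Suc n \<and> x < y"
      by (auto simp: eventually_sequentially intro: less_imp_le)
  qed
  then obtain N where N: "\<And>j. R (N j) \<le> (1/4)^j" "\<And>j. N j < N (Suc j)" by auto
  have N_mono: "strict_mono N" using N(2) by (simp add: strict_mono_Suc_iff)
  define D where "D j x = G (N (Suc j)) x - G (N j) x" for j x
  have D: "D j \<in> L2_space M" for j unfolding D_def[abs_def] by (rule L2_space_diff[OF G G])
  have DM[measurable]: "D j \<in> borel_measurable M" for j using L2_spaceD[OF D] by auto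
  have D_le: "(LINT x|M. (D j x)\<^sup>2) \<le> (1/4)^j" for j
    using R[of "N j" "N (Suc j)"] N[of j] by (simp add: D_def)
  have "(\<integral>\<^sup>+x. (\<Sum>j. ennreal (2^j * (D j x)\<^sup>2)) \<partial>M) = (\<Sum>j. \<integral>\<^sup>+x. ennreal (2^j * (D j x)\<^sup>2) \<partial>M)"
    by (rule nn_integral_suminf) measurable
  also have "\<dots> \<le> (\<Sum>j. ennreal ((1/2)^j))"
  proof (intro suminf_le summableI)
    fix j
    have "(\<integral>\<^sup>+x. ennreal (2^j * (D j x)\<^sup>2) \<partial>M) = ennreal (LINT x|M. 2^j * (D j x)\<^sup>2)"
      by (rule nn_integral_eq_integral) (use L2_spaceD[OF D[of j]] in auto)
    also have "(LINT x|M. 2^j * (D j x)\<^sup>2) \<le> 2^j * (1/4)^j"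
      using D_le[of j] by simp
    also have "(2::real)^j * (1/4)^j = (2 * (1/4))^j" by (rule power_mult_distrib[symmetric])
    finally show "(\<integral>\<^sup>+x. ennreal (2^j * (D j x)\<^sup>2) \<partial>M) \<le> ennreal ((1/2)^j)" by (simp only: ennreal_leI) simp
  qed
  also have "\<dots> = ennreal (\<Sum>j. (1/2)^j)" by (rule suminf_ennreal2) auto
  finally have "(\<integral>\<^sup>+x. (\<Sum>j. ennreal (2^j * (D j x)\<^sup>2)) \<partial>M) \<noteq> \<infinity>" by (auto simp: top_unique)
  then have "AE x in M. (\<Sum>j. ennreal (2^j * (D j x)\<^sup>2)) \<noteq> \<infinity>"
    by (rule nn_integral_PInf_AE[rotated]) measurable
  then have conv: "AE x in M. convergent (\<lambda>j. G (N j) x)"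
  proof eventually_elim
    case (elim x)
    have s1: "summable (\<lambda>j. 2^j * (D j x)\<^sup>2)"
      by (rule summable_suminf_not_top) (use elim in auto)
    have s2: "summable (\<lambda>j. (1/2)^j + 2^j * (D j x)\<^sup>2)"
      by (intro summable_add s1) simp
    have "\<bar>D j x\<bar> \<le> (1/2)^j + 2^j * (D j x)\<^sup>2" for j
    proof -
      have "2 * (1 * (2^j * \<bar>D j x\<bar>)) \<le> 1\<^sup>2 + (2^j * \<bar>D j x\<bar>)\<^sup>2"
        using sum_squares_bound[of 1 "2^j * \<bar>D j x\<bar>"] by simp
      then have "(1/2)^j * (2 * (2^j * \<bar>D j x\<bar>)) \<le> (1/2)^j * (1 + (2^j * \<bar>D j x\<bar>)\<^sup>2)"
        by (intro mult_left_mono) auto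
      also have "\<dots> = (1/2)^j + ((1/2)^j * 2^j) * (2^j * (D j x)\<^sup>2)"
        by (simp add: distrib_left power_mult_distrib power2_eq_square mult_ac)
      also have "(1/2)^j * (2 * (2^j * \<bar>D j x\<bar>)) = 2 * (((1/2)^j * 2^j) * \<bar>D j x\<bar>)"
        by (simp only: mult_ac)
      also have "(1/2)^j * (2::real)^j = 1" by (simp add: power_one_over)
      finally have "2 * \<bar>D j x\<bar> \<le> (1/2)^j + 2^j * (D j x)\<^sup>2" by simp
      then show ?thesis by linarith
    qed
    then have "summable (\<lambda>j. D j x)"
      by (intro summable_comparison_test[OF _ s2]) auto
    then have "convergent (\<lambda>n. \<Sum>j<n. D j x)" by (simp add: summable_iff_convergent)
    then have "convergent (\<lambda>n. (\<Sum>j<n. D j x) + G (N 0) x)"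
      by (intro convergent_add convergent_const)
    moreover have "(\<Sum>j<n. D j x) + G (N 0) x = G (N n) x" for n
      unfolding D_def by (subst sum_lessThan_telescope) simp
    ultimately show ?case by simp
  qed
  define g where "g x = lim (\<lambda>j. G (N j) x)" for x
  have g_meas[measurable]: "g \<in> borel_measurable M"
    unfolding g_def[abs_def] by (rule borel_measurable_lim_metric) measurable
  have lim: "AE x in M. (\<lambda>j. G (N j) x) \<longlonglongrightarrow> g x"
    using conv unfolding g_def by (auto simp: convergent_LIMSEQ_iff)
  have fatou: "(\<integral>\<^sup>+x. ennreal ((g x - G m x)\<^sup>2) \<partial>M) \<le> ennreal (R m)" for m
  proof -
    have "(\<integral>\<^sup>+x. ennreal ((g x - G m x)\<^sup>2) \<partial>M)
        = (\<integral>\<^sup>+x. liminf (\<lambda>j. ennreal ((G (N j) x - G m x)\<^sup>2)) \<partial>M)"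
    proof (rule nn_integral_cong_AE, use lim in eventually_elim)
      case (elim x)
      have "(\<lambda>j. ennreal ((G (N j) x - G m x)\<^sup>2)) \<longlonglongrightarrow> ennreal ((g x - G m x)\<^sup>2)"
        by (intro tendsto_intros elim)
      then show ?case by (rule lim_imp_Liminf[OF sequentially_bot, symmetric])
    qed
    also have "\<dots> \<le> liminf (\<lambda>j. \<integral>\<^sup>+x. ennreal ((G (N j) x - G m x)\<^sup>2) \<partial>M)"
      by (rule nn_integral_liminf) measurable
    also have "\<dots> \<le> liminf (\<lambda>j::nat. ennreal (R m))"
    proof (rule Liminf_mono)
      show "\<forall>\<^sub>F j in sequentially. (\<integral>\<^sup>+x. ennreal ((G (N j) x - G m x)\<^sup>2) \<partial>M) \<le> ennreal (R m)"
        using eventually_ge_at_top[of m]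
      proof eventually_elim
        case (elim j)
        have "(\<integral>\<^sup>+x. ennreal ((G (N j) x - G m x)\<^sup>2) \<partial>M) = ennreal (LINT x|M. (G (N j) x - G m x)\<^sup>2)"
          by (rule nn_integral_eq_integral) (use L2_spaceD[OF L2_space_diff[OF G G]] in auto)
        also have "\<dots> \<le> ennreal (R m)"
          using R[of m "N j"] strict_mono_imp_increasing[OF N_mono, of j] elim by (intro ennreal_leI) simp
        finally show ?case .
      qed
    qed
    also have "\<dots> = ennreal (R m)" by (simp add: Liminf_const)
    finally show ?thesis .
  qed
  have gd: "(\<lambda>x. g x - G m x) \<in> L2_space M" for m
  proof -
    have "integrable M (\<lambda>x. (g x - G m x)\<^sup>2)"
    proof (rule integrableI_bounded)
      show "(\<integral>\<^sup>+x. ennreal (norm ((g x - G m x)\<^sup>2)) \<partial>M) < \<infinity>"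
        using le_less_trans[OF fatou[of m] ennreal_less_top] by simp
    qed measurable
    then show ?thesis by (simp add: L2_space_def)
  qed
  have g: "g \<in> L2_space M" using L2_space_add[OF gd[of 0] G[of 0]] by simp
  have R0: "0 \<le> R m" for m
    unfolding R_def by (rule suminf_nonneg) (use c in \<open>auto simp: summable_iff_shift[of "\<lambda>k. (c k)\<^sup>2"]\<close>)
  have "(L2_norm M (\<lambda>x. G m x - g x))\<^sup>2 \<le> R m" for m
  proof -
    have "ennreal (LINT x|M. (g x - G m x)\<^sup>2) \<le> ennreal (R m)"
      using fatou[of m] nn_integral_eq_integral[of M "\<lambda>x. (g x - G m x)\<^sup>2"] L2_spaceD[OF gd[of m]] by simp
    then show ?thesis
      using R0[of m] by (simp add: L2_norm_diff_commute[of M "G m"] L2_norm_sq_integral)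
  qed
  then have "L2_norm M (\<lambda>x. G m x - g x) \<le> sqrt (R m)" for m
    by (simp add: real_le_rsqrt)
  moreover have "(\<lambda>m. sqrt (R m)) \<longlonglongrightarrow> 0"
    using tendsto_real_sqrt[OF R_lim] by simp
  ultimately have norm_lim: "(\<lambda>m. L2_norm M (\<lambda>x. G m x - g x)) \<longlonglongrightarrow> 0"
    using Lim_null_comparison[of "\<lambda>m. L2_norm M (\<lambda>x. G m x - g x)" "\<lambda>m. sqrt (R m)" sequentially]
    by (simp add: L2_norm_nonneg)
  have "L2_inner M g (e k) = c k" for k
  proof (rule LIMSEQ_unique)
    show "(\<lambda>m. L2_inner M (G m) (e k)) \<longlonglongrightarrow> L2_inner M g (e k)"
      by (rule L2_inner_tendsto[OF G g orthonormal_basisD(1)[OF e] norm_lim])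
    have "\<forall>\<^sub>F m in sequentially. L2_inner M (G m) (e k) = c k"
      using eventually_gt_at_top[of k] unfolding G_def
      by eventually_elim (simp add: basis_sum_coeff[OF e])
    then show "(\<lambda>m. L2_inner M (G m) (e k)) \<longlonglongrightarrow> c k" by (simp add: tendsto_eventually)
  qed
  then show ?thesis using g by blast
qed

section \<open>Integration over intervals\<close>

abbreviation leb_I :: "real \<Rightarrow> real \<Rightarrow> real measure" where
  "leb_I a b \<equiv> lebesgue_on {a<..<b}"

lemma lebesgue_on_integrable_iff:
  fixes f :: "real \<Rightarrow> real"
  assumes "S \<in> sets lebesgue"
  shows "integrable (lebesgue_on S) f \<longleftrightarrow> integrable lebesgue (\<lambda>x. indicator S x * f x)"
  using assms by (simp add: integrable_restrict_space)

lemma lebesgue_on_integral_eq: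
  fixes f :: "real \<Rightarrow> real"
  assumes "S \<in> sets lebesgue"
  shows "(LINT x|lebesgue_on S. f x) = (LINT x|lebesgue. indicator S x * f x)"
  using assms by (simp add: integral_restrict_space)

lemma AE_lebesgue_on_iff:
  assumes "S \<in> sets lebesgue"
  shows "(AE x in lebesgue_on S. P x) \<longleftrightarrow> (AE x in lebesgue. x \<in> S \<longrightarrow> P x)"
  using assms by (simp add: AE_restrict_space_iff)

lemma integrable_subinterval:
  fixes f :: "real \<Rightarrow> real"
  assumes "integrable (leb_I a b) f" "a \<le> c" "d \<le> b"
  shows "integrable (leb_I c d) f"
proof -
  have "integrable lebesgue (\<lambda>x. indicator {c<..<d} x *\<^sub>R (indicator {a<..<b} x * f x))"
    by (rule integrable_mult_indicator) (use assms(1) in \<open>simp_all add: lebesgue_on_integrable_iff\<close>)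
  moreover have "(\<lambda>x. indicator {c<..<d} x *\<^sub>R (indicator {a<..<b} x * f x)) = (\<lambda>x. indicator {c<..<d} x * f x)"
    using assms(2,3) by (auto simp: indicator_def)
  ultimately show ?thesis by (simp add: lebesgue_on_integrable_iff)
qed

lemma AE_subinterval:
  assumes "AE x in lebesgue_on {a<..<b::real}. P x" "a \<le> c" "d \<le> b"
  shows "AE x in leb_I c d. P x"
proof -
  have "AE x in lebesgue. x \<in> {a<..<b} \<longrightarrow> P x" using assms(1) by (simp add: AE_lebesgue_on_iff)
  then have "AE x in lebesgue. x \<in> {c<..<d} \<longrightarrow> P x"
    by eventually_elim (use assms(2,3) in auto)
  then show ?thesis by (simp add: AE_lebesgue_on_iff)
qed

lemma integrable_imp_integrable_on:
  fixes f :: "real \<Rightarrow> real"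
  assumes "integrable (leb_I a b) f"
  shows "f integrable_on {a..b}"
  using integrable_on_lebesgue_on[OF assms] by (simp add: integrable_on_Icc_iff_Ioo)

lemma LINT_eq_integral:
  fixes f :: "real \<Rightarrow> real"
  assumes "integrable (leb_I a b) f"
  shows "(LINT x|leb_I a b. f x) = integral {a..b} f"
  using lebesgue_integral_eq_integral[OF assms] by (simp add: integral_open_interval_real)

lemma LINT_primitive_eq:
  fixes f :: "real \<Rightarrow> real"
  assumes "integrable (leb_I a b) f" "t \<le> b"
  shows "(LINT x|leb_I a t. f x) = integral {a..t} f"
  using LINT_eq_integral[OF integrable_subinterval[OF assms(1) order_refl assms(2)]] .

lemma LINT_combine:
  fixes f :: "real \<Rightarrow> real"
  assumes f: "integrable (leb_I a b) f" and c: "a \<le> c" "c \<le> d" "d \<le> b"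
  shows "(LINT x|leb_I a d. f x)
    = (LINT x|leb_I a c. f x) + (LINT x|leb_I c d. f x)"
proof -
  note i = integrable_subinterval[OF f]
  have "integral {a..c} f + integral {c..d} f = integral {a..d} f"
    by (rule Henstock_Kurzweil_Integration.integral_combine[OF c(1,2) integrable_imp_integrable_on[OF i]])
      (use c in auto)
  then show ?thesis
    using c by (simp add: LINT_eq_integral[OF i])
qed

lemma continuous_on_primitive:
  fixes f :: "real \<Rightarrow> real"
  assumes "integrable (leb_I a b) f"
  shows "continuous_on {a..b} (\<lambda>t. LINT x|leb_I a t. f x)"
proof -
  have "continuous_on {a..b} (\<lambda>t. integral {a..t} f)"
    by (rule indefinite_integral_continuous_1[OF integrable_imp_integrable_on[OF assms]])
  then show ?thesis
    by (rule continuous_on_eq) (simp add: LINT_primitive_eq[OF assms])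
qed

lemma continuous_integrable_open_interval:
  fixes f :: "real \<Rightarrow> real"
  assumes "continuous_on {a..b} f"
  shows "integrable (leb_I a b) f"
proof -
  have "f absolutely_integrable_on {a<..<b}"
    using absolutely_integrable_continuous_real[OF assms]
    by (rule set_integrable_subset) auto
  then show ?thesis by (rule absolutely_integrable_imp_integrable) simp
qed

lemma bounded_mult_integrable:
  fixes p \<psi> :: "real \<Rightarrow> real"
  assumes p: "integrable (leb_I a b) p" and c: "continuous_on {a..b} \<psi>"
  shows "integrable (leb_I a b) (\<lambda>t. p t * \<psi> t)"
proof -
  obtain B where B: "\<And>t. t \<in> {a..b} \<Longrightarrow> \<bar>\<psi> t\<bar> \<le> B"
    using compact_imp_bounded[OF compact_continuous_image[OF c compact_Icc]]
    unfolding bounded_iff by fastforce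
  show ?thesis
  proof (rule Bochner_Integration.integrable_bound[of _ "\<lambda>t. B * p t"])
    show "(\<lambda>t. p t * \<psi> t) \<in> borel_measurable (leb_I a b)"
      using p continuous_integrable_open_interval[OF c] by (auto dest!: borel_measurable_integrable)
    show "AE t in leb_I a b. norm (p t * \<psi> t) \<le> norm (B * p t)"
    proof (rule AE_I2)
      fix t assume "t \<in> space (leb_I a b)"
      then have "\<bar>\<psi> t\<bar> \<le> \<bar>B\<bar>" using B[of t] by simp
      then show "norm (p t * \<psi> t) \<le> norm (B * p t)"
        by (simp add: abs_mult mult.commute mult_right_mono)
    qed
  qed (use p in simp)
qed

lemma LINT_FTC:
  fixes F f :: "real \<Rightarrow> real"
  assumes "a \<le> b" "continuous_on {a..b} f"
    and "\<And>t. a \<le> t \<Longrightarrow> t \<le> b \<Longrightarrow> (F has_real_derivative f t) (at t)"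
  shows "(LINT t|leb_I a b. f t) = F b - F a"
proof -
  have "(f has_integral (F b - F a)) {a..b}"
    by (rule fundamental_theorem_of_calculus)
      (use assms in \<open>auto simp: has_real_derivative_iff_has_vector_derivative intro: has_vector_derivative_at_within\<close>)
  then show ?thesis
    by (simp add: LINT_eq_integral[OF continuous_integrable_open_interval[OF assms(2)]] integral_unique)
qed

lemma LINT_reflect:
  fixes f :: "real \<Rightarrow> real"
  shows "(LINT r|leb_I a b. f (c - r)) = (LINT r|lebesgue_on {c-b<..<c-a}. f r)"
proof -
  have "(LINT r|lebesgue_on {c-b<..<c-a}. f r) = (LINT r|lebesgue. indicator {c-b<..<c-a} r * f r)"
    by (simp add: lebesgue_on_integral_eq)
  also have "\<dots> = (LINT r|lebesgue. indicator {c-b<..<c-a} (c + (-1) * r) * f (c + (-1) * r))"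
    using lebesgue_integral_real_affine[of "-1" "\<lambda>r. indicator {c-b<..<c-a} r * f r" c] by simp
  also have "\<dots> = (LINT r|lebesgue. indicator {a<..<b} r * f (c - r))"
    by (intro Bochner_Integration.integral_cong) (auto simp: indicator_def)
  finally show ?thesis by (simp add: lebesgue_on_integral_eq)
qed

lemma integrable_reflect:
  fixes f :: "real \<Rightarrow> real"
  assumes "integrable (lebesgue_on {c-b<..<c-a}) f"
  shows "integrable (leb_I a b) (\<lambda>r. f (c - r))"
proof -
  have "integrable lebesgue (\<lambda>r. indicator {c-b<..<c-a} r * f r)"
    using assms by (simp add: lebesgue_on_integrable_iff)
  from lebesgue_integrable_real_affine[OF this, of "-1" c]
  have "integrable lebesgue (\<lambda>r. indicator {c-b<..<c-a} (c - r) * f (c - r))" by simp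
  moreover have "(\<lambda>r. indicator {c-b<..<c-a} (c - r) * f (c - r)) = (\<lambda>r. indicator {a<..<b} r * f (c - r))"
    by (auto simp: indicator_def fun_eq_iff)
  ultimately show ?thesis by (simp add: lebesgue_on_integrable_iff)
qed

text \<open>Since Lebesgue measure is complete, functions that agree almost everywhere are either both
  measurable or both not, and in the latter case both integrals have the default value zero.\<close>

lemma lebesgue_on_integral_cong_AE:
  fixes f g :: "real \<Rightarrow> real"
  assumes S: "S \<in> sets lebesgue" and eq: "AE x in lebesgue_on S. f x = g x"
  shows "(LINT x|lebesgue_on S. f x) = (LINT x|lebesgue_on S. g x)"
    and "integrable (lebesgue_on S) f \<longleftrightarrow> integrable (lebesgue_on S) g"
proof -
  let ?f = "\<lambda>x. indicator S x * f x" and ?g = "\<lambda>x. indicator S x * g x"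
  have "AE x in lebesgue. x \<in> S \<longrightarrow> f x = g x" using eq S by (simp add: AE_lebesgue_on_iff)
  then have eq': "AE x in lebesgue. ?f x = ?g x" by eventually_elim (simp add: indicator_def)
  then have eq'': "AE x in lebesgue. ?g x = ?f x" by eventually_elim (rule sym)
  have m: "?f \<in> borel_measurable lebesgue \<longleftrightarrow> ?g \<in> borel_measurable lebesgue"
    using borel_measurable_AE[OF _ eq'] borel_measurable_AE[OF _ eq''] by blast
  have "(LINT x|lebesgue. ?f x) = (LINT x|lebesgue. ?g x) \<and> (integrable lebesgue ?f \<longleftrightarrow> integrable lebesgue ?g)"
  proof (cases "?f \<in> borel_measurable lebesgue")
    case True
    with m have "?g \<in> borel_measurable lebesgue" by simp
    then show ?thesis
      using integral_cong_AE[OF True _ eq'] integrable_cong_AE[OF True _ eq'] by blast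
  next
    case False
    then have "\<not> integrable lebesgue ?f" "\<not> integrable lebesgue ?g"
      using m borel_measurable_integrable by blast+
    then show ?thesis by (simp add: not_integrable_integral_eq)
  qed
  then show "(LINT x|lebesgue_on S. f x) = (LINT x|lebesgue_on S. g x)"
    "integrable (lebesgue_on S) f \<longleftrightarrow> integrable (lebesgue_on S) g"
    using S by (simp_all add: lebesgue_on_integral_eq lebesgue_on_integrable_iff)
qed

lemma AE_lebesgue_affine:
  fixes c :: real
  assumes c: "c \<noteq> 0" and P: "AE x in lebesgue. P x"
  shows "AE x in lebesgue. P (t + c * x)"
proof -
  have "AE x in lborel. P x" using P by (simp add: AE_completion_iff)
  then obtain N where N: "{x. \<not> P x} \<subseteq> N" "N \<in> null_sets lborel"
    by (auto simp: eventually_ae_filter)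
  have "AE x in lborel. x \<notin> N" by (rule AE_not_in[OF N(2)])
  moreover have "Measurable.pred borel (\<lambda>x. x \<notin> N)"
    using N(2) by (auto simp: null_sets_def pred_def intro!: sets.sets_Collect)
  ultimately have "AE x in lborel. t + c * x \<notin> N"
    using AE_borel_affine[OF c] by blast
  then have "AE x in lborel. P (t + c * x)"
    by eventually_elim (use N(1) in auto)
  then show ?thesis by (rule AE_completion)
qed

lemma AE_reflect:
  fixes c :: real
  assumes "AE x in leb_I a b. P x"
  shows "AE x in lebesgue_on {c-b<..<c-a}. P (c - x)"
proof -
  have "AE x in lebesgue. x \<in> {a<..<b} \<longrightarrow> P x"
    using assms by (simp add: AE_lebesgue_on_iff)
  from AE_lebesgue_affine[OF _ this, of "-1" c]
  have "AE x in lebesgue. c - x \<in> {a<..<b} \<longrightarrow> P (c - x)" by simp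
  then have "AE x in lebesgue. x \<in> {c-b<..<c-a} \<longrightarrow> P (c - x)"
    by eventually_elim auto
  then show ?thesis by (simp add: AE_lebesgue_on_iff)
qed

lemma continuous_AE_eq_imp_eq:
  fixes f g :: "real \<Rightarrow> real"
  assumes "a < b" "continuous_on {a..b} f" "continuous_on {a..b} g"
    and AE: "AE t in leb_I a b. f t = g t" and t: "t \<in> {a..b}"
  shows "f t = g t"
proof -
  let ?N = "{t \<in> {a<..<b}. f t - g t \<noteq> 0}"
  have cont: "continuous_on {a<..<b} (\<lambda>t. f t - g t)"
    by (intro continuous_on_diff continuous_on_subset[OF assms(2)] continuous_on_subset[OF assms(3)]) auto
  have "open ?N"
  proof -
    have "open ({a<..<b} \<inter> (\<lambda>t. f t - g t) -` (-{0}))"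
      by (rule continuous_open_preimage[OF cont]) auto
    moreover have "{a<..<b} \<inter> (\<lambda>t. f t - g t) -` (-{0}) = ?N" by auto
    ultimately show ?thesis by simp
  qed
  moreover have "negligible ?N"
  proof -
    have "AE t in lebesgue. t \<notin> ?N"
      using AE by (simp add: AE_lebesgue_on_iff) (auto elim!: eventually_mono)
    then have "{t \<in> space lebesgue. \<not> t \<notin> ?N} \<in> null_sets lebesgue"
      by (rule completion.AE_iff_null_sets[THEN iffD1])
    moreover have "{t \<in> space lebesgue. \<not> t \<notin> ?N} = ?N" by auto
    ultimately have "?N \<in> null_sets lebesgue" by simp
    then show ?thesis by (simp add: negligible_iff_null_sets)
  qed
  ultimately have "?N = {}" using open_not_negligible by blast
  then have zero: "f x - g x = 0" if "x \<in> {a<..<b}" for x using that by auto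
  have "continuous_on (closure {a<..<b}) (\<lambda>t. f t - g t)"
    using assms(1-3) by (auto intro!: continuous_on_diff)
  then have "f t - g t = 0"
    by (rule continuous_constant_on_closure) (use t assms(1) zero in auto)
  then show ?thesis by simp
qed

text \<open>Lebesgue measurable functions are replaced by Borel measurable ones, since only the latter
  stay measurable, on the product space, when composed with \<open>(t, r) \<mapsto> t - r\<close>.\<close>

lemma borel_version:
  fixes f :: "real \<Rightarrow> real"
  assumes "S \<in> sets lebesgue" "f \<in> borel_measurable (lebesgue_on S)"
  obtains f' where "f' \<in> borel_measurable borel" "AE x in lebesgue. f' x = indicator S x * f x"
proof -
  have "(\<lambda>x. indicator S x *\<^sub>R f x) \<in> borel_measurable lebesgue"
    using assms borel_measurable_restrict_space_iff[of S lebesgue f] by simp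
  from completion_ex_borel_measurable_real[OF this]
  obtain f' where "f' \<in> borel_measurable lborel" "AE x in lborel. indicator S x *\<^sub>R f x = f' x" by auto
  then show ?thesis
    by (intro that[of f']) (auto dest!: AE_completion elim!: eventually_mono)
qed

lemma borel_version_integrable:
  fixes f :: "real \<Rightarrow> real"
  assumes S: "S \<in> sets lebesgue" and f: "integrable (lebesgue_on S) f"
  obtains f' where "integrable lborel f'" "AE x in lebesgue. f' x = indicator S x * f x"
proof -
  obtain f' where f': "f' \<in> borel_measurable borel" "AE x in lebesgue. f' x = indicator S x * f x"
    using borel_version[OF S borel_measurable_integrable[OF f]] .
  have "integrable lebesgue (\<lambda>x. indicator S x * f x)"
    using f S by (simp add: lebesgue_on_integrable_iff)
  moreover have "integrable lebesgue f' \<longleftrightarrow> integrable lebesgue (\<lambda>x. indicator S x * f x)"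
    by (rule integrable_cong_AE)
      (use f' calculation in \<open>auto intro: measurable_completion dest: borel_measurable_integrable\<close>)
  ultimately have "integrable lborel f'"
    using f'(1) by (simp add: integrable_completion)
  then show ?thesis using f'(2) that by blast
qed

lemma borel_version_bounded:
  fixes f :: "real \<Rightarrow> real"
  assumes S: "S \<in> sets lebesgue" and f: "f \<in> borel_measurable (lebesgue_on S)"
    and C: "AE x in lebesgue_on S. \<bar>f x\<bar> \<le> C"
  obtains f' where "f' \<in> borel_measurable borel" "AE x in lebesgue. f' x = indicator S x * f x"
    "\<And>x. \<bar>f' x\<bar> \<le> \<bar>C\<bar>"
proof -
  obtain f0 where f0: "f0 \<in> borel_measurable borel" "AE x in lebesgue. f0 x = indicator S x * f x"
    using borel_version[OF S f] .
  define f' where "f' x = max (- \<bar>C\<bar>) (min \<bar>C\<bar> (f0 x))" for x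
  have [measurable]: "f0 \<in> borel_measurable borel" by (rule f0)
  have "f' \<in> borel_measurable borel" unfolding f'_def[abs_def] by measurable
  moreover have "\<bar>f' x\<bar> \<le> \<bar>C\<bar>" for x by (auto simp: f'_def)
  moreover have "AE x in lebesgue. f' x = indicator S x * f x"
  proof -
    have "AE x in lebesgue. x \<in> S \<longrightarrow> \<bar>f x\<bar> \<le> C"
      using C S by (simp add: AE_lebesgue_on_iff)
    then show ?thesis using f0(2)
      by eventually_elim (auto simp: f'_def indicator_def split: if_splits)
  qed
  ultimately show ?thesis using that by blast
qed

lemma LINT_lborel_eq_lebesgue_on:
  fixes f g :: "real \<Rightarrow> real"
  assumes S: "S \<in> sets lebesgue" and f: "f \<in> borel_measurable borel"
    and eq: "AE x in lebesgue. f x = indicator S x * g x"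
  shows "(LINT x|lborel. f x) = (LINT x|lebesgue_on S. g x)"
    and "integrable lborel f \<longleftrightarrow> integrable (lebesgue_on S) g"
proof -
  have f': "f \<in> borel_measurable lebesgue" using f by (auto intro: measurable_completion)
  have "(LINT x|lborel. f x) = (LINT x|lebesgue. f x)"
    using f by (simp add: integral_completion)
  also have "\<dots> = (LINT x|lebesgue. indicator S x * g x)"
    by (rule integral_cong_AE[OF f' borel_measurable_AE[OF f' eq] eq])
  finally show "(LINT x|lborel. f x) = (LINT x|lebesgue_on S. g x)"
    using S by (simp add: lebesgue_on_integral_eq)
  have "integrable lborel f \<longleftrightarrow> integrable lebesgue f"
    using f by (simp add: integrable_completion)
  also have "\<dots> \<longleftrightarrow> integrable lebesgue (\<lambda>x. indicator S x * g x)"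
    by (rule integrable_cong_AE[OF f' borel_measurable_AE[OF f' eq] eq])
  finally show "integrable lborel f \<longleftrightarrow> integrable (lebesgue_on S) g"
    using S by (simp add: lebesgue_on_integrable_iff)
qed

lemma integrable_shifted_kernel:
  fixes g K :: "real \<Rightarrow> real"
  assumes g: "integrable (leb_I a b) g"
    and K: "K \<in> borel_measurable (lebesgue_on {0<..<b-a})"
    and KC: "AE t in lebesgue_on {0<..<b-a}. \<bar>K t\<bar> \<le> C" and r: "a \<le> r"
  shows "integrable (leb_I r b) (\<lambda>t. K (t - r) * g t)"
proof -
  obtain g' where g': "integrable lborel g'" "AE x in lebesgue. g' x = indicator {a<..<b} x * g x"
    using borel_version_integrable[OF _ g] by auto
  obtain K' where K'm[measurable]: "K' \<in> borel_measurable borel"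
    and K': "AE x in lebesgue. K' x = indicator {0<..<b-a} x * K x" and K'C: "\<And>x. \<bar>K' x\<bar> \<le> \<bar>C\<bar>"
    using borel_version_bounded[OF _ K KC] by auto
  have [measurable]: "g' \<in> borel_measurable borel" using g' by auto
  have "integrable lborel (\<lambda>t. K' (t - r) * g' t)"
    by (rule Bochner_Integration.integrable_bound[of _ "\<lambda>t. C * g' t"])
      (use g'(1) K'C in \<open>auto simp: abs_mult intro!: AE_I2 mult_right_mono\<close>)
  moreover have "AE t in lebesgue. K' (t - r) * g' t = indicator {r<..<b} t * (K (t - r) * g t)"
  proof -
    have "AE t in lebesgue. K' (t - r) = indicator {0<..<b-a} (t - r) * K (t - r)"
      using AE_lebesgue_affine[OF _ K', of 1 "-r"] by simp
    then show ?thesis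
      using g'(2) by eventually_elim (use r in \<open>auto simp: indicator_def\<close>)
  qed
  ultimately show ?thesis
    using LINT_lborel_eq_lebesgue_on(2)[of "{r<..<b}" "\<lambda>t. K' (t - r) * g' t"] by auto
qed

text \<open>Both sides are the integral of \<open>g(t) K(t - r) e(r)\<close> over the triangle \<open>a < r < t < b\<close>.\<close>

lemma Fubini_triangle:
  fixes e g K :: "real \<Rightarrow> real"
  assumes e: "integrable (leb_I a b) e" and g: "integrable (leb_I a b) g"
    and K: "K \<in> borel_measurable (lebesgue_on {0<..<b-a})"
    and KC: "AE t in lebesgue_on {0<..<b-a}. \<bar>K t\<bar> \<le> C"
  shows "(LINT t|leb_I a b. g t * (LINT r|leb_I a t. K (t - r) * e r))
       = (LINT r|leb_I a b. e r * (LINT t|leb_I r b. K (t - r) * g t))"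
    and "integrable (leb_I a b) (\<lambda>t. g t * (LINT r|leb_I a t. K (t - r) * e r))"
    and "integrable (leb_I a b) (\<lambda>r. e r * (LINT t|leb_I r b. K (t - r) * g t))"
proof -
  let ?I = "leb_I a b"
  obtain e' where e': "integrable lborel e'" "AE x in lebesgue. e' x = indicator {a<..<b} x * e x"
    using borel_version_integrable[OF _ e] by auto
  obtain g' where g': "integrable lborel g'" "AE x in lebesgue. g' x = indicator {a<..<b} x * g x"
    using borel_version_integrable[OF _ g] by auto
  define D where "D = \<bar>C\<bar>"
  obtain K' where K'm[measurable]: "K' \<in> borel_measurable borel"
    and K': "AE x in lebesgue. K' x = indicator {0<..<b-a} x * K x" and K'D: "\<And>x. \<bar>K' x\<bar> \<le> D"
    using borel_version_bounded[OF _ K KC] unfolding D_def by auto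
  have [measurable]: "e' \<in> borel_measurable borel" "g' \<in> borel_measurable borel"
    using e' g' by auto
  define \<Phi> where "\<Phi> t r = g' t * (e' r * K' (t - r))" for t r
  have \<Phi>_int: "integrable (lborel \<Otimes>\<^sub>M lborel) (case_prod \<Phi>)"
  proof (rule lborel_pair.Fubini_integrable)
    show [measurable]: "case_prod \<Phi> \<in> borel_measurable (lborel \<Otimes>\<^sub>M lborel)"
      unfolding \<Phi>_def[abs_def] by measurable
    have bound: "\<bar>e' r * K' x\<bar> \<le> D * \<bar>e' r\<bar>" for r x
      using mult_left_mono[OF K'D[of x], of "\<bar>e' r\<bar>"] by (simp add: abs_mult mult.commute)
    have eK: "integrable lborel (\<lambda>r. e' r * K' (t - r))" for t
      by (rule Bochner_Integration.integrable_bound[of _ "\<lambda>r. D * e' r"])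
        (use e'(1) bound in \<open>auto simp: D_def abs_mult intro!: AE_I2\<close>)
    then show "AE t in lborel. integrable lborel (\<lambda>r. case_prod \<Phi> (t, r))"
      by (simp add: \<Phi>_def)
    show "integrable lborel (\<lambda>t. LINT r|lborel. norm (case_prod \<Phi> (t, r)))"
    proof (rule Bochner_Integration.integrable_bound[of _ "\<lambda>t. (D * (LINT r|lborel. \<bar>e' r\<bar>)) * g' t"])
      show "AE t in lborel. norm (LINT r|lborel. norm (case_prod \<Phi> (t, r)))
          \<le> norm ((D * (LINT r|lborel. \<bar>e' r\<bar>)) * g' t)"
      proof (rule AE_I2)
        fix t
        have "(LINT r|lborel. \<bar>e' r * K' (t - r)\<bar>) \<le> (LINT r|lborel. D * \<bar>e' r\<bar>)"
          by (rule integral_mono)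
            (use eK e'(1) bound in auto)
        then have "\<bar>g' t\<bar> * (LINT r|lborel. \<bar>e' r * K' (t - r)\<bar>) \<le> \<bar>g' t\<bar> * (D * (LINT r|lborel. \<bar>e' r\<bar>))"
          by (intro mult_left_mono) auto
        moreover have "(LINT r|lborel. norm (case_prod \<Phi> (t, r))) = \<bar>g' t\<bar> * (LINT r|lborel. \<bar>e' r * K' (t - r)\<bar>)"
          by (simp add: \<Phi>_def abs_mult)
        moreover have "0 \<le> (LINT r|lborel. norm (case_prod \<Phi> (t, r)))" by (rule integral_nonneg_AE) simp
        ultimately show "norm (LINT r|lborel. norm (case_prod \<Phi> (t, r)))
          \<le> norm ((D * (LINT r|lborel. \<bar>e' r\<bar>)) * g' t)"
          by (simp add: abs_mult D_def mult_ac)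
      qed
    qed (use g' in auto)
  qed
  have swap: "(LINT t|lborel. LINT r|lborel. \<Phi> t r) = (LINT r|lborel. LINT t|lborel. \<Phi> t r)"
    using lborel_pair.Fubini_integral[OF \<Phi>_int] by simp
  have inner_r: "(LINT r|lborel. e' r * K' (t - r)) = (LINT r|leb_I a t. K (t - r) * e r)"
    if t: "t \<in> {a<..<b}" for t
  proof (rule LINT_lborel_eq_lebesgue_on(1))
    have "AE r in lebesgue. K' (t - r) = indicator {0<..<b-a} (t - r) * K (t - r)"
      using AE_lebesgue_affine[OF _ K', of "-1" t] by simp
    then show "AE r in lebesgue. e' r * K' (t - r) = indicator {a<..<t} r * (K (t - r) * e r)"
      using e'(2) by eventually_elim (use t in \<open>auto simp: indicator_def\<close>)
  qed auto
  have inner_t: "(LINT t|lborel. g' t * K' (t - r)) = (LINT t|leb_I r b. K (t - r) * g t)"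
    if r: "r \<in> {a<..<b}" for r
  proof (rule LINT_lborel_eq_lebesgue_on(1))
    have "AE t in lebesgue. K' (t - r) = indicator {0<..<b-a} (t - r) * K (t - r)"
      using AE_lebesgue_affine[OF _ K', of 1 "-r"] by simp
    then show "AE t in lebesgue. g' t * K' (t - r) = indicator {r<..<b} t * (K (t - r) * g t)"
      using g'(2) by eventually_elim (use r in \<open>auto simp: indicator_def\<close>)
  qed auto
  have t_eq: "(LINT r|lborel. \<Phi> t r) = g' t * (LINT r|lborel. e' r * K' (t - r))" for t
    by (simp add: \<Phi>_def)
  have "(\<lambda>t. LINT r|lborel. \<Phi> t r) \<in> borel_measurable borel"
    unfolding t_eq by measurable
  moreover have "AE t in lebesgue. (LINT r|lborel. \<Phi> t r)
      = indicator {a<..<b} t * (g t * (LINT r|leb_I a t. K (t - r) * e r))"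
    unfolding t_eq using g'(2) by eventually_elim (auto simp: indicator_def inner_r)
  ultimately have 1: "(LINT t|lborel. LINT r|lborel. \<Phi> t r)
      = (LINT t|?I. g t * (LINT r|leb_I a t. K (t - r) * e r))"
    and int1: "integrable lborel (\<lambda>t. LINT r|lborel. \<Phi> t r) \<longleftrightarrow>
      integrable ?I (\<lambda>t. g t * (LINT r|leb_I a t. K (t - r) * e r))"
    using LINT_lborel_eq_lebesgue_on[of "{a<..<b}" "\<lambda>t. LINT r|lborel. \<Phi> t r"] by auto
  have r_eq: "(LINT t|lborel. \<Phi> t r) = e' r * (LINT t|lborel. g' t * K' (t - r))" for r
    unfolding \<Phi>_def mult.left_commute[of _ "e' r"] by simp
  have "(\<lambda>r. LINT t|lborel. \<Phi> t r) \<in> borel_measurable borel"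
    unfolding r_eq by measurable
  moreover have "AE r in lebesgue. (LINT t|lborel. \<Phi> t r)
      = indicator {a<..<b} r * (e r * (LINT t|leb_I r b. K (t - r) * g t))"
    unfolding r_eq using e'(2) by eventually_elim (auto simp: indicator_def inner_t)
  ultimately have 2: "(LINT r|lborel. LINT t|lborel. \<Phi> t r)
      = (LINT r|?I. e r * (LINT t|leb_I r b. K (t - r) * g t))"
    and int2: "integrable lborel (\<lambda>r. LINT t|lborel. \<Phi> t r) \<longleftrightarrow>
      integrable ?I (\<lambda>r. e r * (LINT t|leb_I r b. K (t - r) * g t))"
    using LINT_lborel_eq_lebesgue_on[of "{a<..<b}" "\<lambda>r. LINT t|lborel. \<Phi> t r"] by auto
  show "(LINT t|?I. g t * (LINT r|leb_I a t. K (t - r) * e r))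
       = (LINT r|?I. e r * (LINT t|leb_I r b. K (t - r) * g t))"
    using 1 2 swap by simp
  show "integrable ?I (\<lambda>t. g t * (LINT r|leb_I a t. K (t - r) * e r))"
    using int1 lborel_pair.integrable_fst[OF \<Phi>_int] by simp
  show "integrable ?I (\<lambda>r. e r * (LINT t|leb_I r b. K (t - r) * g t))"
    using int2 lborel_pair.integrable_snd[OF \<Phi>_int] by simp
qed

text \<open>An absolutely continuous function enters as the primitive of an integrable \<open>p\<close>; the formula is
  Fubini's theorem on the triangle with the constant kernel 1.\<close>

lemma LINT_by_parts:
  fixes p \<psi> \<psi>' :: "real \<Rightarrow> real"
  assumes p: "integrable (leb_I a b) p"
    and c: "continuous_on {a..b} \<psi>'"
    and d: "\<And>t. a \<le> t \<Longrightarrow> t \<le> b \<Longrightarrow> (\<psi> has_real_derivative \<psi>' t) (at t)"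
  shows "(LINT t|leb_I a b. (LINT r|leb_I a t. p r) * \<psi>' t)
    = (LINT t|leb_I a b. p t) * \<psi> b - (LINT t|leb_I a b. p t * \<psi> t)"
proof -
  let ?I = "leb_I a b"
  have c\<psi>: "continuous_on {a..b} \<psi>"
    using d by (auto intro!: DERIV_continuous_on[of _ _ \<psi>'] intro: has_field_derivative_at_within)
  have p\<psi>: "integrable ?I (\<lambda>t. p t * \<psi> t)"
    by (rule bounded_mult_integrable[OF p c\<psi>])
  have "(LINT t|?I. (LINT r|leb_I a t. p r) * \<psi>' t)
     = (LINT t|?I. \<psi>' t * (LINT r|leb_I a t. 1 * p r))"
    by (simp add: mult.commute)
  also have "\<dots> = (LINT r|?I. p r * (LINT t|leb_I r b. 1 * \<psi>' t))"
    using Fubini_triangle(1)[OF p continuous_integrable_open_interval[OF c], of "\<lambda>_. 1" 1] by simp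
  also have "\<dots> = (LINT r|?I. p r * \<psi> b - p r * \<psi> r)"
  proof (rule Bochner_Integration.integral_cong)
    fix r assume "r \<in> space ?I"
    then have r: "a < r" "r < b" by auto
    have "(LINT t|leb_I r b. \<psi>' t) = \<psi> b - \<psi> r"
      by (rule LINT_FTC) (use r d in \<open>auto intro: continuous_on_subset[OF c]\<close>)
    then show "p r * (LINT t|leb_I r b. 1 * \<psi>' t) = p r * \<psi> b - p r * \<psi> r"
      by (simp add: right_diff_distrib)
  qed simp
  also have "\<dots> = (LINT t|?I. p t) * \<psi> b - (LINT t|?I. p t * \<psi> t)"
    using p p\<psi> by simp
  finally show ?thesis .
qed

text \<open>Open intervals form an intersection-stable generator of the Borel sets, so the integral vanishes
  over every Borel set.\<close>

lemma AE_zero_if_interval_integrals_zero: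
  fixes d :: "real \<Rightarrow> real"
  assumes d: "integrable (leb_I a b) d"
    and 0: "\<And>p q. a \<le> p \<Longrightarrow> p \<le> q \<Longrightarrow> q \<le> b \<Longrightarrow> (LINT t|leb_I p q. d t) = 0"
  shows "AE t in leb_I a b. d t = 0"
proof -
  obtain d' where d': "integrable lborel d'" "AE x in lebesgue. d' x = indicator {a<..<b} x * d x"
    using borel_version_integrable[OF _ d] by auto
  have [measurable]: "d' \<in> borel_measurable borel" using d' by auto
  have ind_d': "set_integrable lborel A d'" if "A \<in> sets borel" for A
    unfolding set_integrable_def by (rule integrable_mult_indicator) (use that d' in auto)
  have interval: "(LINT x:{p<..<q}|lborel. d' x) = 0" for p q
  proof -
    have "(LINT x:{p<..<q}|lborel. d' x) = (LINT x|lebesgue_on {max a p<..<min b q}. d x)"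
      unfolding set_lebesgue_integral_def
    proof (rule LINT_lborel_eq_lebesgue_on(1))
      show "AE x in lebesgue. indicator {p<..<q} x *\<^sub>R d' x = indicator {max a p<..<min b q} x * d x"
        using d'(2) by eventually_elim (auto simp: indicator_def)
    qed (auto intro!: borel_measurable_times)
    also have "\<dots> = 0"
    proof (cases "max a p \<le> min b q")
      case True then show ?thesis by (intro 0) auto
    next
      case False
      then have "{max a p<..<min b q} = {}" by auto
      then show ?thesis by simp
    qed
    finally show ?thesis .
  qed
  let ?G = "range (\<lambda>(p, q). {p<..<q::real})"
  have G: "sets borel = sigma_sets UNIV ?G"
    unfolding borel_eq_box by (simp add: box_real split_def)
  have borel: "(LINT x:A|lborel. d' x) = 0" if "A \<in> sigma_sets UNIV ?G" for A
  proof -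
    have "Int_stable ?G"
    proof (rule Int_stableI)
      fix A B assume "A \<in> ?G" "B \<in> ?G"
      then obtain p q r s where "A = {p<..<q}" "B = {r<..<s}" by auto
      then have "A \<inter> B = (\<lambda>(p, q). {p<..<q}) (max p r, min q s)" by auto
      then show "A \<inter> B \<in> ?G" by (rule range_eqI)
    qed
    moreover have "?G \<subseteq> Pow UNIV" by simp
    ultimately show ?thesis using that
    proof (induction rule: sigma_sets_induct_disjoint)
      case (compl A)
      then have A: "A \<in> sets borel" by (simp add: G)
      have "(LINT x:UNIV|lborel. d' x) = (LINT x:A|lborel. d' x) + (LINT x:UNIV - A|lborel. d' x)"
        using set_integral_Un[of A "UNIV - A" lborel d'] ind_d'[OF A] ind_d'[of "UNIV - A"] A by auto
      moreover have "(LINT x:UNIV|lborel. d' x) = (LINT x:{a<..<b}|lborel. d' x)"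
        unfolding set_lebesgue_integral_def
      proof (rule integral_cong_AE)
        have "AE x in lborel. d' x = indicator {a<..<b} x * d x" using d'(2) by (simp add: AE_completion_iff)
        then show "AE x in lborel. indicator UNIV x *\<^sub>R d' x = indicator {a<..<b} x *\<^sub>R d' x"
          by eventually_elim (auto simp: indicator_def)
      qed auto
      ultimately show ?case using interval compl by simp
    next
      case (union A)
      then have A: "A i \<in> sets borel" for i unfolding G by auto
      have "(LINT x:(\<Union>i. A i)|lborel. d' x) = (\<Sum>i. (LINT x:(A i)|lborel. d' x))"
      proof (rule lebesgue_integral_countable_add)
        show "set_integrable lborel (\<Union>i. A i) d'" by (rule ind_d') (use A in auto)
      qed (use A union(1) in \<open>auto simp: disjoint_family_on_def\<close>)
      then show ?case using union by simp
    qed (use interval in \<open>auto simp: set_lebesgue_integral_def\<close>)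
  qed
  have "AE x in lborel. d' x = 0"
    by (rule sigma_finite_measure.density_zero[OF sigma_finite_lborel d'(1)]) (use borel in \<open>simp add: G\<close>)
  then have "AE x in lebesgue. d' x = 0" by (rule AE_completion)
  then have "AE x in lebesgue. x \<in> {a<..<b} \<longrightarrow> d x = 0"
    using d'(2) by eventually_elim (auto simp: indicator_def)
  then show ?thesis by (simp add: AE_lebesgue_on_iff)
qed

section \<open>Weak derivatives on an interval\<close>

lemma test_functions_continuous:
  assumes "\<psi> \<in> test_functions a b"
  shows "(\<psi> has_real_derivative deriv \<psi> t) (at t)" "continuous_on S \<psi>" "continuous_on S (deriv \<psi>)"
proof -
  have d: "(\<psi> has_real_derivative deriv \<psi> t) (at t)" for t
    using assms by (auto simp: test_functions_def DERIV_deriv_iff_real_differentiable)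
  then show "(\<psi> has_real_derivative deriv \<psi> t) (at t)" .
  show "continuous_on S \<psi>"
    by (rule continuous_at_imp_continuous_on) (use d DERIV_isCont in blast)
  show "continuous_on S (deriv \<psi>)"
    using assms by (auto simp: test_functions_def intro: continuous_on_subset)
qed

lemma test_functions_zero:
  assumes "\<psi> \<in> test_functions a b" "t \<le> a \<or> b \<le> t"
  shows "\<psi> t = 0"
  using assms by (force simp: test_functions_def)

lemma primitive_by_parts_test:
  fixes p :: "real \<Rightarrow> real"
  assumes p: "integrable (leb_I a b) p" and \<psi>: "\<psi> \<in> test_functions a b"
  shows "(LINT t|leb_I a b. (LINT r|leb_I a t. p r) * deriv \<psi> t)
    = - (LINT t|leb_I a b. p t * \<psi> t)"
  using LINT_by_parts[OF p test_functions_continuous(3)[OF \<psi>] test_functions_continuous(1)[OF \<psi>]]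
    test_functions_zero[OF \<psi>, of b] by simp

text \<open>An antiderivative is constant on either side of the support; mean value zero makes the two
  constants equal, and subtracting them leaves a test function.\<close>

lemma antiderivative_test_function:
  fixes \<eta> :: "real \<Rightarrow> real"
  assumes c: "continuous_on UNIV \<eta>" and supp: "\<And>t. t \<notin> {c..d} \<Longrightarrow> \<eta> t = 0"
    and cd: "a < c" "c \<le> d" "d < b" and 0: "(LINT t|leb_I a b. \<eta> t) = 0"
  obtains \<psi> where "\<psi> \<in> test_functions a b" "deriv \<psi> = \<eta>"
proof -
  have "\<exists>F. \<forall>x::real. -\<infinity> < ereal x \<longrightarrow> ereal x < \<infinity> \<longrightarrow> (F has_vector_derivative \<eta> x) (at x)"
    by (rule einterval_antiderivative) (use c in \<open>auto simp: continuous_on_eq_continuous_at\<close>)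
  then obtain F where F: "\<And>x. (F has_real_derivative \<eta> x) (at x)"
    by (auto simp: has_real_derivative_iff_has_vector_derivative)
  define \<psi> where "\<psi> x = F x - F a" for x
  have \<psi>: "(\<psi> has_real_derivative \<eta> x) (at x)" for x
    unfolding \<psi>_def[abs_def] using F[of x] by (auto intro!: derivative_eq_intros)
  have deriv: "deriv \<psi> = \<eta>" using \<psi> by (auto intro: DERIV_imp_deriv)
  have int: "(LINT t|leb_I x y. \<eta> t) = \<psi> y - \<psi> x" if "x \<le> y" for x y
    by (rule LINT_FTC[OF that continuous_on_subset[OF c]]) (auto intro: \<psi>)
  have vanish: "(LINT t|leb_I x y. \<eta> t) = 0" if "y \<le> c \<or> d \<le> x" for x y
  proof -
    have "(LINT t|leb_I x y. \<eta> t) = (LINT t|leb_I x y. 0)"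
      by (rule Bochner_Integration.integral_cong) (use supp that in auto)
    then show ?thesis by simp
  qed
  have \<psi>a: "\<psi> a = 0" by (simp add: \<psi>_def)
  have left: "\<psi> t = 0" if "t \<le> c" for t
  proof (cases "a \<le> t")
    case True then show ?thesis using int[of a t] vanish[of t a] that \<psi>a by simp
  next
    case False then show ?thesis using int[of t a] vanish[of a t] cd \<psi>a by simp
  qed
  have \<psi>b: "\<psi> b = 0" using int[of a b] 0 cd \<psi>a by simp
  have right: "\<psi> t = 0" if "d \<le> t" for t
  proof (cases "b \<le> t")
    case True then show ?thesis using int[of b t] vanish[of t b] cd \<psi>b by simp
  next
    case False then show ?thesis using int[of t b] vanish[of b t] that \<psi>b by simp
  qed
  have "\<psi> \<in> test_functions a b"
  proof -
    have "\<psi> differentiable at t" for t using \<psi>[of t] by (auto simp: real_differentiable_def)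
    moreover have "\<psi> t = 0" if "t \<notin> {c..d}" for t using that left right by (cases "t \<le> c") auto
    ultimately show ?thesis using c cd by (auto simp: test_functions_def deriv)
  qed
  then show ?thesis using deriv that by blast
qed

text \<open>Continuous trapezoidal functions, supported inside \<open>(p, q)\<close>, that converge to the
  indicator of \<open>(p, q)\<close>; here \<open>p\<close> and \<open>q\<close> may be the end points of the interval of integration.\<close>

definition trapezoid :: "real \<Rightarrow> real \<Rightarrow> nat \<Rightarrow> real \<Rightarrow> real" where
  "trapezoid p q n t = max 0 (min 1 (min (n * (t - p) - 1) (n * (q - t) - 1)))"

lemma trapezoid_continuous: "continuous_on S (trapezoid p q n)"
  unfolding trapezoid_def[abs_def] by (intro continuous_intros)

lemma trapezoid_bound: "\<bar>trapezoid p q n t\<bar> \<le> 1"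
  by (auto simp: trapezoid_def)

lemma trapezoid_support:
  assumes "0 < n" "t \<notin> {p + 1/n..q - 1/n}"
  shows "trapezoid p q n t = 0"
proof -
  have "real n * (t - p) < 1 \<or> real n * (q - t) < 1"
    using assms by (auto simp: field_simps not_le)
  then show ?thesis by (auto simp: trapezoid_def)
qed

lemma trapezoid_tendsto: "(\<lambda>n. trapezoid p q n t) \<longlonglongrightarrow> indicator {p<..<q} t"
proof (cases "t \<in> {p<..<q}")
  case True
  have "\<forall>\<^sub>F n in sequentially. 2 / (t - p) \<le> real n \<and> 2 / (q - t) \<le> real n"
    using filterlim_real_sequentially by (intro eventually_conj) (auto simp: filterlim_at_top)
  then have "\<forall>\<^sub>F n in sequentially. trapezoid p q n t = 1"
    by eventually_elim (use True in \<open>auto simp: trapezoid_def field_simps min_def max_def\<close>)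
  then show ?thesis using True by (simp add: tendsto_eventually)
next
  case False
  have "trapezoid p q n t = 0" for n
  proof -
    have "real n * (t - p) \<le> 0 \<or> real n * (q - t) \<le> 0"
      using False by (auto simp: mult_le_0_iff not_less)
    then show ?thesis by (auto simp: trapezoid_def)
  qed
  then show ?thesis using False by simp
qed

lemma trapezoid_integral_tendsto:
  fixes d :: "real \<Rightarrow> real"
  assumes d: "integrable (leb_I a b) d" and pq: "a \<le> p" "q \<le> b"
  shows "(\<lambda>n. LINT t|leb_I a b. d t * trapezoid p q n t)
    \<longlonglongrightarrow> (LINT t|leb_I p q. d t)"
proof -
  let ?I = "leb_I a b"
  have "(\<lambda>n. LINT t|?I. d t * trapezoid p q n t)
    \<longlonglongrightarrow> (LINT t|?I. d t * indicator {p<..<q} t)"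
  proof (rule integral_dominated_convergence[where w="\<lambda>t. \<bar>d t\<bar>"])
    show "AE t in ?I. (\<lambda>n. d t * trapezoid p q n t) \<longlonglongrightarrow> d t * indicator {p<..<q} t"
      by (intro AE_I2 tendsto_mult tendsto_const trapezoid_tendsto)
    show "AE t in ?I. norm (d t * trapezoid p q n t) \<le> \<bar>d t\<bar>" for n
      using trapezoid_bound by (auto simp: abs_mult intro!: mult_left_le AE_I2)
    show "(\<lambda>t. d t * trapezoid p q n t) \<in> borel_measurable ?I" for n
      using borel_measurable_integrable[OF bounded_mult_integrable[OF d trapezoid_continuous]] .
    show "(\<lambda>t. d t * indicator {p<..<q} t) \<in> borel_measurable ?I"
      by (intro borel_measurable_times borel_measurable_integrable[OF d] measurable_restrict_space1
          borel_measurable_indicator) auto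
  qed (use d in simp)
  also have "(LINT t|?I. d t * indicator {p<..<q} t) = (LINT t|leb_I p q. d t)"
  proof -
    have "(\<lambda>t. indicator {a<..<b} t * (d t * indicator {p<..<q} t)) = (\<lambda>t. indicator {p<..<q} t * d t)"
      using pq by (auto simp: indicator_def fun_eq_iff)
    then show ?thesis by (simp add: lebesgue_on_integral_eq)
  qed
  finally show ?thesis .
qed

text \<open>The du Bois-Reymond lemma: after subtraction of a primitive of \<open>p\<close>, the function is
  orthogonal to all continuous \<open>\<eta>\<close> with compact support and mean zero. Subtracting a multiple of one
  fixed trapezoid of mass different from zero removes the condition on the mean.\<close>

lemma weak_deriv_primitive:
  fixes g p :: "real \<Rightarrow> real"
  assumes ab: "a < b" and g: "integrable (leb_I a b) g"
    and p: "integrable (leb_I a b) p" and w: "weak_deriv a b g p"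
  obtains c where "AE t in leb_I a b. g t = c + (LINT r|leb_I a t. p r)"
proof -
  let ?M = "leb_I a b"
  define P where "P t = (LINT r|leb_I a t. p r)" for t
  have P: "integrable ?M P"
    unfolding P_def[abs_def] by (rule continuous_integrable_open_interval[OF continuous_on_primitive[OF p]])
  define d where "d t = g t - P t" for t
  have d: "integrable ?M d" unfolding d_def[abs_def] using g P by simp
  have ortho: "(LINT t|?M. d t * \<eta> t) = 0"
    if \<eta>: "continuous_on UNIV \<eta>" "\<And>t. t \<notin> {e..f} \<Longrightarrow> \<eta> t = 0" "a < e" "e \<le> f" "f < b"
      "(LINT t|?M. \<eta> t) = 0" for \<eta> e f
  proof -
    obtain \<psi> where \<psi>: "\<psi> \<in> test_functions a b" "deriv \<psi> = \<eta>"
      using antiderivative_test_function[OF \<eta>] .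
    have c: "continuous_on {a..b} \<eta>" using \<eta>(1) by (rule continuous_on_subset) simp
    have "(LINT t|?M. d t * \<eta> t) = (LINT t|?M. g t * \<eta> t) - (LINT t|?M. P t * \<eta> t)"
      unfolding d_def
      using bounded_mult_integrable[OF g c] bounded_mult_integrable[OF P c] by (simp add: left_diff_distrib)
    also have "(LINT t|?M. g t * \<eta> t) = - (LINT t|?M. p t * \<psi> t)"
      using w \<psi> by (auto simp: weak_deriv_def)
    also have "(LINT t|?M. P t * \<eta> t) = - (LINT t|?M. p t * \<psi> t)"
      using primitive_by_parts_test[OF p \<psi>(1)] \<psi>(2) by (simp add: P_def)
    finally show ?thesis by simp
  qed
  have one: "integrable ?M (\<lambda>_. k)" for k :: real
    by (rule continuous_integrable_open_interval) simp
  have "(\<lambda>n. LINT t|?M. 1 * trapezoid a b n t) \<longlonglongrightarrow> (LINT t|?M. 1)"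
    by (rule trapezoid_integral_tendsto[OF one]) auto
  moreover have "(LINT t|?M. 1) = b - a"
    using LINT_FTC[of a b "\<lambda>_. 1" "\<lambda>t. t"] ab by simp
  ultimately have "(\<lambda>n. LINT t|?M. trapezoid a b n t) \<longlonglongrightarrow> b - a" by simp
  then have "\<forall>\<^sub>F n in sequentially. 0 < (LINT t|?M. trapezoid a b n t)"
    using order_tendstoD(1)[of _ "b - a" sequentially 0] ab by simp
  moreover have "\<forall>\<^sub>F n in sequentially. 2 / (b - a) < real n"
    using filterlim_real_sequentially by (auto simp: filterlim_at_top_dense)
  ultimately have "\<forall>\<^sub>F n in sequentially. 0 < (LINT t|?M. trapezoid a b n t) \<and> 2 / (b - a) < real n"
    by (rule eventually_conj)
  \<comment> \<open>The second condition makes \<open>{a + 1/n..b - 1/n}\<close> a nonempty interval for \<open>n > m\<close>.\<close>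
  then obtain m where m: "0 < (LINT t|?M. trapezoid a b m t)" "2 / (b - a) < real m"
    by (auto simp: eventually_sequentially)
  have m0: "0 < m" using m(2) ab by (cases m) auto
  define I where "I = (LINT t|?M. trapezoid a b m t)"
  define c where "c = (LINT t|?M. d t * trapezoid a b m t) / I"
  have T: "integrable ?M (trapezoid p q n)" for p q n
    by (rule continuous_integrable_open_interval[OF trapezoid_continuous])
  have zero: "(LINT t|leb_I p q. d t - c) = 0" if pq: "a \<le> p" "p \<le> q" "q \<le> b" for p q
  proof -
    have "(\<lambda>n. LINT t|?M. (d t - c) * trapezoid p q n t) \<longlonglongrightarrow> (LINT t|leb_I p q. d t - c)"
      by (rule trapezoid_integral_tendsto) (use d one pq in auto)
    moreover have "\<forall>\<^sub>F n in sequentially. (LINT t|?M. (d t - c) * trapezoid p q n t) = 0"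
    proof (use eventually_gt_at_top[of m] in eventually_elim)
      case (elim n)
      define k where "k = (LINT t|?M. trapezoid p q n t) / I"
      define \<eta> where "\<eta> t = trapezoid p q n t - k * trapezoid a b m t" for t
      have "(LINT t|?M. d t * \<eta> t) = 0"
      proof (rule ortho)
        show "continuous_on UNIV \<eta>"
          unfolding \<eta>_def[abs_def] by (intro continuous_intros trapezoid_continuous)
        have n0: "0 < n" using elim by simp
        let ?\<epsilon> = "1 / real n"
        have \<epsilon>: "0 < ?\<epsilon>" "?\<epsilon> < 1 / real m" using elim m0 by (auto simp: frac_less2)
        show "\<eta> t = 0" if "t \<notin> {a + ?\<epsilon>..b - ?\<epsilon>}" for t
        proof -
          have "t \<notin> {p + 1 / real n..q - 1 / real n}" "t \<notin> {a + 1 / real m..b - 1 / real m}"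
            using that pq \<epsilon> by auto
          then show ?thesis
            using trapezoid_support[OF n0, of t p q] trapezoid_support[OF m0, of t a b] by (simp add: \<eta>_def)
        qed
        show "a < a + ?\<epsilon>" "b - ?\<epsilon> < b" using \<epsilon> by auto
        have "2 / real m < b - a" using m(2) m0 ab by (simp add: field_simps)
        then show "a + ?\<epsilon> \<le> b - ?\<epsilon>" using \<epsilon> by linarith
        show "(LINT t|?M. \<eta> t) = 0"
          unfolding \<eta>_def using T m(1) by (simp add: k_def I_def)
      qed
      moreover have "(LINT t|?M. d t * \<eta> t) = (LINT t|?M. (d t - c) * trapezoid p q n t)"
      proof -
        have Td: "integrable ?M (\<lambda>t. d t * trapezoid p q n t)" for p q n
          by (rule bounded_mult_integrable[OF d trapezoid_continuous])
        have "(LINT t|?M. d t * \<eta> t)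
            = (LINT t|?M. d t * trapezoid p q n t) - k * (LINT t|?M. d t * trapezoid a b m t)"
          unfolding \<eta>_def using Td[of p q n] Td[of a b m]
          by (simp add: right_diff_distrib mult.left_commute[of _ k])
        also have "\<dots> = (LINT t|?M. d t * trapezoid p q n t) - c * (LINT t|?M. trapezoid p q n t)"
          by (simp add: k_def c_def)
        also have "\<dots> = (LINT t|?M. (d t - c) * trapezoid p q n t)"
          using Td[of p q n] T[of p q n] by (simp add: left_diff_distrib)
        finally show ?thesis .
      qed
      ultimately show ?case by simp
    qed
    ultimately show ?thesis
      by (rule LIMSEQ_unique[OF _ tendsto_eventually])
  qed
  have "AE t in ?M. d t - c = 0"
    by (rule AE_zero_if_interval_integrals_zero) (use d one zero in auto)
  then have "AE t in ?M. g t = c + P t"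
    by eventually_elim (simp add: d_def)
  then show ?thesis using that by (simp add: P_def)
qed

text \<open>The difference of two weak derivatives is a weak derivative of zero, so its primitive is constant
  and all its integrals over intervals vanish.\<close>

lemma weak_deriv_unique:
  fixes g p q :: "real \<Rightarrow> real"
  assumes ab: "a < b"
    and p: "integrable (leb_I a b) p" and q: "integrable (leb_I a b) q"
    and wp: "weak_deriv a b g p" and wq: "weak_deriv a b g q"
  shows "AE t in leb_I a b. p t = q t"
proof -
  let ?M = "leb_I a b"
  have pq: "integrable ?M (\<lambda>t. p t - q t)" using p q by simp
  have "weak_deriv a b (\<lambda>_. 0) (\<lambda>t. p t - q t)"
    unfolding weak_deriv_def
  proof
    fix \<psi> assume \<psi>: "\<psi> \<in> test_functions a b"
    have c: "continuous_on {a..b} \<psi>" by (rule test_functions_continuous(2)[OF \<psi>])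
    have "(LINT t|?M. p t * \<psi> t) = (LINT t|?M. q t * \<psi> t)"
      using wp wq \<psi> unfolding weak_deriv_def by fastforce
    then show "(LINT t|?M. 0 * deriv \<psi> t) = - (LINT t|?M. (p t - q t) * \<psi> t)"
      using bounded_mult_integrable[OF p c] bounded_mult_integrable[OF q c]
      by (simp add: left_diff_distrib)
  qed
  then obtain c where c: "AE t in ?M. 0 = c + (LINT r|leb_I a t. p r - q r)"
    using weak_deriv_primitive[OF ab _ pq, of "\<lambda>_. 0"] by auto
  have all: "0 = c + (LINT r|leb_I a t. p r - q r)" if "t \<in> {a..b}" for t
    by (rule continuous_AE_eq_imp_eq[OF ab _ _ c that])
      (intro continuous_on_add continuous_on_const continuous_on_primitive[OF pq])+
  have "AE t in ?M. p t - q t = 0"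
  proof (rule AE_zero_if_interval_integrals_zero[OF pq])
    fix r s assume rs: "a \<le> r" "r \<le> s" "s \<le> b"
    show "(LINT t|leb_I r s. p t - q t) = 0"
      using LINT_combine[OF pq rs] all[of r] all[of s] rs by simp
  qed
  then show ?thesis by eventually_elim simp
qed

text \<open>Initial and final values are point values of the continuous representative, and the primitive
  formula holds for it at every point.\<close>

lemma weak_deriv_continuous_representative:
  fixes g G p :: "real \<Rightarrow> real"
  assumes ab: "a < b" and G: "continuous_on {a..b} G" and gG: "AE t in leb_I a b. g t = G t"
    and g: "integrable (leb_I a b) g"
    and p: "integrable (leb_I a b) p" and w: "weak_deriv a b g p" and t: "t \<in> {a..b}"
  shows "G t = G a + (LINT r|leb_I a t. p r)"
proof -
  obtain c where c: "AE t in leb_I a b. g t = c + (LINT r|leb_I a t. p r)"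
    using weak_deriv_primitive[OF ab g p w] .
  have eq: "AE t in leb_I a b. G t = c + (LINT r|leb_I a t. p r)"
    using c gG by eventually_elim simp
  have "G t = c + (LINT r|leb_I a t. p r)" if "t \<in> {a..b}" for t
    by (rule continuous_AE_eq_imp_eq[OF ab G _ eq that])
      (intro continuous_on_add continuous_on_const continuous_on_primitive[OF p])
  from this[of a] this[OF t] show ?thesis using ab by simp
qed

section \<open>The scalar equation \<open>z' + l z = p\<close> and convolution with its kernel\<close>

text \<open>This is the solution of \<open>z' + l z = p\<close> with \<open>z(0) = 0\<close>.\<close>

definition exp_conv :: "real \<Rightarrow> (real \<Rightarrow> real) \<Rightarrow> real \<Rightarrow> real" where
  "exp_conv l p t = (LINT r|leb_I 0 t. p (t - r) * exp (- l * r))"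

lemma exp_conv_reflect: "exp_conv l p t = (LINT r|leb_I 0 t. p r * exp (- l * (t - r)))"
  unfolding exp_conv_def
  using LINT_reflect[of 0 t "\<lambda>r. p r * exp (- l * (t - r))" t] by simp

lemma exp_conv_eq_primitive:
  "exp (l * t) * exp_conv l p t = (LINT r|leb_I 0 t. p r * exp (l * r))"
proof -
  have "exp (- l * (t - r)) = exp (- (l * t)) * exp (l * r)" for r
    by (simp add: right_diff_distrib flip: exp_add)
  then have "p r * exp (- l * (t - r)) = exp (- (l * t)) * (p r * exp (l * r))" for r
    by (simp only: mult.left_commute)
  then have "exp_conv l p t = exp (- (l * t)) * (LINT r|leb_I 0 t. p r * exp (l * r))"
    unfolding exp_conv_reflect by (simp only: integral_mult_right_zero)
  then show ?thesis by (simp add: mult.assoc[symmetric] flip: exp_add)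
qed

text \<open>Variation of constants: \<open>exp(l t)\<close> is an integrating factor, and the product rule is replaced by
  integration by parts against the primitive of \<open>p - l z\<close>.\<close>

lemma linear_ode_representative:
  fixes z Z p :: "real \<Rightarrow> real"
  assumes T: "0 < T" and Z: "continuous_on {0..T} Z" and zZ: "AE t in leb_I 0 T. z t = Z t"
    and z: "integrable (leb_I 0 T) z" and p: "integrable (leb_I 0 T) p"
    and w: "weak_deriv 0 T z (\<lambda>t. p t - l * z t)" and t: "t \<in> {0..T}"
  shows "exp (l * t) * Z t = Z 0 + (LINT r|leb_I 0 t. p r * exp (l * r))"
proof -
  let ?q = "\<lambda>t. p t - l * z t" and ?M = "leb_I 0 t"
  have q: "integrable (leb_I 0 T) ?q" using z p by simp
  have rep: "Z r = Z 0 + (LINT r|leb_I 0 r. ?q r)" if "r \<in> {0..T}" for r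
    by (rule weak_deriv_continuous_representative[OF T Z zZ z q w that])
  have sub: "integrable ?M f" if "integrable (leb_I 0 T) f" for f :: "real \<Rightarrow> real"
    using integrable_subinterval[OF that] t by simp
  have E: "continuous_on {0..t} (\<lambda>r. exp (l * r))" by (intro continuous_intros)
  have lE: "continuous_on {0..t} (\<lambda>r. l * exp (l * r))" by (intro continuous_intros)
  have Zi: "integrable ?M Z"
    by (rule continuous_integrable_open_interval) (use t in \<open>auto intro: continuous_on_subset[OF Z]\<close>)
  note ZE = bounded_mult_integrable[OF Zi E]
  note zE = bounded_mult_integrable[OF sub[OF z] E]
  note pE = bounded_mult_integrable[OF sub[OF p] E]
  have lEi: "integrable ?M (\<lambda>r. l * exp (l * r))" by (rule continuous_integrable_open_interval[OF lE])
  have "(LINT s|?M. (LINT r|leb_I 0 s. ?q r) * (l * exp (l * s)))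
    = (LINT s|?M. ?q s) * exp (l * t) - (LINT s|?M. ?q s * exp (l * s))"
    by (rule LINT_by_parts[OF sub[OF q] lE]) (auto intro!: derivative_eq_intros)
  also have "(LINT s|?M. (LINT r|leb_I 0 s. ?q r) * (l * exp (l * s)))
    = (LINT s|?M. l * (Z s * exp (l * s)) - Z 0 * (l * exp (l * s)))"
  proof (rule Bochner_Integration.integral_cong)
    fix s assume "s \<in> space ?M"
    then have eq: "(LINT r|leb_I 0 s. ?q r) = Z s - Z 0" using rep[of s] t by simp
    show "(LINT r|leb_I 0 s. ?q r) * (l * exp (l * s))
        = l * (Z s * exp (l * s)) - Z 0 * (l * exp (l * s))"
      unfolding eq by (simp add: algebra_simps)
  qed simp
  also have "\<dots> = l * (LINT s|?M. Z s * exp (l * s)) - Z 0 * (LINT s|?M. l * exp (l * s))"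
    using ZE lEi by simp
  also have "(LINT s|?M. l * exp (l * s)) = exp (l * t) - 1"
    by (subst LINT_FTC[OF _ lE, where F="\<lambda>s. exp (l * s)"])
      (use t in \<open>auto intro!: derivative_eq_intros\<close>)
  also have "(LINT s|?M. ?q s * exp (l * s)) = (LINT s|?M. p s * exp (l * s)) - l * (LINT s|?M. z s * exp (l * s))"
    using pE zE by (simp add: left_diff_distrib mult.assoc)
  also have "(LINT s|?M. z s * exp (l * s)) = (LINT s|?M. Z s * exp (l * s))"
  proof (rule integral_cong_AE)
    have "AE s in ?M. z s = Z s" using AE_subinterval[OF zZ] t by simp
    then show "AE s in ?M. z s * exp (l * s) = Z s * exp (l * s)" by eventually_elim simp
  qed (use zE ZE in \<open>auto dest: borel_measurable_integrable\<close>)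
  also have "(LINT s|?M. ?q s) = Z t - Z 0" using rep[OF t] by simp
  finally show ?thesis by (simp add: algebra_simps)
qed

text \<open>Both sides are the time derivative of \<open>exp_conv l \<sigma>\<close>: on the left the convolution is differentiated
  through \<open>\<sigma>\<close>, on the right the differential equation is used.\<close>

lemma exp_conv_deriv:
  fixes \<sigma> \<sigma>' :: "real \<Rightarrow> real"
  assumes \<sigma>': "integrable (leb_I 0 T) \<sigma>'"
    and \<sigma>: "\<And>t. t \<in> {0..T} \<Longrightarrow> \<sigma> t = \<sigma> 0 + (LINT r|leb_I 0 t. \<sigma>' r)"
    and t: "t \<in> {0..T}"
  shows "\<sigma> 0 * exp (- l * t) + exp_conv l \<sigma>' t = \<sigma> t - l * exp_conv l \<sigma> t"
proof -
  let ?M = "leb_I 0 t"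
  have i: "integrable ?M \<sigma>'" using integrable_subinterval[OF \<sigma>'] t by simp
  have lE: "continuous_on {0..t} (\<lambda>r. l * exp (- l * (t - r)))" by (intro continuous_intros)
  have "continuous_on {0..T} (\<lambda>t. \<sigma> 0 + (LINT r|leb_I 0 t. \<sigma>' r))"
    by (intro continuous_on_add continuous_on_const continuous_on_primitive[OF \<sigma>'])
  then have "continuous_on {0..T} \<sigma>"
    by (rule continuous_on_eq) (rule \<sigma>[symmetric])
  then have \<sigma>c: "continuous_on {0..t} \<sigma>" by (rule continuous_on_subset) (use t in auto)
  have i2: "integrable ?M (\<lambda>s. \<sigma> s * (l * exp (- l * (t - s))))"
    by (intro continuous_integrable_open_interval continuous_on_mult \<sigma>c lE)
  have i3: "integrable ?M (\<lambda>s. l * exp (- l * (t - s)))"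
    by (rule continuous_integrable_open_interval[OF lE])
  have "exp_conv l \<sigma>' t = (LINT r|?M. \<sigma>' r * exp (- l * (t - r)))" by (rule exp_conv_reflect)
  also have "\<dots> = (LINT r|?M. \<sigma>' r) - (LINT s|?M. (LINT r|leb_I 0 s. \<sigma>' r) * (l * exp (- l * (t - s))))"
    by (subst LINT_by_parts[OF i lE, where \<psi>="\<lambda>r. exp (- l * (t - r))"])
      (auto intro!: derivative_eq_intros)
  also have "(LINT s|?M. (LINT r|leb_I 0 s. \<sigma>' r) * (l * exp (- l * (t - s))))
     = (LINT s|?M. \<sigma> s * (l * exp (- l * (t - s))) - \<sigma> 0 * (l * exp (- l * (t - s))))"
  proof (rule Bochner_Integration.integral_cong)
    fix s assume "s \<in> space ?M"
    then have "(LINT r|leb_I 0 s. \<sigma>' r) = \<sigma> s - \<sigma> 0" using \<sigma>[of s] t by simp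
    then show "(LINT r|leb_I 0 s. \<sigma>' r) * (l * exp (- l * (t - s)))
        = \<sigma> s * (l * exp (- l * (t - s))) - \<sigma> 0 * (l * exp (- l * (t - s)))"
      by (simp only: left_diff_distrib)
  qed simp
  also have "\<dots> = (LINT s|?M. \<sigma> s * (l * exp (- l * (t - s)))) - \<sigma> 0 * (LINT s|?M. l * exp (- l * (t - s)))"
    using i2 i3 by simp
  also have "(LINT s|?M. l * exp (- l * (t - s))) = 1 - exp (- l * t)"
    by (subst LINT_FTC[OF _ lE, where F="\<lambda>s. exp (- l * (t - s))"])
      (use t in \<open>auto intro!: derivative_eq_intros\<close>)
  also have "(LINT s|?M. \<sigma> s * (l * exp (- l * (t - s)))) = l * exp_conv l \<sigma> t"
    by (simp add: exp_conv_reflect mult.left_commute)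
  finally show ?thesis using \<sigma>[OF t] by (simp add: algebra_simps)
qed

section \<open>Square-integrable functions on subsets of the line\<close>

lemma L2_restrict:
  fixes A B :: "real set"
  assumes AB: "A \<subseteq> B" "A \<in> sets lebesgue" "B \<in> sets lebesgue" and f: "f \<in> L2_space (lebesgue_on B)"
  shows "f \<in> L2_space (lebesgue_on A)"
proof -
  have "f \<in> borel_measurable (lebesgue_on A)"
    using measurable_restrict_mono[OF L2_spaceD(1)[OF f] AB(1)] .
  moreover have "integrable lebesgue (\<lambda>x. indicator A x *\<^sub>R (indicator B x * (f x)\<^sup>2))"
    by (rule integrable_mult_indicator) (use L2_spaceD(2)[OF f] AB in \<open>simp_all add: lebesgue_on_integrable_iff\<close>)
  moreover have "(\<lambda>x. indicator A x *\<^sub>R (indicator B x * (f x)\<^sup>2)) = (\<lambda>x. indicator A x * (f x)\<^sup>2)"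
    using AB(1) by (auto simp: indicator_def fun_eq_iff)
  ultimately show ?thesis using AB by (simp add: L2_space_def lebesgue_on_integrable_iff)
qed

lemma L2_zero_extension:
  fixes A B :: "real set"
  assumes AB: "A \<subseteq> B" "A \<in> sets lebesgue" "B \<in> sets lebesgue" and f: "f \<in> L2_space (lebesgue_on A)"
  shows "(\<lambda>x. indicator A x * f x) \<in> L2_space (lebesgue_on B)"
proof -
  have "(\<lambda>x. indicator A x *\<^sub>R f x) \<in> borel_measurable lebesgue"
    using L2_spaceD(1)[OF f] AB borel_measurable_restrict_space_iff[of A lebesgue f] by simp
  then have "(\<lambda>x. indicator A x * f x) \<in> borel_measurable (lebesgue_on B)"
    by (simp add: measurable_restrict_space1)
  moreover have "(\<lambda>x. indicator B x * (indicator A x * f x)\<^sup>2) = (\<lambda>x. indicator A x * (f x)\<^sup>2)"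
    using AB(1) by (auto simp: indicator_def fun_eq_iff)
  ultimately show ?thesis
    using L2_spaceD(2)[OF f] AB by (simp add: L2_space_def lebesgue_on_integrable_iff)
qed

lemma L2_inner_restrict:
  fixes A B :: "real set"
  assumes AB: "A \<subseteq> B" "A \<in> sets lebesgue" "B \<in> sets lebesgue"
  shows "L2_inner (lebesgue_on A) f g = L2_inner (lebesgue_on B) f (\<lambda>x. indicator A x * g x)"
proof -
  have "(\<lambda>x. indicator B x * (f x * (indicator A x * g x))) = (\<lambda>x. indicator A x * (f x * g x))"
    using AB(1) by (auto simp: indicator_def fun_eq_iff)
  then show ?thesis using AB by (simp add: L2_inner_def lebesgue_on_integral_eq)
qed

lemma L2_norm_restrict:
  fixes A B :: "real set"
  assumes AB: "A \<subseteq> B" "A \<in> sets lebesgue" "B \<in> sets lebesgue" and f: "f \<in> L2_space (lebesgue_on B)"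
  shows "L2_norm (lebesgue_on A) f \<le> L2_norm (lebesgue_on B) f"
proof -
  have "(LINT x|lebesgue. indicator A x * (f x)\<^sup>2) \<le> (LINT x|lebesgue. indicator B x * (f x)\<^sup>2)"
    by (rule integral_mono)
      (use L2_spaceD(2)[OF f] L2_spaceD(2)[OF L2_restrict[OF AB f]] AB
        in \<open>auto simp: lebesgue_on_integrable_iff indicator_def\<close>)
  then have "(L2_norm (lebesgue_on A) f)\<^sup>2 \<le> (L2_norm (lebesgue_on B) f)\<^sup>2"
    using AB by (simp add: L2_norm_sq_integral lebesgue_on_integral_eq)
  then show ?thesis by (rule power2_le_imp_le) (rule L2_norm_nonneg)
qed

section \<open>Functions of time with values in a space of functions\<close>

text \<open>Completeness of Lebesgue measure absorbs the exceptional null set.\<close>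

lemma measurable_AE_limit:
  fixes f :: "real \<Rightarrow> real"
  assumes S: "S \<in> sets lebesgue"
    and m: "\<And>k. F k \<in> borel_measurable (lebesgue_on S)"
    and lim: "AE t in lebesgue_on S. (\<lambda>k. F k t) \<longlonglongrightarrow> f t"
  shows "f \<in> borel_measurable (lebesgue_on S)"
proof -
  have m': "(\<lambda>t. indicator S t * F k t) \<in> borel_measurable lebesgue" for k
    using m[of k] S borel_measurable_restrict_space_iff[of S lebesgue "F k"] by simp
  have "(\<lambda>t. lim (\<lambda>k. indicator S t * F k t)) \<in> borel_measurable lebesgue"
    using m' by (rule borel_measurable_lim_metric)
  moreover have "AE t in lebesgue. lim (\<lambda>k. indicator S t * F k t) = indicator S t * f t"
  proof -
    have "AE t in lebesgue. t \<in> S \<longrightarrow> (\<lambda>k. F k t) \<longlonglongrightarrow> f t"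
      using lim S by (simp add: AE_lebesgue_on_iff)
    then show ?thesis
      by eventually_elim (auto simp: indicator_def limI)
  qed
  ultimately have "(\<lambda>t. indicator S t * f t) \<in> borel_measurable lebesgue"
    by (rule borel_measurable_AE)
  then show ?thesis
    using S borel_measurable_restrict_space_iff[of S lebesgue f] by simp
qed

lemma simple_function_real_compose:
  fixes F :: "'v \<Rightarrow> real"
  assumes "simple_function M S"
  shows "(\<lambda>t. F (S t)) \<in> borel_measurable M"
  using simple_function_compose[OF assms, of F] by (simp add: borel_measurable_simple_function o_def)

lemma bochner_L2_L2E:
  assumes "v \<in> bochner_L2_L2 M a b"
  obtains S where "\<And>k. simple_function (leb_I a b) (S k)"
    "\<And>k t. t \<in> {a<..<b} \<Longrightarrow> S k t \<in> L2_space M"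
    "AE t in leb_I a b. v t \<in> L2_space M \<and> (\<lambda>k. L2_norm M (\<lambda>x. S k t x - v t x)) \<longlonglongrightarrow> 0"
proof -
  let ?I = "leb_I a b"
  have "strongly_measurable (L2_space M) (L2_norm M) a b v"
    and L2: "AE t in ?I. v t \<in> L2_space M"
    using assms by (simp_all add: bochner_L2_def)
  then obtain S where S: "\<forall>k. simple_function ?I (S k) \<and> (\<forall>t\<in>{a<..<b}. S k t \<in> L2_space M)"
    and lim: "AE t in ?I. (\<lambda>k. L2_norm M (S k t - v t)) \<longlonglongrightarrow> 0"
    unfolding strongly_measurable_def by blast
  show ?thesis
  proof (rule that)
    show "simple_function ?I (S k)" for k using S by blast
    show "S k t \<in> L2_space M" if "t \<in> {a<..<b}" for k t using S that by blast
    show "AE t in ?I. v t \<in> L2_space M \<and> (\<lambda>k. L2_norm M (\<lambda>x. S k t x - v t x)) \<longlonglongrightarrow> 0"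
      using L2 lim by eventually_elim (simp add: fun_diff_def)
  qed
qed

text \<open>Measurability of the norm comes from the approximating simple functions, so that a dominating
  function suffices for square integrability.\<close>

lemma bochner_L2_L2I:
  assumes S: "\<And>k. simple_function (leb_I a b) (S k)"
    "\<And>k t. t \<in> {a<..<b} \<Longrightarrow> S k t \<in> L2_space M"
    and lim: "AE t in leb_I a b. v t \<in> L2_space M \<and> (\<lambda>k. L2_norm M (\<lambda>x. S k t x - v t x)) \<longlonglongrightarrow> 0"
    and g: "integrable (leb_I a b) g" "AE t in leb_I a b. (L2_norm M (v t))\<^sup>2 \<le> g t"
  shows "v \<in> bochner_L2_L2 M a b"
proof -
  let ?I = "leb_I a b"
  have "(\<lambda>t. L2_norm M (v t)) \<in> borel_measurable ?I"
  proof (rule measurable_AE_limit)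
    show "(\<lambda>t. L2_norm M (S k t)) \<in> borel_measurable ?I" for k
      by (rule simple_function_real_compose[OF S(1)])
    show "AE t in ?I. (\<lambda>k. L2_norm M (S k t)) \<longlonglongrightarrow> L2_norm M (v t)"
      using lim AE_space by eventually_elim (auto intro!: L2_norm_tendsto S(2))
  qed simp
  then have "integrable ?I (\<lambda>t. (L2_norm M (v t))\<^sup>2)"
    by (intro Bochner_Integration.integrable_bound[OF g(1)])
      (use g(2) in \<open>auto elim!: eventually_mono\<close>)
  moreover have "strongly_measurable (L2_space M) (L2_norm M) a b v"
    unfolding strongly_measurable_def
    by (rule exI[of _ S]) (use S lim in \<open>auto simp: fun_diff_def\<close>)
  ultimately show ?thesis using lim by (auto simp: bochner_L2_def)
qed

lemma bochner_L2_L2D: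
  assumes v: "v \<in> bochner_L2_L2 M a b"
  shows "AE t in leb_I a b. v t \<in> L2_space M"
    and "integrable (leb_I a b) (\<lambda>t. (L2_norm M (v t))\<^sup>2)"
    and "integrable (leb_I a b) (\<lambda>t. L2_norm M (v t))"
    and "w \<in> L2_space M \<Longrightarrow> integrable (leb_I a b) (\<lambda>t. L2_inner M (v t) w)"
proof -
  let ?T = "leb_I a b"
  obtain S where S: "\<And>k. simple_function ?T (S k)" "\<And>k t. t \<in> {a<..<b} \<Longrightarrow> S k t \<in> L2_space M"
    "AE t in ?T. v t \<in> L2_space M \<and> (\<lambda>k. L2_norm M (\<lambda>x. S k t x - v t x)) \<longlonglongrightarrow> 0"
    by (rule bochner_L2_L2E[OF v]) (rule that)
  show L2: "AE t in ?T. v t \<in> L2_space M" using S(3) by auto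
  show sq: "integrable ?T (\<lambda>t. (L2_norm M (v t))\<^sup>2)" using v by (simp add: bochner_L2_def)
  have one: "integrable ?T (\<lambda>_. 1::real)" by (rule continuous_integrable_open_interval) simp
  have "(\<lambda>t. L2_norm M (v t)) \<in> borel_measurable ?T"
  proof (rule measurable_AE_limit)
    show "(\<lambda>t. L2_norm M (S k t)) \<in> borel_measurable ?T" for k
      by (rule simple_function_real_compose[OF S(1)])
    show "AE t in ?T. (\<lambda>k. L2_norm M (S k t)) \<longlonglongrightarrow> L2_norm M (v t)"
      using S(3) AE_space by eventually_elim (auto intro!: L2_norm_tendsto S(2))
  qed simp
  then show n: "integrable ?T (\<lambda>t. L2_norm M (v t))"
  proof (rule Bochner_Integration.integrable_bound[rotated])
    show "integrable ?T (\<lambda>t. (L2_norm M (v t))\<^sup>2 + 1)" using sq one by simp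
    have "y \<le> y\<^sup>2 + 1" for y :: real
      using sum_squares_bound[of y 1] zero_le_power2[of y] unfolding one_power2 by linarith
    then show "AE t in ?T. norm (L2_norm M (v t)) \<le> norm ((L2_norm M (v t))\<^sup>2 + 1)"
      by (simp add: L2_norm_nonneg)
  qed
  assume w: "w \<in> L2_space M"
  have "(\<lambda>t. L2_inner M (v t) w) \<in> borel_measurable ?T"
  proof (rule measurable_AE_limit)
    show "(\<lambda>t. L2_inner M (S k t) w) \<in> borel_measurable ?T" for k
      by (rule simple_function_real_compose[OF S(1)])
    show "AE t in ?T. (\<lambda>k. L2_inner M (S k t) w) \<longlonglongrightarrow> L2_inner M (v t) w"
      using S(3) AE_space by eventually_elim (auto intro!: L2_inner_tendsto S(2) w)
  qed simp
  then show "integrable ?T (\<lambda>t. L2_inner M (v t) w)"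
  proof (rule Bochner_Integration.integrable_bound[rotated])
    show "integrable ?T (\<lambda>t. L2_norm M (v t) * L2_norm M w)" using n by simp
    show "AE t in ?T. norm (L2_inner M (v t) w) \<le> norm (L2_norm M (v t) * L2_norm M w)"
      using L2 by eventually_elim (use L2_Cauchy_Schwarz[OF _ w] in \<open>simp add: L2_norm_nonneg abs_mult\<close>)
  qed
qed

text \<open>A weak derivative is determined by its inner products with the countably many values of the
  simple functions that approximate it.\<close>

lemma time_deriv_L2_unique:
  assumes ab: "a < b" and v1: "has_time_deriv_L2 M a b v v1" and v2: "has_time_deriv_L2 M a b v v2"
  shows "AE t in leb_I a b. AE x in M. v1 t x = v2 t x"
proof -
  let ?T = "leb_I a b"
  have b1: "v1 \<in> bochner_L2_L2 M a b" and b2: "v2 \<in> bochner_L2_L2 M a b"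
    using v1 v2 by (auto simp: has_time_deriv_L2_def)
  obtain S1 where S1: "\<And>k. simple_function ?T (S1 k)" "\<And>k t. t \<in> {a<..<b} \<Longrightarrow> S1 k t \<in> L2_space M"
    "AE t in ?T. v1 t \<in> L2_space M \<and> (\<lambda>k. L2_norm M (\<lambda>x. S1 k t x - v1 t x)) \<longlonglongrightarrow> 0"
    by (rule bochner_L2_L2E[OF b1]) (rule that)
  obtain S2 where S2: "\<And>k. simple_function ?T (S2 k)" "\<And>k t. t \<in> {a<..<b} \<Longrightarrow> S2 k t \<in> L2_space M"
    "AE t in ?T. v2 t \<in> L2_space M \<and> (\<lambda>k. L2_norm M (\<lambda>x. S2 k t x - v2 t x)) \<longlonglongrightarrow> 0"
    by (rule bochner_L2_L2E[OF b2]) (rule that)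
  define W where "W = (\<Union>k. S1 k ` {a<..<b}) \<union> (\<Union>k. S2 k ` {a<..<b})"
  have "finite (S1 k ` {a<..<b})" "finite (S2 k ` {a<..<b})" for k
    using S1(1)[of k] S2(1)[of k] by (auto simp: simple_function_def)
  then have "countable W" by (auto simp: W_def intro: countable_finite)
  moreover have eq: "AE t in ?T. L2_inner M (v1 t) w = L2_inner M (v2 t) w" if "w \<in> W" for w
  proof -
    have w: "w \<in> L2_space M" using that S1(2) S2(2) by (auto simp: W_def)
    show ?thesis
      using v1 v2 w
      by (intro weak_deriv_unique[OF ab bochner_L2_L2D(4)[OF b1 w] bochner_L2_L2D(4)[OF b2 w]])
        (auto simp: has_time_deriv_L2_def)
  qed
  ultimately have "AE t in ?T. \<forall>w\<in>W. L2_inner M (v1 t) w = L2_inner M (v2 t) w"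
    by (simp add: AE_ball_countable)
  with S1(3) S2(3) AE_space show ?thesis
  proof eventually_elim
    case (elim t)
    then have t: "t \<in> {a<..<b}" and L2: "v1 t \<in> L2_space M" "v2 t \<in> L2_space M" by auto
    define d where "d x = v1 t x - v2 t x" for x
    have d: "d \<in> L2_space M" unfolding d_def[abs_def] by (rule L2_space_diff[OF L2])
    have ortho: "L2_inner M w d = 0" if "w \<in> W" for w
    proof -
      have "w \<in> L2_space M" using that S1(2) S2(2) by (auto simp: W_def)
      then show ?thesis
        using elim(4) that L2_inner_diff_left[OF L2] by (simp add: d_def[abs_def] L2_inner_commute[of M w])
    qed
    have z1: "L2_inner M (v1 t) d = 0"
    proof (rule LIMSEQ_unique)
      show "(\<lambda>k. L2_inner M (S1 k t) d) \<longlonglongrightarrow> L2_inner M (v1 t) d"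
        by (rule L2_inner_tendsto[OF S1(2)[OF t] L2(1) d]) (use elim in auto)
      have "S1 k t \<in> W" for k using t unfolding W_def by blast
      then show "(\<lambda>k. L2_inner M (S1 k t) d) \<longlonglongrightarrow> 0" by (simp add: ortho)
    qed
    have z2: "L2_inner M (v2 t) d = 0"
    proof (rule LIMSEQ_unique)
      show "(\<lambda>k. L2_inner M (S2 k t) d) \<longlonglongrightarrow> L2_inner M (v2 t) d"
        by (rule L2_inner_tendsto[OF S2(2)[OF t] L2(2) d]) (use elim in auto)
      have "S2 k t \<in> W" for k using t unfolding W_def by blast
      then show "(\<lambda>k. L2_inner M (S2 k t) d) \<longlonglongrightarrow> 0" by (simp add: ortho)
    qed
    have "L2_norm M d = 0"
      using L2_inner_diff_left[OF L2 d] z1 z2 by (simp add: L2_norm_def d_def[abs_def, symmetric])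
    then show ?case using L2_norm_zero_imp_AE[OF d] by (simp add: d_def)
  qed
qed

lemma time_deriv_unique:
  assumes "a < b" "has_time_deriv_L2 M a b v v'"
  shows "AE t in leb_I a b. AE x in M. time_deriv M a b v t x = v' t x"
proof (rule time_deriv_L2_unique[OF assms(1) _ assms(2)])
  show "has_time_deriv_L2 M a b v (time_deriv M a b v)"
    unfolding time_deriv_def using someI[of "has_time_deriv_L2 M a b v", OF assms(2)] by simp
qed

lemma L2_inner_cong_AE:
  assumes "f \<in> L2_space M" "g \<in> L2_space M" "AE x in M. f x = g x" "w \<in> L2_space M"
  shows "L2_inner M f w = L2_inner M g w"
  unfolding L2_inner_def
proof (rule integral_cong_AE)
  show "AE x in M. f x * w x = g x * w x" using assms(3) by eventually_elim simp
qed (intro borel_measurable_times L2_spaceD(1) assms)+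

text \<open>Pairing with a fixed \<open>w\<close> turns an initial or final condition into one for a continuous scalar
  function, to which the results on scalar weak derivatives apply.\<close>

lemma has_value_at_inner:
  assumes u: "L2_has_value_at M a b u t0 g" and t0: "t0 \<in> {a..b}" and g: "g \<in> L2_space M"
    and uL: "AE t in leb_I a b. u t \<in> L2_space M" and w: "w \<in> L2_space M"
  obtains G where "continuous_on {a..b} G" "AE t in leb_I a b. L2_inner M (u t) w = G t"
    "G t0 = L2_inner M g w"
proof -
  obtain v where v: "\<And>t. t \<in> {a..b} \<Longrightarrow> v t \<in> L2_space M"
      "\<And>t. t \<in> {a..b} \<Longrightarrow> ((\<lambda>r. L2_norm M (v r - v t)) \<longlongrightarrow> 0) (at t within {a..b})"
      "AE t in leb_I a b. AE x in M. v t x = u t x" "AE x in M. v t0 x = g x"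
    using u unfolding L2_has_value_at_def by blast
  show ?thesis
  proof (rule that[of "\<lambda>t. L2_inner M (v t) w"])
    show "continuous_on {a..b} (\<lambda>t. L2_inner M (v t) w)"
      unfolding continuous_on_def
    proof
      fix t assume t: "t \<in> {a..b}"
      show "((\<lambda>t. L2_inner M (v t) w) \<longlongrightarrow> L2_inner M (v t) w) (at t within {a..b})"
      proof (rule LIM_zero_cancel, rule Lim_null_comparison)
        show "\<forall>\<^sub>F r in at t within {a..b}. norm (L2_inner M (v r) w - L2_inner M (v t) w)
            \<le> L2_norm M (v r - v t) * L2_norm M w"
          unfolding eventually_at_filter
        proof (intro always_eventually allI impI)
          fix r assume r: "r \<in> {a..b}"
          show "norm (L2_inner M (v r) w - L2_inner M (v t) w) \<le> L2_norm M (v r - v t) * L2_norm M w"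
            using L2_Cauchy_Schwarz[OF L2_space_diff[OF v(1)[OF r] v(1)[OF t]] w]
              L2_inner_diff_left[OF v(1)[OF r] v(1)[OF t] w] by (simp add: fun_diff_def)
        qed
        show "((\<lambda>r. L2_norm M (v r - v t) * L2_norm M w) \<longlongrightarrow> 0) (at t within {a..b})"
          using tendsto_mult_right[OF v(2)[OF t], of "L2_norm M w"] by simp
      qed
    qed
    show "AE t in leb_I a b. L2_inner M (u t) w = L2_inner M (v t) w"
      using v(3) uL AE_space
    proof eventually_elim
      case (elim t)
      then show ?case
        by (intro L2_inner_cong_AE v(1) w) (auto elim!: eventually_mono)
    qed
    show "L2_inner M (v t0) w = L2_inner M g w"
      by (rule L2_inner_cong_AE[OF v(1)[OF t0] g v(4) w])
  qed
qed

text \<open>The functions with given coefficients in an orthonormal basis depend measurably on time: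
  truncation of the series and rounding of the coefficients give simple functions.\<close>

lemma bochner_L2_from_coefficients:
  fixes c :: "nat \<Rightarrow> real \<Rightarrow> real"
  assumes e: "L2_orthonormal_basis M e"
    and m: "\<And>k. c k \<in> borel_measurable (leb_I a b)"
    and bound: "\<And>k t. t \<in> {a<..<b} \<Longrightarrow> \<bar>c k t\<bar> \<le> C * \<bar>A k\<bar>"
    and A: "summable (\<lambda>k. (A k)\<^sup>2)"
  obtains V where "V \<in> bochner_L2_L2 M a b" "\<And>t. t \<in> {a<..<b} \<Longrightarrow> V t \<in> L2_space M"
    "\<And>t k. t \<in> {a<..<b} \<Longrightarrow> L2_inner M (V t) (e k) = c k t"
proof -
  let ?T = "leb_I a b"
  have sq_le: "(c k t)\<^sup>2 \<le> C\<^sup>2 * (A k)\<^sup>2" if "t \<in> {a<..<b}" for k t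
    using power_mono[OF bound[OF that, of k], of 2] by (simp add: power_mult_distrib)
  have sA: "summable (\<lambda>k. C\<^sup>2 * (A k)\<^sup>2)" by (rule summable_mult[OF A])
  have sc: "summable (\<lambda>k. (c k t)\<^sup>2)" if "t \<in> {a<..<b}" for t
    by (rule summable_comparison_test[OF _ sA]) (use sq_le[OF that] in auto)
  have "\<forall>t\<in>{a<..<b}. \<exists>g. g \<in> L2_space M \<and> (\<forall>k. L2_inner M g (e k) = c k t)"
    using Riesz_Fischer[OF e sc] by blast
  then obtain V where V: "\<And>t. t \<in> {a<..<b} \<Longrightarrow> V t \<in> L2_space M"
    "\<And>t k. t \<in> {a<..<b} \<Longrightarrow> L2_inner M (V t) (e k) = c k t"
    by metis
  \<comment> \<open>Rounding to multiples of \<open>(N + 1)\<^sup>-\<^sup>2\<close> keeps the total error of \<open>N\<close> coefficients small.\<close>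
  define q where "q N y = real_of_int \<lfloor>(real N + 1)\<^sup>2 * y\<rfloor> / (real N + 1)\<^sup>2" for N :: nat and y :: real
  have q: "\<bar>q N y - y\<bar> \<le> 1 / (real N + 1)\<^sup>2" for N y
  proof -
    have p: "0 < (real N + 1)\<^sup>2" by simp
    have "q N y - y = (real_of_int \<lfloor>(real N + 1)\<^sup>2 * y\<rfloor> - (real N + 1)\<^sup>2 * y) / (real N + 1)\<^sup>2"
      using p by (simp add: q_def diff_divide_distrib)
    moreover have "\<bar>real_of_int \<lfloor>(real N + 1)\<^sup>2 * y\<rfloor> - (real N + 1)\<^sup>2 * y\<bar> \<le> 1" by linarith
    ultimately show ?thesis by (simp add: divide_right_mono)
  qed
  define S where "S N t = (\<lambda>x. \<Sum>k<N. q N (c k t) * e k x)" for N t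
  have simple_q: "simple_function ?T (\<lambda>t. q N (c k t))" for N k
  proof (rule simple_function_borel_measurable)
    show "(\<lambda>t. q N (c k t)) \<in> borel_measurable ?T"
      unfolding q_def using m[of k] by measurable
    define B where "B = \<lfloor>(real N + 1)\<^sup>2 * (C * \<bar>A k\<bar>)\<rfloor> + 1"
    have "(\<lambda>t. q N (c k t)) ` space ?T \<subseteq> (\<lambda>i. real_of_int i / (real N + 1)\<^sup>2) ` {-B..B}"
    proof clarify
      fix t assume "t \<in> space ?T"
      then have t: "t \<in> {a<..<b}" by simp
      have "\<bar>(real N + 1)\<^sup>2 * c k t\<bar> \<le> (real N + 1)\<^sup>2 * (C * \<bar>A k\<bar>)"
        using bound[OF t, of k] by (simp add: abs_mult mult_left_mono)
      then have "\<lfloor>(real N + 1)\<^sup>2 * c k t\<rfloor> \<in> {-B..B}"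
        unfolding B_def atLeastAtMost_iff by linarith
      then show "q N (c k t) \<in> (\<lambda>i. real_of_int i / (real N + 1)\<^sup>2) ` {-B..B}"
        unfolding q_def by (rule imageI)
    qed
    then show "finite ((\<lambda>t. q N (c k t)) ` space ?T)" by (rule finite_subset) simp
  qed
  have simple: "simple_function ?T (S N)" for N
  proof -
    have "simple_function ?T (\<lambda>t. \<lambda>x. \<Sum>k<n. q N (c k t) * e k x)" for n
    proof (induction n)
      case (Suc n)
      show ?case
        using simple_function_compose2[OF Suc simple_q[of N n], of "\<lambda>g y x. g x + y * e n x"] by simp
    qed simp
    then show ?thesis by (simp add: S_def[abs_def])
  qed
  have SL: "S N t \<in> L2_space M" for N t
    unfolding S_def by (rule basis_sum_L2[OF e]) simp
  have lim: "(\<lambda>N. L2_norm M (\<lambda>x. S N t x - V t x)) \<longlonglongrightarrow> 0" if t: "t \<in> {a<..<b}" for t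
  proof (rule Lim_null_comparison)
    let ?P = "\<lambda>N x. \<Sum>k<N. c k t * e k x"
    have P: "?P N \<in> L2_space M" for N by (rule basis_sum_L2[OF e]) simp
    have "L2_norm M (\<lambda>x. S N t x - ?P N x) \<le> 1 / (real N + 1)" for N
    proof (rule power2_le_imp_le)
      have "(\<lambda>x. S N t x - ?P N x) = (\<lambda>x. \<Sum>k<N. (q N (c k t) - c k t) * e k x)"
        by (simp add: S_def sum_subtractf left_diff_distrib)
      then have "(L2_norm M (\<lambda>x. S N t x - ?P N x))\<^sup>2 = (\<Sum>k<N. (q N (c k t) - c k t)\<^sup>2)"
        using basis_sum_norm_sq[OF e, of "{..<N}" "\<lambda>k. q N (c k t) - c k t"] by simp
      also have "\<dots> \<le> (\<Sum>k<N. (1 / (real N + 1)\<^sup>2)\<^sup>2)"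
      proof (rule sum_mono)
        fix k
        have "\<bar>q N (c k t) - c k t\<bar>\<^sup>2 \<le> (1 / (real N + 1)\<^sup>2)\<^sup>2" by (rule power_mono[OF q]) simp
        then show "(q N (c k t) - c k t)\<^sup>2 \<le> (1 / (real N + 1)\<^sup>2)\<^sup>2" by simp
      qed
      also have "\<dots> = real N * (1 / (real N + 1)\<^sup>2) * (1 / (real N + 1))\<^sup>2"
        by (simp add: power_divide power2_eq_square)
      also have "\<dots> \<le> 1 * (1 / (real N + 1))\<^sup>2"
      proof (rule mult_right_mono)
        have "real N \<le> (real N + 1)\<^sup>2" by (simp add: power2_eq_square algebra_simps)
        then show "real N * (1 / (real N + 1)\<^sup>2) \<le> 1" by simp
      qed simp
      finally show "(L2_norm M (\<lambda>x. S N t x - ?P N x))\<^sup>2 \<le> (1 / (real N + 1))\<^sup>2" by simp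
    qed simp
    from add_right_mono[OF this] have "L2_norm M (\<lambda>x. S N t x - V t x)
        \<le> 1 / (real N + 1) + L2_norm M (\<lambda>x. V t x - ?P N x)" for N
      unfolding L2_norm_diff_commute[of M "V t" "?P N"]
      by (rule order_trans[OF L2_triangle_via[OF SL P V(1)[OF t], of N t N]])
    then show "\<forall>\<^sub>F N in sequentially. norm (L2_norm M (\<lambda>x. S N t x - V t x))
        \<le> 1 / (real N + 1) + L2_norm M (\<lambda>x. V t x - ?P N x)"
      by (simp add: L2_norm_nonneg)
    have "(\<lambda>N. L2_norm M (\<lambda>x. V t x - ?P N x)) \<longlonglongrightarrow> 0"
      using orthonormal_basisD(3)[OF e V(1)[OF t]] V(2)[OF t] by simp
    moreover have "(\<lambda>N. 1 / (real N + 1)) \<longlonglongrightarrow> 0"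
      using LIMSEQ_inverse_real_of_nat by (simp add: inverse_eq_divide add.commute)
    ultimately show "(\<lambda>N. 1 / (real N + 1) + L2_norm M (\<lambda>x. V t x - ?P N x)) \<longlonglongrightarrow> 0"
      using tendsto_add by fastforce
  qed
  have norm: "(L2_norm M (V t))\<^sup>2 \<le> (\<Sum>k. C\<^sup>2 * (A k)\<^sup>2)" if t: "t \<in> {a<..<b}" for t
  proof -
    have "(\<lambda>k. (c k t)\<^sup>2) sums L2_inner M (V t) (V t)"
      using Parseval[OF e V(1)[OF t] V(1)[OF t]] V(2)[OF t] by (simp add: power2_eq_square)
    then have "L2_inner M (V t) (V t) = (\<Sum>k. (c k t)\<^sup>2)" by (simp add: sums_iff)
    also have "\<dots> \<le> (\<Sum>k. C\<^sup>2 * (A k)\<^sup>2)" by (rule suminf_le[OF sq_le[OF t] sc[OF t] sA])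
    finally show ?thesis by (simp add: L2_norm_sq)
  qed
  have "V \<in> bochner_L2_L2 M a b"
  proof (rule bochner_L2_L2I[OF simple SL])
    show "AE t in ?T. V t \<in> L2_space M \<and> (\<lambda>k. L2_norm M (\<lambda>x. S k t x - V t x)) \<longlonglongrightarrow> 0"
      using lim V(1) by (auto intro!: AE_I2)
    show "integrable ?T (\<lambda>t. \<Sum>k. C\<^sup>2 * (A k)\<^sup>2)" by (rule continuous_integrable_open_interval) simp
    show "AE t in ?T. (L2_norm M (V t))\<^sup>2 \<le> (\<Sum>k. C\<^sup>2 * (A k)\<^sup>2)"
      using norm by (auto intro!: AE_I2)
  qed
  then show ?thesis using V that by blast
qed

lemma bochner_L2_const:
  assumes W: "W \<in> L2_space M"
  shows "(\<lambda>t. W) \<in> bochner_L2_L2 M a b"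
proof (rule bochner_L2_L2I[where S="\<lambda>k t. W" and g="\<lambda>t. (L2_norm M W)\<^sup>2"])
  show "integrable (leb_I a b) (\<lambda>t. (L2_norm M W)\<^sup>2)"
    by (rule continuous_integrable_open_interval) simp
qed (use W in \<open>simp_all add: L2_norm_def\<close>)

text \<open>The weight \<open>\<rho>\<close> is a test function or its derivative when weak derivatives are computed, and 1
  when the energy inner product is expanded.\<close>

lemma Parseval_integral:
  fixes \<rho> :: "real \<Rightarrow> real"
  assumes e: "L2_orthonormal_basis M e" and \<rho>: "continuous_on {a..b} \<rho>"
    and v: "v \<in> bochner_L2_L2 M a b" and w: "w \<in> bochner_L2_L2 M a b"
  shows "(\<lambda>k. LINT t|leb_I a b. \<rho> t * (L2_inner M (v t) (e k) * L2_inner M (w t) (e k)))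
      sums (LINT t|leb_I a b. \<rho> t * L2_inner M (v t) (w t))"
    and "integrable (leb_I a b) (\<lambda>t. L2_inner M (v t) (w t))"
proof -
  let ?T = "leb_I a b"
  let ?c = "\<lambda>k t. L2_inner M (v t) (e k) * L2_inner M (w t) (e k)"
  let ?g = "\<lambda>t. (L2_norm M (v t))\<^sup>2 + (L2_norm M (w t))\<^sup>2"
  note eL = orthonormal_basisD(1)[OF e]
  have vw: "AE t in ?T. v t \<in> L2_space M \<and> w t \<in> L2_space M"
    using bochner_L2_L2D(1)[OF v] bochner_L2_L2D(1)[OF w] by eventually_elim simp
  have g: "integrable ?T ?g" using bochner_L2_L2D(2)[OF v] bochner_L2_L2D(2)[OF w] by simp
  have prod_le: "L2_norm M x * L2_norm M y \<le> (L2_norm M x)\<^sup>2 + (L2_norm M y)\<^sup>2" for x y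
    using sum_squares_bound[of "L2_norm M x" "L2_norm M y"] L2_norm_nonneg[of M x] L2_norm_nonneg[of M y]
      mult_nonneg_nonneg[of "L2_norm M x" "L2_norm M y"] by linarith
  have cm: "?c k \<in> borel_measurable ?T" for k
    using bochner_L2_L2D(4)[OF v eL] bochner_L2_L2D(4)[OF w eL]
    by (intro borel_measurable_times) (auto dest: borel_measurable_integrable)
  have c_int: "integrable ?T (?c k)" for k
  proof (rule Bochner_Integration.integrable_bound[OF g cm])
    show "AE t in ?T. norm (?c k t) \<le> norm (?g t)"
      using vw
    proof eventually_elim
      case (elim t)
      have e1: "L2_norm M (e k) = 1" by (simp add: L2_norm_def orthonormal_basisD(2)[OF e])
      have "\<bar>?c k t\<bar> \<le> L2_norm M (v t) * L2_norm M (w t)"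
        unfolding abs_mult
        using L2_Cauchy_Schwarz[of "v t" M "e k"] L2_Cauchy_Schwarz[of "w t" M "e k"] elim eL e1
        by (intro mult_mono) (auto simp: L2_norm_nonneg)
      also have "\<dots> \<le> ?g t" by (rule prod_le)
      finally show ?case by simp
    qed
  qed
  let ?s = "\<lambda>N t. \<Sum>k<N. ?c k t"
  have lim: "AE t in ?T. (\<lambda>N. ?s N t) \<longlonglongrightarrow> L2_inner M (v t) (w t)"
    using vw by eventually_elim (use Parseval[OF e] in \<open>auto simp: sums_def\<close>)
  have sm: "?s N \<in> borel_measurable ?T" for N by (intro borel_measurable_sum cm)
  have m: "(\<lambda>t. L2_inner M (v t) (w t)) \<in> borel_measurable ?T"
    by (rule measurable_AE_limit[OF _ sm lim]) simp
  show int: "integrable ?T (\<lambda>t. L2_inner M (v t) (w t))"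
  proof (rule Bochner_Integration.integrable_bound[OF g m])
    show "AE t in ?T. norm (L2_inner M (v t) (w t)) \<le> norm (?g t)"
      using vw
    proof eventually_elim
      case (elim t)
      then show ?case
        using L2_Cauchy_Schwarz[of "v t" M "w t"] prod_le[of "v t" "w t"] by simp
    qed
  qed
  have \<rho>m: "\<rho> \<in> borel_measurable ?T"
    by (rule borel_measurable_integrable[OF continuous_integrable_open_interval[OF \<rho>]])
  have "(\<lambda>N. LINT t|?T. \<rho> t * ?s N t) \<longlonglongrightarrow> (LINT t|?T. \<rho> t * L2_inner M (v t) (w t))"
  proof (rule integral_dominated_convergence)
    show "integrable ?T (\<lambda>t. \<bar>?g t * \<rho> t\<bar>)"
      by (rule integrable_abs[OF bounded_mult_integrable[OF g \<rho>]])
    show "AE t in ?T. (\<lambda>N. \<rho> t * ?s N t) \<longlonglongrightarrow> \<rho> t * L2_inner M (v t) (w t)"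
      using lim by eventually_elim (rule tendsto_mult_left)
    show "AE t in ?T. norm (\<rho> t * ?s N t) \<le> \<bar>?g t * \<rho> t\<bar>" for N
      using vw
    proof eventually_elim
      case (elim t)
      have "\<bar>?s N t\<bar> \<le> \<bar>?g t\<bar>"
        using basis_partial_inner_bound[OF e, of "v t" "w t" N] prod_le[of "v t" "w t"] elim by simp
      then show ?case
        unfolding real_norm_def abs_mult[of "\<rho> t"] abs_mult[of "?g t"] mult.commute[of "\<bar>?g t\<bar>"]
        by (rule mult_left_mono) simp
    qed
  qed (use \<rho>m sm m in \<open>auto intro!: borel_measurable_times\<close>)
  moreover have "(LINT t|?T. \<rho> t * ?s N t) = (\<Sum>k<N. LINT t|?T. \<rho> t * ?c k t)" for N
    unfolding sum_distrib_left
    by (rule Bochner_Integration.integral_sum)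
      (use bounded_mult_integrable[OF c_int \<rho>] in \<open>simp add: mult.commute[of "\<rho> _"]\<close>)
  ultimately show "(\<lambda>k. LINT t|?T. \<rho> t * ?c k t) sums (LINT t|?T. \<rho> t * L2_inner M (v t) (w t))"
    by (simp add: sums_def)
qed

section \<open>The fractional Sobolev space and the energy form\<close>

text \<open>The rule is derived for arbitrary integrands, directly from the supremum over simple functions
  that defines the integral. It then applies to the inner integral of the Gagliardo seminorm without
  a discussion of its measurability.\<close>

lemma nn_integral_cmult_ge:
  fixes f :: "'a \<Rightarrow> ennreal"
  shows "c * (\<integral>\<^sup>+x. f x \<partial>M) \<le> (\<integral>\<^sup>+x. c * f x \<partial>M)"
proof -
  let ?G = "{g. simple_function M g \<and> g \<le> f}"
  have "c * (\<integral>\<^sup>+x. f x \<partial>M) = (SUP g\<in>?G. c * integral\<^sup>S M g)"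
    unfolding nn_integral_def by (rule SUP_mult_left_ennreal)
  also have "\<dots> \<le> (\<integral>\<^sup>+x. c * f x \<partial>M)"
    unfolding nn_integral_def[of M "\<lambda>x. c * f x"]
  proof (rule SUP_mono)
    fix g assume g: "g \<in> ?G"
    have "(\<lambda>x. c * g x) \<in> {h. simple_function M h \<and> h \<le> (\<lambda>x. c * f x)}"
      using g by (auto simp: le_fun_def intro!: mult_left_mono)
    moreover have "c * integral\<^sup>S M g = integral\<^sup>S M (\<lambda>x. c * g x)"
      using g by (simp add: simple_integral_mult)
    ultimately show "\<exists>h\<in>{h. simple_function M h \<and> h \<le> (\<lambda>x. c * f x)}.
        c * integral\<^sup>S M g \<le> integral\<^sup>S M h"
      by (intro bexI[of _ "\<lambda>x. c * g x"]) auto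
  qed
  finally show ?thesis .
qed

lemma nn_integral_cmult_positive:
  fixes c :: real
  assumes c: "0 < c"
  shows "(\<integral>\<^sup>+x. ennreal c * f x \<partial>M) = ennreal c * (\<integral>\<^sup>+x. f x \<partial>M)"
proof (rule antisym)
  have cc: "ennreal c * (ennreal (1 / c) * y) = y" "ennreal (1 / c) * (ennreal c * y) = y" for y
    using c by (simp_all flip: mult.assoc ennreal_mult)
  have "ennreal (1 / c) * (\<integral>\<^sup>+x. ennreal c * f x \<partial>M) \<le> (\<integral>\<^sup>+x. f x \<partial>M)"
    using nn_integral_cmult_ge[of "ennreal (1 / c)" M "\<lambda>x. ennreal c * f x"] by (simp add: cc)
  then have "ennreal c * (ennreal (1 / c) * (\<integral>\<^sup>+x. ennreal c * f x \<partial>M)) \<le> ennreal c * (\<integral>\<^sup>+x. f x \<partial>M)"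
    by (rule mult_left_mono) simp
  then show "(\<integral>\<^sup>+x. ennreal c * f x \<partial>M) \<le> ennreal c * (\<integral>\<^sup>+x. f x \<partial>M)" by (simp add: cc)
qed (simp add: nn_integral_cmult_ge)

lemma gagliardo_scale: "gagliardo s (\<lambda>x. c * u x) = ennreal (c\<^sup>2) * gagliardo s u"
proof (cases "c = 0")
  case False
  then have c: "0 < c\<^sup>2" by simp
  have "ennreal ((c * u x - c * u y)\<^sup>2 / \<bar>x - y\<bar> powr (1 + 2 * s))
      = ennreal (c\<^sup>2) * ennreal ((u x - u y)\<^sup>2 / \<bar>x - y\<bar> powr (1 + 2 * s))" for x y
    by (simp add: ennreal_mult'[symmetric] power_mult_distrib[symmetric] right_diff_distrib)
  then show ?thesis
    unfolding gagliardo_def by (simp add: nn_integral_cmult_positive[OF c])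
qed (simp add: gagliardo_def)

lemma Hs_norm_scale: "Hs_norm s (\<lambda>x. c * u x) = \<bar>c\<bar> * Hs_norm s u"
proof -
  have "(L2_norm lebesgue (\<lambda>x. c * u x))\<^sup>2 + enn2real (gagliardo s (\<lambda>x. c * u x))
      = c\<^sup>2 * ((L2_norm lebesgue u)\<^sup>2 + enn2real (gagliardo s u))"
    by (simp add: gagliardo_scale L2_norm_scale power_mult_distrib enn2real_mult distrib_left)
  then show ?thesis by (simp add: Hs_norm_def real_sqrt_mult)
qed

lemma H0s_scale: "u \<in> H0s s \<Longrightarrow> (\<lambda>x. c * u x) \<in> H0s s"
  by (auto simp: H0s_def Hs_def gagliardo_scale L2_space_scale ennreal_mult_less_top
      elim!: eventually_mono)

lemma H0s_imp_L2: "u \<in> H0s s \<Longrightarrow> u \<in> L2_space lebesgue"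
  by (simp add: H0s_def Hs_def)

lemma L2_lebesgue_imp_L2_D: "u \<in> L2_space lebesgue \<Longrightarrow> u \<in> L2_space leb_D"
  using L2_restrict[of "{-1<..<1}" UNIV u] by (simp add: lebesgue_on_UNIV_eq)

lemma L2_norm_D_le_Hs_norm:
  assumes "u \<in> L2_space lebesgue"
  shows "L2_norm leb_D u \<le> Hs_norm s u"
proof -
  have "L2_norm leb_D u \<le> L2_norm lebesgue u"
    using L2_norm_restrict[of "{-1<..<1}" UNIV u] assms by (simp add: lebesgue_on_UNIV_eq)
  also have "\<dots> \<le> Hs_norm s u"
    unfolding Hs_norm_def by (rule real_le_rsqrt) (simp add: enn2real_nonneg)
  finally show ?thesis .
qed

lemma bochner_H0s_imp_L2:
  assumes u: "u \<in> bochner_L2 (H0s s) (Hs_norm s) a b"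
  shows "u \<in> bochner_L2_L2 leb_D a b"
proof -
  let ?T = "leb_I a b"
  have uH: "AE t in ?T. u t \<in> H0s s" and int: "integrable ?T (\<lambda>t. (Hs_norm s (u t))\<^sup>2)"
    and sm: "strongly_measurable (H0s s) (Hs_norm s) a b u"
    using u by (simp_all add: bochner_L2_def)
  then obtain S where S: "\<forall>k. simple_function ?T (S k) \<and> (\<forall>t\<in>{a<..<b}. S k t \<in> H0s s)"
    and lim: "AE t in ?T. (\<lambda>k. Hs_norm s (S k t - u t)) \<longlonglongrightarrow> 0"
    unfolding strongly_measurable_def by blast
  show ?thesis
  proof (rule bochner_L2_L2I[OF _ _ _ int])
    show "simple_function ?T (S k)" for k using S by blast
    show "S k t \<in> L2_space leb_D" if "t \<in> {a<..<b}" for k t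
      using S that by (blast intro: L2_lebesgue_imp_L2_D H0s_imp_L2)
    show "AE t in ?T. u t \<in> L2_space leb_D \<and> (\<lambda>k. L2_norm leb_D (\<lambda>x. S k t x - u t x)) \<longlonglongrightarrow> 0"
      using uH lim AE_space
    proof eventually_elim
      case (elim t)
      then have t: "t \<in> {a<..<b}" by simp
      have "L2_norm leb_D (\<lambda>x. S k t x - u t x) \<le> Hs_norm s (S k t - u t)" for k
        unfolding fun_diff_def
        using S t elim(1) by (intro L2_norm_D_le_Hs_norm L2_space_diff H0s_imp_L2[of _ s]) auto
      then have "(\<lambda>k. L2_norm leb_D (\<lambda>x. S k t x - u t x)) \<longlonglongrightarrow> 0"
        by (intro Lim_null_comparison[OF _ elim(2)]) (simp add: L2_norm_nonneg)
      then show ?case using elim(1) by (auto intro: L2_lebesgue_imp_L2_D H0s_imp_L2)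
    qed
    show "AE t in ?T. (L2_norm leb_D (u t))\<^sup>2 \<le> (Hs_norm s (u t))\<^sup>2"
      using uH by eventually_elim
        (auto intro!: power_mono L2_norm_D_le_Hs_norm L2_norm_nonneg dest: H0s_imp_L2)
  qed
qed

lemma bochner_H0s_product:
  assumes \<psi>: "continuous_on {a..b} \<psi>" and w: "w \<in> H0s s"
  shows "(\<lambda>t x. \<psi> t * w x) \<in> bochner_L2 (H0s s) (Hs_norm s) a b"
proof -
  let ?T = "leb_I a b"
  have \<psi>m: "\<psi> \<in> borel_measurable ?T"
    by (rule borel_measurable_integrable[OF continuous_integrable_open_interval[OF \<psi>]])
  obtain P where P: "\<forall>k. simple_function ?T (P k)" "\<forall>t\<in>space ?T. (\<lambda>k. P k t) \<longlonglongrightarrow> \<psi> t"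
    using borel_measurable_implies_sequence_metric[OF \<psi>m, of 0] by blast
  have "strongly_measurable (H0s s) (Hs_norm s) a b (\<lambda>t x. \<psi> t * w x)"
    unfolding strongly_measurable_def
  proof (intro exI conjI allI ballI)
    show "simple_function ?T (\<lambda>t x. P k t * w x)" for k
      using simple_function_compose[of ?T "P k" "\<lambda>y x. y * w x"] P(1) by (simp add: o_def)
    show "(\<lambda>x. P k t * w x) \<in> H0s s" for k t by (rule H0s_scale[OF w])
    show "AE t in ?T. (\<lambda>k. Hs_norm s ((\<lambda>x. P k t * w x) - (\<lambda>x. \<psi> t * w x))) \<longlonglongrightarrow> 0"
    proof (rule AE_I2)
      fix t assume t: "t \<in> space ?T"
      have "(\<lambda>x. P k t * w x) - (\<lambda>x. \<psi> t * w x) = (\<lambda>x. (P k t - \<psi> t) * w x)" for k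
        by (simp add: fun_diff_def left_diff_distrib)
      moreover have "(\<lambda>k. \<bar>P k t - \<psi> t\<bar> * Hs_norm s w) \<longlonglongrightarrow> 0"
        using P(2) t by (intro tendsto_mult_left_zero tendsto_rabs_zero LIM_zero) auto
      ultimately show "(\<lambda>k. Hs_norm s ((\<lambda>x. P k t * w x) - (\<lambda>x. \<psi> t * w x))) \<longlonglongrightarrow> 0"
        by (simp add: Hs_norm_scale)
    qed
  qed
  moreover have "integrable ?T (\<lambda>t. (Hs_norm s (\<lambda>x. \<psi> t * w x))\<^sup>2)"
    unfolding Hs_norm_scale
    by (rule continuous_integrable_open_interval) (intro continuous_intros \<psi>)
  ultimately show ?thesis by (simp add: bochner_L2_def H0s_scale[OF w])
qed

lemma frac_form_commute: "frac_form s u v = frac_form s v u"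
  by (simp add: frac_form_def mult.commute)

lemma frac_form_scale: "frac_form s u (\<lambda>x. c * v x) = c * frac_form s u v"
proof -
  have "(u x - u y) * (c * v x - c * v y) / \<bar>x - y\<bar> powr (1 + 2 * s)
      = c * ((u x - u y) * (v x - v y) / \<bar>x - y\<bar> powr (1 + 2 * s))" for x y
    by (simp add: right_diff_distrib[symmetric])
  then show ?thesis unfolding frac_form_def by (simp only: integral_mult_right_zero mult.left_commute)
qed

lemma frac_form_eigenfunction:
  assumes "dirichlet_frac_laplacian s \<phi> (\<lambda>x. l * \<phi> x)" "u \<in> H0s s"
  shows "frac_form s u (\<lambda>x. c * \<phi> x) = c * (l * L2_inner leb_D u \<phi>)"
  using assms by (simp add: frac_form_scale frac_form_commute[of s u] dirichlet_frac_laplacian_def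
      L2_inner_scale_left L2_inner_commute[of leb_D u])

lemma Hdual_scale:
  assumes "l \<in> Hdual s" "w \<in> H0s s"
  shows "l (\<lambda>x. c * w x) = c * l w"
proof -
  have "l (\<lambda>x. c * w x + 0 * w x) = c * l w + 0 * l w"
    using assms unfolding Hdual_def by blast
  then show ?thesis by simp
qed

section \<open>Fourier coefficients of solutions of the fractional heat equation\<close>

text \<open>Testing the equation with \<open>\<psi>(t) \<phi>(x)\<close>, where \<open>\<phi>\<close> is an eigenfunction, turns it into the scalar
  equation \<open>z' + l z = p\<close> for the coefficient \<open>z(t) = (u(t), \<phi>)\<close>.\<close>

lemma finite_energy_solution_coefficient:
  assumes T: "0 < T" and sol: "finite_energy_solution s T F u0 u" and u0: "u0 \<in> L2_space leb_D"
    and eig: "dirichlet_frac_laplacian s \<phi> (\<lambda>x. l * \<phi> x)"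
    and F: "\<And>t c. F t (\<lambda>x. c * \<phi> x) = c * p t" and p: "integrable (leb_I 0 T) p"
  obtains Z where "continuous_on {0..T} Z" "AE t in leb_I 0 T. L2_inner leb_D (u t) \<phi> = Z t"
    "weak_deriv 0 T (\<lambda>t. L2_inner leb_D (u t) \<phi>) (\<lambda>t. p t - l * L2_inner leb_D (u t) \<phi>)"
    "\<And>t. t \<in> {0..T} \<Longrightarrow>
      exp (l * t) * Z t = L2_inner leb_D u0 \<phi> + (LINT r|leb_I 0 t. p r * exp (l * r))"
proof -
  let ?T = "leb_I 0 T"
  define z where "z t = L2_inner leb_D (u t) \<phi>" for t
  have \<phi>: "\<phi> \<in> H0s s" using eig by (simp add: dirichlet_frac_laplacian_def)
  have \<phi>L: "\<phi> \<in> L2_space leb_D" by (rule L2_lebesgue_imp_L2_D[OF H0s_imp_L2[OF \<phi>]])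
  have uB: "u \<in> bochner_L2 (H0s s) (Hs_norm s) 0 T" and u_val: "L2_has_value_at leb_D 0 T u 0 u0"
    using sol by (simp_all add: finite_energy_solution_def)
  have uH: "AE t in ?T. u t \<in> H0s s" using uB by (simp add: bochner_L2_def)
  note uL = bochner_H0s_imp_L2[OF uB]
  have z: "integrable ?T z" unfolding z_def[abs_def] by (rule bochner_L2_L2D(4)[OF uL \<phi>L])
  obtain u' where u': "u' \<in> bochner_L2 (Hdual s) (Hdual_norm s) 0 T"
    and wd: "\<And>w. w \<in> H0s s \<Longrightarrow> weak_deriv 0 T (\<lambda>t. pivot (u t) w) (\<lambda>t. u' t w)"
    and eq: "\<And>w. w \<in> bochner_L2 (H0s s) (Hs_norm s) 0 T \<Longrightarrow>
      (LINT t|?T. u' t (w t)) + (LINT t|?T. frac_form s (u t) (w t)) = (LINT t|?T. F t (w t))"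
    using sol by (auto simp: finite_energy_solution_def)
  have u'H: "AE t in ?T. u' t \<in> Hdual s" using u' by (simp add: bochner_L2_def)
  have weak: "weak_deriv 0 T z (\<lambda>t. p t - l * z t)"
    unfolding weak_deriv_def
  proof
    fix \<psi> assume \<psi>: "\<psi> \<in> test_functions 0 T"
    note c\<psi> = test_functions_continuous(2)[OF \<psi>, of "{0..T}"]
    have "(LINT t|?T. z t * deriv \<psi> t) = - (LINT t|?T. u' t \<phi> * \<psi> t)"
      using wd[OF \<phi>] \<psi> by (simp add: weak_deriv_def z_def pivot_def)
    also have "(LINT t|?T. u' t \<phi> * \<psi> t) = (LINT t|?T. u' t (\<lambda>x. \<psi> t * \<phi> x))"
      by (rule lebesgue_on_integral_cong_AE(1), simp)
        (use u'H in eventually_elim, simp add: Hdual_scale[OF _ \<phi>])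
    also have "\<dots> = (LINT t|?T. F t (\<lambda>x. \<psi> t * \<phi> x)) - (LINT t|?T. frac_form s (u t) (\<lambda>x. \<psi> t * \<phi> x))"
      using eq[OF bochner_H0s_product[OF c\<psi> \<phi>]] by simp
    also have "(LINT t|?T. frac_form s (u t) (\<lambda>x. \<psi> t * \<phi> x)) = (LINT t|?T. l * (z t * \<psi> t))"
      by (rule lebesgue_on_integral_cong_AE(1), simp)
        (use uH in eventually_elim, simp add: frac_form_eigenfunction[OF eig] z_def)
    also have "(LINT t|?T. F t (\<lambda>x. \<psi> t * \<phi> x)) = (LINT t|?T. p t * \<psi> t)"
      by (simp add: F mult.commute[of "p _"])
    finally show "(LINT t|?T. z t * deriv \<psi> t) = - (LINT t|?T. (p t - l * z t) * \<psi> t)"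
      using bounded_mult_integrable[OF p c\<psi>] bounded_mult_integrable[OF z c\<psi>]
      by (simp add: left_diff_distrib mult.assoc)
  qed
  obtain Z where Z: "continuous_on {0..T} Z" "AE t in ?T. z t = Z t" "Z 0 = L2_inner leb_D u0 \<phi>"
    unfolding z_def
    by (rule has_value_at_inner[OF u_val _ u0 bochner_L2_L2D(1)[OF uL] \<phi>L]) (use T that in auto)
  have "exp (l * t) * Z t = L2_inner leb_D u0 \<phi> + (LINT r|leb_I 0 t. p r * exp (l * r))"
    if "t \<in> {0..T}" for t
    using linear_ode_representative[OF T Z(1,2) z p weak that] Z(3) by simp
  then show ?thesis using that[of Z] Z(1,2) weak unfolding z_def by blast
qed

text \<open>A null control solves a moment problem: the \<open>k\<close>-th coefficient of the controlled state, with time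
  reversed, starts from \<open>\<delta>\<^sub>k\<^sub>n\<close> and vanishes at time \<open>\<tau>\<close>, so the contribution of \<open>h\<close> in Duhamel's
  formula cancels that of the initial value.\<close>

lemma null_control_moment:
  assumes \<tau>: "0 < \<tau>" and eigen: "dirichlet_eigensystem s lam \<phi>"
    and \<omega>: "\<omega> \<subseteq> {-1<..<1}" "\<omega> \<in> sets lebesgue"
    and h: "null_control s \<omega> \<tau> (\<phi> n) h"
  shows "(LINT r|leb_I 0 \<tau>. exp (- lam k * r) * L2_inner (lebesgue_on \<omega>) (h r) (\<phi> k))
    = - (if k = n then exp (- lam k * \<tau>) else 0)"
proof -
  let ?T = "leb_I 0 \<tau>"
  have basis: "L2_orthonormal_basis leb_D \<phi>"
    and eig: "dirichlet_frac_laplacian s (\<phi> k) (\<lambda>x. lam k * \<phi> k x)"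
    using eigen by (simp_all add: dirichlet_eigensystem_def)
  note \<phi>L = orthonormal_basisD(1)[OF basis]
  have \<phi>\<omega>: "\<phi> k \<in> L2_space (lebesgue_on \<omega>)" by (rule L2_restrict[OF \<omega> _ \<phi>L]) simp
  have hB: "h \<in> bochner_L2_L2 (lebesgue_on \<omega>) 0 \<tau>" using h by (simp add: null_control_def)
  define q where "q t = L2_inner (lebesgue_on \<omega>) (h t) (\<phi> k)" for t
  have q: "integrable ?T q" unfolding q_def[abs_def] by (rule bochner_L2_L2D(4)[OF hB \<phi>\<omega>])
  have q': "integrable ?T (\<lambda>t. q (\<tau> - t))" using integrable_reflect[of \<tau> \<tau> 0 q] q by simp
  obtain v where sol: "finite_energy_solution s \<tau> (\<lambda>t. pivot (\<lambda>x. indicator \<omega> x * h (\<tau> - t) x)) (\<phi> n) (\<lambda>t. v (\<tau> - t))"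
    and v0: "L2_has_value_at leb_D 0 \<tau> v 0 (\<lambda>x. 0)"
    using h by (auto simp: null_control_def backward_finite_energy_solution_def)
  have F: "pivot (\<lambda>x. indicator \<omega> x * h (\<tau> - t) x) (\<lambda>x. c * \<phi> k x) = c * q (\<tau> - t)" for t c
    using L2_inner_restrict[OF \<omega>, of "\<phi> k" "h (\<tau> - t)"]
    by (simp add: pivot_def q_def L2_inner_scale_right L2_inner_commute[of "lebesgue_on \<omega>"]
        L2_inner_commute[of leb_D "\<phi> k"])
  obtain Z where Z: "continuous_on {0..\<tau>} Z" "AE t in ?T. L2_inner leb_D (v (\<tau> - t)) (\<phi> k) = Z t"
    "\<And>t. t \<in> {0..\<tau>} \<Longrightarrow> exp (lam k * t) * Z t
      = L2_inner leb_D (\<phi> n) (\<phi> k) + (LINT r|leb_I 0 t. q (\<tau> - r) * exp (lam k * r))"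
    by (rule finite_energy_solution_coefficient[OF \<tau> sol \<phi>L eig F q']) (rule that)
  have vL: "AE t in ?T. v t \<in> L2_space leb_D"
  proof -
    have "(\<lambda>t. v (\<tau> - t)) \<in> bochner_L2 (H0s s) (Hs_norm s) 0 \<tau>"
      using sol by (simp add: finite_energy_solution_def)
    from AE_reflect[OF bochner_L2_L2D(1)[OF bochner_H0s_imp_L2[OF this]], of \<tau>]
    show ?thesis unfolding diff_self diff_zero by simp
  qed
  obtain G where G: "continuous_on {0..\<tau>} G" "AE t in ?T. L2_inner leb_D (v t) (\<phi> k) = G t"
    "G 0 = L2_inner leb_D (\<lambda>x. 0) (\<phi> k)"
    by (rule has_value_at_inner[OF v0 _ L2_space_zero vL \<phi>L]) (use \<tau> that in auto)
  have "AE t in ?T. L2_inner leb_D (v (\<tau> - t)) (\<phi> k) = G (\<tau> - t)"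
    using AE_reflect[OF G(2), of \<tau>] unfolding diff_self diff_zero .
  then have "AE t in ?T. Z t = G (\<tau> - t)" using Z(2) by eventually_elim simp
  moreover have "continuous_on {0..\<tau>} (\<lambda>t. G (\<tau> - t))"
    by (rule continuous_on_compose2[OF G(1)]) (auto intro!: continuous_intros)
  ultimately have "Z \<tau> = G (\<tau> - \<tau>)"
    using \<tau> by (intro continuous_AE_eq_imp_eq[OF \<tau> Z(1)]) auto
  then have "Z \<tau> = 0" using G(3) by simp
  then have "(LINT r|?T. q (\<tau> - r) * exp (lam k * r)) = - (if k = n then 1 else 0)"
    using Z(3)[of \<tau>] \<tau> orthonormal_basisD(2)[OF basis, of n k] by (auto split: if_splits)
  also have "(LINT r|?T. q (\<tau> - r) * exp (lam k * r)) = (LINT r|?T. q r * exp (lam k * (\<tau> - r)))"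
    using LINT_reflect[of 0 \<tau> "\<lambda>r. q r * exp (lam k * (\<tau> - r))" \<tau>] by simp
  also have "\<dots> = (LINT r|?T. exp (lam k * \<tau>) * (exp (- lam k * r) * q r))"
  proof -
    have "exp (lam k * (\<tau> - r)) = exp (lam k * \<tau>) * exp (- lam k * r)" for r
      by (simp add: right_diff_distrib flip: exp_add)
    then show ?thesis by (simp only: mult_ac)
  qed
  finally have "exp (lam k * \<tau>) * (LINT r|?T. exp (- lam k * r) * q r) = - (if k = n then 1 else 0)"
    by simp
  then have "exp (- lam k * \<tau>) * (exp (lam k * \<tau>) * (LINT r|?T. exp (- lam k * r) * q r))
      = exp (- lam k * \<tau>) * - (if k = n then 1 else 0)"
    by simp
  then show ?thesis
    unfolding q_def by (auto simp: mult.assoc[symmetric] exp_minus split: if_splits)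
qed

section \<open>The response to a source of the form \<open>f(x) \<sigma>(t)\<close>\<close>

lemma W1inf_with_derivE:
  assumes T: "0 < T" and \<sigma>: "W1inf_with_deriv 0 T \<sigma> \<sigma>'"
  obtains C where "0 \<le> C" "continuous_on {0..T} \<sigma>" "\<And>t. t \<in> {0..T} \<Longrightarrow> \<bar>\<sigma> t\<bar> \<le> C"
    "\<sigma>' \<in> borel_measurable (leb_I 0 T)" "AE t in leb_I 0 T. \<bar>\<sigma>' t\<bar> \<le> C"
    "integrable (leb_I 0 T) \<sigma>'"
    "\<And>t. t \<in> {0..T} \<Longrightarrow> \<sigma> t = \<sigma> 0 + (LINT r|leb_I 0 t. \<sigma>' r)"
proof -
  let ?T = "leb_I 0 T"
  have c: "continuous_on {0..T} \<sigma>" and w: "weak_deriv 0 T \<sigma> \<sigma>'"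
    and m: "\<sigma>' \<in> borel_measurable ?T"
    using \<sigma> by (auto simp: W1inf_with_deriv_def Linf_def)
  obtain C1 where C1: "AE t in ?T. \<bar>\<sigma>' t\<bar> \<le> C1"
    using \<sigma> by (auto simp: W1inf_with_deriv_def Linf_def)
  obtain C2 where C2: "\<And>t. t \<in> {0..T} \<Longrightarrow> \<bar>\<sigma> t\<bar> \<le> C2"
    using compact_imp_bounded[OF compact_continuous_image[OF c compact_Icc]]
    unfolding bounded_iff by fastforce
  have i: "integrable ?T \<sigma>'"
  proof (rule Bochner_Integration.integrable_bound[OF _ m])
    show "integrable ?T (\<lambda>_. C1)" by (rule continuous_integrable_open_interval) simp
    show "AE t in ?T. norm (\<sigma>' t) \<le> norm C1" using C1 by eventually_elim simp
  qed
  have rep: "\<sigma> t = \<sigma> 0 + (LINT r|leb_I 0 t. \<sigma>' r)" if "t \<in> {0..T}" for t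
    by (rule weak_deriv_continuous_representative[OF T c _ continuous_integrable_open_interval[OF c] i w that]) simp
  show ?thesis
  proof (rule that[of "max 0 (max C1 C2)", OF _ c _ m _ i rep])
    show "AE t in ?T. \<bar>\<sigma>' t\<bar> \<le> max 0 (max C1 C2)" using C1 by eventually_elim simp
    show "\<bar>\<sigma> t\<bar> \<le> max 0 (max C1 C2)" if "t \<in> {0..T}" for t using C2[OF that] by simp
  qed simp_all
qed

lemma exp_conv_bound:
  assumes i: "integrable (leb_I 0 T) p" and C: "AE t in leb_I 0 T. \<bar>p t\<bar> \<le> C"
    and C0: "0 \<le> C" and l: "0 \<le> l" and t: "t \<in> {0..T}"
  shows "\<bar>exp_conv l p t\<bar> \<le> C * T"
proof -
  let ?M = "leb_I 0 t"
  have i': "integrable ?M p" using integrable_subinterval[OF i, of 0 t] t by simp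
  have pe: "integrable ?M (\<lambda>r. p r * exp (- l * (t - r)))"
    by (rule bounded_mult_integrable[OF i']) (intro continuous_intros)
  have Ci: "integrable ?M (\<lambda>_. C)" by (rule continuous_integrable_open_interval) simp
  have "\<bar>exp_conv l p t\<bar> \<le> (LINT r|?M. \<bar>p r * exp (- l * (t - r))\<bar>)"
    unfolding exp_conv_reflect by (rule integral_abs_bound)
  also have "\<dots> \<le> (LINT r|?M. C)"
  proof (rule integral_mono_AE)
    have "AE r in ?M. \<bar>p r\<bar> \<le> C" using AE_subinterval[OF C, of 0 t] t by simp
    then show "AE r in ?M. \<bar>p r * exp (- l * (t - r))\<bar> \<le> C"
      using AE_space
    proof eventually_elim
      case (elim r)
      then have "exp (- l * (t - r)) \<le> 1" using l by simp
      then have "\<bar>p r\<bar> * exp (- l * (t - r)) \<le> C * 1" using elim C0 by (intro mult_mono) auto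
      then show ?case by (simp add: abs_mult)
    qed
  qed (use pe Ci in auto)
  also have "\<dots> = C * t"
    using LINT_FTC[of 0 t "\<lambda>_. C" "\<lambda>r. C * r"] t by (auto intro!: derivative_eq_intros)
  also have "\<dots> \<le> C * T" using t C0 by (intro mult_left_mono) auto
  finally show ?thesis .
qed

text \<open>The coefficients of the solution are convolutions of \<open>\<sigma>\<close> with decaying exponentials. Those of
  its formal time derivative are bounded, uniformly in time, by a multiple of the coefficients of
  \<open>f\<close>, so that the Riesz-Fischer theorem provides the time derivative itself.\<close>

lemma source_solution_time_deriv:
  assumes T: "0 < T" and f: "f \<in> L2_space leb_D" and eigen: "dirichlet_eigensystem s lam \<phi>"
    and \<sigma>: "W1inf_with_deriv 0 T \<sigma> \<sigma>'"
    and u: "finite_energy_solution s T (\<lambda>t. pivot (\<lambda>x. f x * \<sigma> t)) (\<lambda>x. 0) u"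
  obtains V where "has_time_deriv_L2 leb_D 0 T u V"
    "\<And>k. AE t in leb_I 0 T. L2_inner leb_D (u t) (\<phi> k) = L2_inner leb_D f (\<phi> k) * exp_conv (lam k) \<sigma> t"
    "\<And>k t. t \<in> {0<..<T} \<Longrightarrow> L2_inner leb_D (V t) (\<phi> k)
      = L2_inner leb_D f (\<phi> k) * (\<sigma> 0 * exp (- lam k * t) + exp_conv (lam k) \<sigma>' t)"
proof -
  let ?T = "leb_I 0 T"
  obtain C where C: "0 \<le> C" "continuous_on {0..T} \<sigma>" "AE t in ?T. \<bar>\<sigma>' t\<bar> \<le> C" "integrable ?T \<sigma>'"
    "\<And>t. t \<in> {0..T} \<Longrightarrow> \<sigma> t = \<sigma> 0 + (LINT r|leb_I 0 t. \<sigma>' r)"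
    by (rule W1inf_with_derivE[OF T \<sigma>]) (rule that)
  have basis: "L2_orthonormal_basis leb_D \<phi>" and lam: "\<And>k. 0 < lam k"
    and eig: "\<And>k. dirichlet_frac_laplacian s (\<phi> k) (\<lambda>x. lam k * \<phi> k x)"
    using eigen by (simp_all add: dirichlet_eigensystem_def)
  note \<phi>L = orthonormal_basisD(1)[OF basis]
  have uB: "u \<in> bochner_L2_L2 leb_D 0 T"
    using u by (auto simp: finite_energy_solution_def intro: bochner_H0s_imp_L2)
  define a where "a k = L2_inner leb_D f (\<phi> k)" for k
  define y where "y k t = \<sigma> 0 * exp (- lam k * t) + exp_conv (lam k) \<sigma>' t" for k t
  have y_eq: "y k t = \<sigma> t - lam k * exp_conv (lam k) \<sigma> t" if "t \<in> {0..T}" for k t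
    using exp_conv_deriv[OF C(4) C(5) that] by (simp add: y_def)
  have \<sigma>i: "integrable ?T \<sigma>" by (rule continuous_integrable_open_interval[OF C(2)])
  have coeff: "(AE t in ?T. L2_inner leb_D (u t) (\<phi> k) = a k * exp_conv (lam k) \<sigma> t)
    \<and> weak_deriv 0 T (\<lambda>t. L2_inner leb_D (u t) (\<phi> k)) (\<lambda>t. a k * \<sigma> t - lam k * L2_inner leb_D (u t) (\<phi> k))" for k
  proof -
    have F: "pivot (\<lambda>x. f x * \<sigma> t) (\<lambda>x. c * \<phi> k x) = c * (a k * \<sigma> t)" for t c
      by (simp add: pivot_def a_def L2_inner_scale_right L2_inner_scale_left mult.commute[of "f _"])
    have ai: "integrable ?T (\<lambda>t. a k * \<sigma> t)" using \<sigma>i by simp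
    obtain Z where Z: "continuous_on {0..T} Z" "AE t in ?T. L2_inner leb_D (u t) (\<phi> k) = Z t"
      "weak_deriv 0 T (\<lambda>t. L2_inner leb_D (u t) (\<phi> k)) (\<lambda>t. a k * \<sigma> t - lam k * L2_inner leb_D (u t) (\<phi> k))"
      "\<And>t. t \<in> {0..T} \<Longrightarrow> exp (lam k * t) * Z t
        = L2_inner leb_D (\<lambda>x. 0) (\<phi> k) + (LINT r|leb_I 0 t. a k * \<sigma> r * exp (lam k * r))"
      by (rule finite_energy_solution_coefficient[OF T u L2_space_zero eig F ai]) (rule that)
    have Z_eq: "Z t = a k * exp_conv (lam k) \<sigma> t" if "t \<in> {0..T}" for t
    proof -
      have "exp (lam k * t) * Z t = exp (lam k * t) * (a k * exp_conv (lam k) \<sigma> t)"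
        using Z(4)[OF that] exp_conv_eq_primitive[of "lam k" t \<sigma>]
        by (simp add: mult.assoc mult.left_commute[of _ "a k"])
      then show ?thesis by simp
    qed
    have "AE t in ?T. L2_inner leb_D (u t) (\<phi> k) = a k * exp_conv (lam k) \<sigma> t"
      using Z(2) AE_space by eventually_elim (simp add: Z_eq)
    then show ?thesis using Z(3) by simp
  qed
  have y_cont: "continuous_on {0..T} (y k)" for k
  proof -
    have "integrable ?T (\<lambda>r. \<sigma> r * exp (lam k * r))"
      by (intro continuous_integrable_open_interval continuous_intros C(2))
    from continuous_on_primitive[OF this]
    have "continuous_on {0..T} (\<lambda>t. \<sigma> t - lam k * (exp (- (lam k * t)) * (exp (lam k * t) * exp_conv (lam k) \<sigma> t)))"
      unfolding exp_conv_eq_primitive by (intro continuous_intros C(2))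
    then show ?thesis
      by (rule continuous_on_eq) (simp add: y_eq mult.assoc[symmetric] flip: exp_add)
  qed
  have y_bound: "\<bar>a k * y k t\<bar> \<le> (\<bar>\<sigma> 0\<bar> + C * T) * \<bar>a k\<bar>" if "t \<in> {0<..<T}" for k t
  proof -
    have "\<bar>exp_conv (lam k) \<sigma>' t\<bar> \<le> C * T"
      by (rule exp_conv_bound[OF C(4,3,1)]) (use lam[of k] that in auto)
    moreover have "\<bar>\<sigma> 0 * exp (- lam k * t)\<bar> \<le> \<bar>\<sigma> 0\<bar>"
      using lam[of k] that by (simp add: abs_mult mult_left_le)
    ultimately have "\<bar>y k t\<bar> \<le> \<bar>\<sigma> 0\<bar> + C * T" unfolding y_def by linarith
    from mult_left_mono[OF this, of "\<bar>a k\<bar>"] show ?thesis by (simp add: abs_mult mult.commute)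
  qed
  have a_sum: "summable (\<lambda>k. (a k)\<^sup>2)"
    using Parseval[OF basis f f] by (simp add: sums_iff a_def power2_eq_square)
  obtain V where V: "V \<in> bochner_L2_L2 leb_D 0 T" "\<And>t. t \<in> {0<..<T} \<Longrightarrow> V t \<in> L2_space leb_D"
    "\<And>t k. t \<in> {0<..<T} \<Longrightarrow> L2_inner leb_D (V t) (\<phi> k) = a k * y k t"
  proof (rule bochner_L2_from_coefficients[OF basis _ y_bound a_sum])
    show "(\<lambda>t. a k * y k t) \<in> borel_measurable ?T" for k
      using borel_measurable_integrable[OF continuous_integrable_open_interval[OF y_cont]] by simp
  qed (assumption | rule that)+
  have "has_time_deriv_L2 leb_D 0 T u V"
    unfolding has_time_deriv_L2_def
  proof (intro conjI V(1) ballI)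
    fix W assume W: "W \<in> L2_space leb_D"
    show "weak_deriv 0 T (\<lambda>t. L2_inner leb_D (u t) W) (\<lambda>t. L2_inner leb_D (V t) W)"
      unfolding weak_deriv_def
    proof
      fix \<psi> assume \<psi>: "\<psi> \<in> test_functions 0 T"
      have mode: "(LINT t|?T. deriv \<psi> t * (L2_inner leb_D (u t) (\<phi> k) * L2_inner leb_D W (\<phi> k)))
        = - (LINT t|?T. \<psi> t * (L2_inner leb_D (V t) (\<phi> k) * L2_inner leb_D W (\<phi> k)))" for k
      proof -
        have "(LINT t|?T. deriv \<psi> t * (L2_inner leb_D (u t) (\<phi> k) * L2_inner leb_D W (\<phi> k)))
          = (LINT t|?T. L2_inner leb_D (u t) (\<phi> k) * deriv \<psi> t) * L2_inner leb_D W (\<phi> k)"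
          by (simp add: mult.assoc[symmetric] mult.commute[of "deriv \<psi> _"])
        also have "(LINT t|?T. L2_inner leb_D (u t) (\<phi> k) * deriv \<psi> t)
          = - (LINT t|?T. (a k * \<sigma> t - lam k * L2_inner leb_D (u t) (\<phi> k)) * \<psi> t)"
          using coeff[of k] \<psi> unfolding weak_deriv_def by blast
        also have "(LINT t|?T. (a k * \<sigma> t - lam k * L2_inner leb_D (u t) (\<phi> k)) * \<psi> t)
          = (LINT t|?T. \<psi> t * L2_inner leb_D (V t) (\<phi> k))"
        proof (rule lebesgue_on_integral_cong_AE(1))
          have "AE t in ?T. L2_inner leb_D (u t) (\<phi> k) = a k * exp_conv (lam k) \<sigma> t"
            using coeff[of k] by simp
          then show "AE t in ?T. (a k * \<sigma> t - lam k * L2_inner leb_D (u t) (\<phi> k)) * \<psi> t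
            = \<psi> t * L2_inner leb_D (V t) (\<phi> k)"
            using AE_space
            by eventually_elim (simp add: V(3) y_eq algebra_simps)
        qed simp
        finally show ?thesis by (simp add: mult.assoc[symmetric])
      qed
      have "(\<lambda>k. LINT t|?T. deriv \<psi> t * (L2_inner leb_D (u t) (\<phi> k) * L2_inner leb_D W (\<phi> k)))
          sums (LINT t|?T. deriv \<psi> t * L2_inner leb_D (u t) W)"
        by (rule Parseval_integral(1)[OF basis test_functions_continuous(3)[OF \<psi>] uB bochner_L2_const[OF W]])
      moreover have "(\<lambda>k. - (LINT t|?T. \<psi> t * (L2_inner leb_D (V t) (\<phi> k) * L2_inner leb_D W (\<phi> k))))
          sums - (LINT t|?T. \<psi> t * L2_inner leb_D (V t) W)"
        by (intro sums_minus
            Parseval_integral(1)[OF basis test_functions_continuous(2)[OF \<psi>] V(1) bochner_L2_const[OF W]])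
      ultimately have "(LINT t|?T. deriv \<psi> t * L2_inner leb_D (u t) W) = - (LINT t|?T. \<psi> t * L2_inner leb_D (V t) W)"
        unfolding mode by (rule sums_unique2)
      then show "(LINT t|?T. L2_inner leb_D (u t) W * deriv \<psi> t) = - (LINT t|?T. L2_inner leb_D (V t) W * \<psi> t)"
        by (simp add: mult.commute)
    qed
  qed
  then show ?thesis
    using coeff V(3) by (intro that[of V]) (simp_all add: a_def y_def)
qed

section \<open>Restriction to \<open>\<omega>\<close> and extension by zero in time\<close>

lemma bochner_L2_indicator:
  fixes A B :: "real set"
  assumes AB: "A \<subseteq> B" "A \<in> sets lebesgue" "B \<in> sets lebesgue"
    and v: "v \<in> bochner_L2_L2 (lebesgue_on B) a b"
  shows "(\<lambda>t x. indicator A x * v t x) \<in> bochner_L2_L2 (lebesgue_on B) a b"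
proof -
  let ?B = "lebesgue_on B" and ?T = "leb_I a b"
  have L2: "(\<lambda>x. indicator A x * w x) \<in> L2_space ?B" if "w \<in> L2_space ?B" for w
    by (rule L2_zero_extension[OF AB L2_restrict[OF AB that]])
  have norm: "L2_norm ?B (\<lambda>x. indicator A x * w x) \<le> L2_norm ?B w" if w: "w \<in> L2_space ?B" for w
  proof -
    have "(\<lambda>x. indicator B x * (indicator A x * w x)\<^sup>2) = (\<lambda>x. indicator A x * (w x)\<^sup>2)"
      using AB(1) by (auto simp: indicator_def fun_eq_iff)
    then have "(L2_norm ?B (\<lambda>x. indicator A x * w x))\<^sup>2 = (L2_norm (lebesgue_on A) w)\<^sup>2"
      using AB by (simp add: L2_norm_sq_integral lebesgue_on_integral_eq)
    then have "L2_norm ?B (\<lambda>x. indicator A x * w x) = L2_norm (lebesgue_on A) w"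
      by (simp add: L2_norm_nonneg)
    then show ?thesis using L2_norm_restrict[OF AB w] by simp
  qed
  obtain S where S: "\<And>k. simple_function ?T (S k)" "\<And>k t. t \<in> {a<..<b} \<Longrightarrow> S k t \<in> L2_space ?B"
    "AE t in ?T. v t \<in> L2_space ?B \<and> (\<lambda>k. L2_norm ?B (\<lambda>x. S k t x - v t x)) \<longlonglongrightarrow> 0"
    by (rule bochner_L2_L2E[OF v]) (rule that)
  show ?thesis
  proof (rule bochner_L2_L2I[where S="\<lambda>k t x. indicator A x * S k t x"])
    show "simple_function ?T (\<lambda>t x. indicator A x * S k t x)" for k
      using simple_function_compose[OF S(1), of "\<lambda>w x. indicator A x * w x" k] by (simp add: o_def)
    show "(\<lambda>x. indicator A x * S k t x) \<in> L2_space ?B" if "t \<in> {a<..<b}" for k t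
      by (rule L2[OF S(2)[OF that]])
    show "AE t in ?T. (\<lambda>x. indicator A x * v t x) \<in> L2_space ?B \<and>
      (\<lambda>k. L2_norm ?B (\<lambda>x. indicator A x * S k t x - indicator A x * v t x)) \<longlonglongrightarrow> 0"
      using S(3) AE_space
    proof eventually_elim
      case (elim t)
      then have t: "t \<in> {a<..<b}" by simp
      have "L2_norm ?B (\<lambda>x. indicator A x * S k t x - indicator A x * v t x)
          \<le> L2_norm ?B (\<lambda>x. S k t x - v t x)" for k
        unfolding right_diff_distrib[symmetric]
        by (rule norm, rule L2_space_diff[OF S(2)[OF t]]) (use elim in blast)
      then have "(\<lambda>k. L2_norm ?B (\<lambda>x. indicator A x * S k t x - indicator A x * v t x)) \<longlonglongrightarrow> 0"
        by (intro Lim_null_comparison[OF _ conjunct2[OF elim(1)]]) (simp add: L2_norm_nonneg)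
      then show ?case using elim L2 by blast
    qed
    show "integrable ?T (\<lambda>t. (L2_norm ?B (v t))\<^sup>2)" by (rule bochner_L2_L2D(2)[OF v])
    show "AE t in ?T. (L2_norm ?B (\<lambda>x. indicator A x * v t x))\<^sup>2 \<le> (L2_norm ?B (v t))\<^sup>2"
      using bochner_L2_L2D(1)[OF v] by eventually_elim (intro power_mono norm L2_norm_nonneg)
  qed
qed

lemma bochner_L2_restrict_extend:
  fixes A B :: "real set"
  assumes AB: "A \<subseteq> B" "A \<in> sets lebesgue" "B \<in> sets lebesgue"
    and v: "v \<in> bochner_L2_L2 (lebesgue_on B) 0 \<tau>" and \<tau>: "0 < \<tau>" "\<tau> \<le> T"
  shows "extend_by_zero \<tau> v \<in> bochner_L2_L2 (lebesgue_on A) 0 T"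
proof -
  let ?T = "leb_I 0 T" and ?A = "lebesgue_on A" and ?B = "lebesgue_on B"
  obtain S where S: "\<And>k. simple_function (leb_I 0 \<tau>) (S k)"
    "\<And>k t. t \<in> {0<..<\<tau>} \<Longrightarrow> S k t \<in> L2_space ?B"
    "AE t in leb_I 0 \<tau>. v t \<in> L2_space ?B \<and> (\<lambda>k. L2_norm ?B (\<lambda>x. S k t x - v t x)) \<longlonglongrightarrow> 0"
    by (rule bochner_L2_L2E[OF v]) (rule that)
  define S' where "S' k t = (if t < \<tau> then S k t else (\<lambda>x. 0))" for k t
  have AEv: "AE t in lebesgue. t \<in> {0<..<\<tau>} \<longrightarrow>
      v t \<in> L2_space ?B \<and> (\<lambda>k. L2_norm ?B (\<lambda>x. S k t x - v t x)) \<longlonglongrightarrow> 0"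
    using S(3) by (rule AE_lebesgue_on_iff[THEN iffD1, rotated]) simp
  have ne: "AE t in lebesgue. t \<noteq> \<tau>"
    by (rule AE_completion, rule AE_lborel_singleton)
  show ?thesis
  proof (rule bochner_L2_L2I)
    show "simple_function ?T (S' k)" for k
      unfolding simple_function_def
    proof (intro conjI ballI)
      have "S' k ` space ?T \<subseteq> insert (\<lambda>x. 0) (S k ` {0<..<\<tau>})"
        by (auto simp: S'_def)
      moreover have "finite (S k ` {0<..<\<tau>})" using S(1)[of k] by (simp add: simple_function_def)
      ultimately show "finite (S' k ` space ?T)" by (meson finite_insert finite_subset)
      fix y
      have "S k -` {y} \<inter> {0<..<\<tau>} \<in> sets lebesgue"
      proof (cases "y \<in> S k ` {0<..<\<tau>}")
        case True
        then show ?thesis using S(1)[of k] by (auto simp: simple_function_def sets_restrict_space_iff)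
      next
        case False
        then have "S k -` {y} \<inter> {0<..<\<tau>} = {}" by auto
        then show ?thesis by simp
      qed
      moreover have "S' k -` {y} \<inter> space ?T
          = (S k -` {y} \<inter> {0<..<\<tau>}) \<union> (if y = (\<lambda>x. 0) then {\<tau>..<T} else {})"
        using \<tau> by (auto simp: S'_def split: if_splits)
      ultimately show "S' k -` {y} \<inter> space ?T \<in> sets ?T"
        by (subst sets_restrict_space_iff) auto
    qed
    show "S' k t \<in> L2_space ?A" if "t \<in> {0<..<T}" for k t
      using that S(2) by (auto simp: S'_def intro: L2_restrict[OF AB] L2_space_zero)
    have "AE t in lebesgue. t \<in> {0<..<T} \<longrightarrow> extend_by_zero \<tau> v t \<in> L2_space ?A \<and>
        (\<lambda>k. L2_norm ?A (\<lambda>x. S' k t x - extend_by_zero \<tau> v t x)) \<longlonglongrightarrow> 0"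
      using AEv ne
    proof eventually_elim
      case (elim t)
      show ?case
      proof (cases "t < \<tau>")
        case True
        have "(\<lambda>k. L2_norm ?A (\<lambda>x. S k t x - v t x)) \<longlonglongrightarrow> 0" if t: "t \<in> {0<..<\<tau>}"
        proof (rule Lim_null_comparison)
          show "\<forall>\<^sub>F k in sequentially. norm (L2_norm ?A (\<lambda>x. S k t x - v t x)) \<le> L2_norm ?B (\<lambda>x. S k t x - v t x)"
          proof (rule always_eventually, rule allI)
            fix k
            have "(\<lambda>x. S k t x - v t x) \<in> L2_space ?B"
              by (rule L2_space_diff[OF S(2)[OF t]]) (use elim t in blast)
            from L2_norm_restrict[OF AB this]
            show "norm (L2_norm ?A (\<lambda>x. S k t x - v t x)) \<le> L2_norm ?B (\<lambda>x. S k t x - v t x)"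
              by (simp add: L2_norm_nonneg)
          qed
        qed (use elim t in auto)
        then show ?thesis
          using elim True by (auto simp: extend_by_zero_def S'_def intro: L2_restrict[OF AB])
      next
        case False
        then show ?thesis using elim
          by (auto simp: extend_by_zero_def S'_def L2_space_zero L2_norm_def)
      qed
    qed
    then show "AE t in ?T. extend_by_zero \<tau> v t \<in> L2_space ?A \<and>
        (\<lambda>k. L2_norm ?A (\<lambda>x. S' k t x - extend_by_zero \<tau> v t x)) \<longlonglongrightarrow> 0"
      by (rule AE_lebesgue_on_iff[THEN iffD2, rotated]) simp
    let ?g = "\<lambda>t. indicator {0<..<\<tau>} t * (L2_norm ?B (v t))\<^sup>2"
    have "integrable lebesgue ?g"
      using bochner_L2_L2D(2)[OF v] by (simp add: lebesgue_on_integrable_iff)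
    moreover have "(\<lambda>t. indicator {0<..<T} t * ?g t) = ?g"
      using \<tau> by (auto simp: indicator_def fun_eq_iff)
    ultimately show "integrable ?T ?g" by (simp add: lebesgue_on_integrable_iff)
    have "AE t in lebesgue. t \<in> {0<..<T} \<longrightarrow> (L2_norm ?A (extend_by_zero \<tau> v t))\<^sup>2 \<le> ?g t"
      using AEv ne
    proof eventually_elim
      case (elim t)
      show ?case
      proof (cases "t < \<tau>")
        case True
        have "(L2_norm ?A (v t))\<^sup>2 \<le> (L2_norm ?B (v t))\<^sup>2" if "t \<in> {0<..<\<tau>}"
          by (intro power_mono L2_norm_restrict[OF AB] L2_norm_nonneg) (use elim that in auto)
        then show ?thesis using True by (simp add: extend_by_zero_def)
      next
        case False
        then show ?thesis using elim by (simp add: extend_by_zero_def L2_norm_def)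
      qed
    qed
    then show "AE t in ?T. (L2_norm ?A (extend_by_zero \<tau> v t))\<^sup>2 \<le> ?g t"
      by (simp add: AE_lebesgue_on_iff)
  qed
qed

text \<open>On \<open>(0, T)\<close> the extension agrees with \<open>v'\<close>; in this form its membership in the Bochner space over
  \<open>A\<close> is an instance of \<open>bochner_L2_restrict_extend\<close>.\<close>

lemma has_time_deriv_L2_restrict:
  fixes A B :: "real set"
  assumes AB: "A \<subseteq> B" "A \<in> sets lebesgue" "B \<in> sets lebesgue" and T: "0 < T"
    and v: "has_time_deriv_L2 (lebesgue_on B) 0 T v v'"
  shows "has_time_deriv_L2 (lebesgue_on A) 0 T v (extend_by_zero T v')"
  unfolding has_time_deriv_L2_def
proof (intro conjI ballI)
  let ?I = "leb_I 0 T"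
  show "extend_by_zero T v' \<in> bochner_L2_L2 (lebesgue_on A) 0 T"
    by (rule bochner_L2_restrict_extend[OF AB]) (use v T in \<open>auto simp: has_time_deriv_L2_def\<close>)
  fix w assume w: "w \<in> L2_space (lebesgue_on A)"
  have wd: "weak_deriv 0 T (\<lambda>t. L2_inner (lebesgue_on B) (v t) (\<lambda>x. indicator A x * w x))
      (\<lambda>t. L2_inner (lebesgue_on B) (v' t) (\<lambda>x. indicator A x * w x))"
    using v L2_zero_extension[OF AB w] by (simp add: has_time_deriv_L2_def)
  show "weak_deriv 0 T (\<lambda>t. L2_inner (lebesgue_on A) (v t) w)
      (\<lambda>t. L2_inner (lebesgue_on A) (extend_by_zero T v' t) w)"
    unfolding weak_deriv_def
  proof
    fix \<psi> assume "\<psi> \<in> test_functions 0 T"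
    then have "(LINT t|?I. L2_inner (lebesgue_on A) (v t) w * deriv \<psi> t)
      = - (LINT t|?I. L2_inner (lebesgue_on A) (v' t) w * \<psi> t)"
      using wd by (simp add: weak_deriv_def L2_inner_restrict[OF AB])
    also have "(LINT t|?I. L2_inner (lebesgue_on A) (v' t) w * \<psi> t)
      = (LINT t|?I. L2_inner (lebesgue_on A) (extend_by_zero T v' t) w * \<psi> t)"
      by (rule Bochner_Integration.integral_cong) (auto simp: extend_by_zero_def)
    finally show "(LINT t|?I. L2_inner (lebesgue_on A) (v t) w * deriv \<psi> t)
      = - (LINT t|?I. L2_inner (lebesgue_on A) (extend_by_zero T v' t) w * \<psi> t)" .
  qed
qed

lemma LINT_extend_by_zero:
  fixes g k :: "real \<Rightarrow> real"
  assumes \<tau>: "0 < \<tau>" "\<tau> \<le> T" and k: "\<And>t. t \<in> {0<..<\<tau>} \<Longrightarrow> k t = g t"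
    "\<And>t. \<tau> < t \<Longrightarrow> k t = 0"
  shows "(LINT t|leb_I 0 T. k t) = (LINT t|leb_I 0 \<tau>. g t)"
proof -
  have "(LINT t|leb_I 0 T. k t) = (LINT t|leb_I 0 T. indicator {0<..<\<tau>} t * g t)"
  proof (rule lebesgue_on_integral_cong_AE(1))
    have "AE t in lebesgue. t \<noteq> \<tau>" by (rule AE_completion, rule AE_lborel_singleton)
    then have "AE t in lebesgue. t \<in> {0<..<T} \<longrightarrow> k t = indicator {0<..<\<tau>} t * g t"
      by eventually_elim (use k in \<open>auto simp: indicator_def\<close>)
    then show "AE t in leb_I 0 T. k t = indicator {0<..<\<tau>} t * g t"
      by (simp add: AE_lebesgue_on_iff)
  qed simp
  also have "\<dots> = (LINT t|lebesgue. indicator {0<..<T} t * (indicator {0<..<\<tau>} t * g t))"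
    by (simp add: lebesgue_on_integral_eq)
  also have "(\<lambda>t. indicator {0<..<T} t * (indicator {0<..<\<tau>} t * g t)) = (\<lambda>t. indicator {0<..<\<tau>} t * g t)"
    using \<tau> by (auto simp: indicator_def fun_eq_iff)
  finally show ?thesis by (simp add: lebesgue_on_integral_eq)
qed

text \<open>The final value zero prevents the extension by zero from jumping at time \<open>\<tau>\<close>.\<close>

lemma has_time_deriv_L2_extend:
  fixes A B :: "real set"
  assumes AB: "A \<subseteq> B" "A \<in> sets lebesgue" "B \<in> sets lebesgue" and \<tau>: "0 < \<tau>" "\<tau> \<le> T"
    and v: "v \<in> bochner_L2_L2 (lebesgue_on B) 0 \<tau>" and v': "has_time_deriv_L2 (lebesgue_on B) 0 \<tau> v v'"
    and zero: "L2_has_value_at (lebesgue_on B) 0 \<tau> v \<tau> (\<lambda>x. 0)"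
  shows "has_time_deriv_L2 (lebesgue_on A) 0 T (extend_by_zero \<tau> v) (extend_by_zero \<tau> v')"
  unfolding has_time_deriv_L2_def
proof (intro conjI ballI)
  let ?I = "leb_I 0 T"
  let ?B = "lebesgue_on B" and ?A = "lebesgue_on A" and ?T = "leb_I 0 \<tau>"
  have v'B: "v' \<in> bochner_L2_L2 ?B 0 \<tau>" using v' by (simp add: has_time_deriv_L2_def)
  show "extend_by_zero \<tau> v' \<in> bochner_L2_L2 ?A 0 T"
    by (rule bochner_L2_restrict_extend[OF AB v'B \<tau>])
  fix w assume w: "w \<in> L2_space ?A"
  define W where "W = (\<lambda>x. indicator A x * w x)"
  have W: "W \<in> L2_space ?B" unfolding W_def by (rule L2_zero_extension[OF AB w])
  define g where "g t = L2_inner ?B (v t) W" for t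
  define q where "q t = L2_inner ?B (v' t) W" for t
  have g: "integrable ?T g" unfolding g_def[abs_def] by (rule bochner_L2_L2D(4)[OF v W])
  have q: "integrable ?T q" unfolding q_def[abs_def] by (rule bochner_L2_L2D(4)[OF v'B W])
  have wd: "weak_deriv 0 \<tau> g q" using v' W by (simp add: has_time_deriv_L2_def g_def[abs_def] q_def[abs_def])
  obtain G where G: "continuous_on {0..\<tau>} G" "AE t in ?T. g t = G t" "G \<tau> = L2_inner ?B (\<lambda>x. 0) W"
    unfolding g_def
    by (rule has_value_at_inner[OF zero _ L2_space_zero bochner_L2_L2D(1)[OF v] W]) (use \<tau> that in auto)
  have rep: "G t = G 0 + (LINT r|leb_I 0 t. q r)" if "t \<in> {0..\<tau>}" for t
    by (rule weak_deriv_continuous_representative[OF \<tau>(1) G(1,2) g q wd that])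
  show "weak_deriv 0 T (\<lambda>t. L2_inner ?A (extend_by_zero \<tau> v t) w)
      (\<lambda>t. L2_inner ?A (extend_by_zero \<tau> v' t) w)"
    unfolding weak_deriv_def
  proof
    fix \<psi> assume \<psi>: "\<psi> \<in> test_functions 0 T"
    note c\<psi> = test_functions_continuous(3)[OF \<psi>, of "{0..\<tau>}"]
    let ?P = "\<lambda>t. LINT r|leb_I 0 t. q r"
    have P: "integrable ?T (\<lambda>t. ?P t * deriv \<psi> t)"
      by (rule bounded_mult_integrable[OF continuous_integrable_open_interval[OF continuous_on_primitive[OF q]] c\<psi>])
    have d\<psi>: "integrable ?T (deriv \<psi>)" by (rule continuous_integrable_open_interval[OF c\<psi>])
    have ext: "L2_inner ?A (\<lambda>x. v t x) w = g t" "L2_inner ?A (\<lambda>x. v' t x) w = q t" for t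
      by (simp_all add: g_def q_def W_def L2_inner_restrict[OF AB])
    have "(LINT t|?I. L2_inner ?A (extend_by_zero \<tau> v t) w * deriv \<psi> t)
        = (LINT t|?T. g t * deriv \<psi> t)"
      by (rule LINT_extend_by_zero[OF \<tau>]) (simp_all add: extend_by_zero_def ext)
    also have "\<dots> = (LINT t|?T. G 0 * deriv \<psi> t + ?P t * deriv \<psi> t)"
    proof (rule lebesgue_on_integral_cong_AE(1))
      show "AE t in ?T. g t * deriv \<psi> t = G 0 * deriv \<psi> t + ?P t * deriv \<psi> t"
        using G(2) AE_space
      proof eventually_elim
        case (elim t)
        have "G t = G 0 + ?P t" by (rule rep) (use elim in auto)
        then show ?case using elim by (simp only: distrib_right)
      qed
    qed simp
    also have "\<dots> = G 0 * (LINT t|?T. deriv \<psi> t) + (LINT t|?T. ?P t * deriv \<psi> t)"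
      using P d\<psi> by simp
    also have "(LINT t|?T. deriv \<psi> t) = \<psi> \<tau>"
      using LINT_FTC[OF _ c\<psi> test_functions_continuous(1)[OF \<psi>]] \<tau> test_functions_zero[OF \<psi>, of 0] by simp
    also have "(LINT t|?T. ?P t * deriv \<psi> t) = ?P \<tau> * \<psi> \<tau> - (LINT t|?T. q t * \<psi> t)"
      by (rule LINT_by_parts[OF q c\<psi> test_functions_continuous(1)[OF \<psi>]])
    also have "G 0 * \<psi> \<tau> + (?P \<tau> * \<psi> \<tau> - (LINT t|?T. q t * \<psi> t)) = (G 0 + ?P \<tau>) * \<psi> \<tau> - (LINT t|?T. q t * \<psi> t)"
      by (simp only: distrib_right add_diff_eq)
    also have "G 0 + ?P \<tau> = 0" using rep[of \<tau>] G(3) \<tau> by simp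
    also have "(LINT t|?T. q t * \<psi> t)
        = (LINT t|?I. L2_inner ?A (extend_by_zero \<tau> v' t) w * \<psi> t)"
      by (rule LINT_extend_by_zero[OF \<tau>, symmetric]) (simp_all add: extend_by_zero_def ext)
    finally show "(LINT t|?I. L2_inner ?A (extend_by_zero \<tau> v t) w * deriv \<psi> t)
        = - (LINT t|?I. L2_inner ?A (extend_by_zero \<tau> v' t) w * \<psi> t)"
      by simp
  qed
qed

section \<open>The Volterra equation and the control\<close>

text \<open>Fubini's theorem moves both convolutions from the exponential to \<open>g\<close> and \<open>g'\<close>; the bracket on
  the right is the Volterra operator.\<close>

lemma LINT_exp_conv_duality:
  fixes \<sigma> \<sigma>' g g' :: "real \<Rightarrow> real"
  assumes g: "integrable (leb_I 0 \<tau>) g" and g': "integrable (leb_I 0 \<tau>) g'"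
    and \<sigma>: "\<sigma> \<in> borel_measurable (leb_I 0 \<tau>)" "AE t in leb_I 0 \<tau>. \<bar>\<sigma> t\<bar> \<le> C"
    and \<sigma>': "\<sigma>' \<in> borel_measurable (leb_I 0 \<tau>)" "AE t in leb_I 0 \<tau>. \<bar>\<sigma>' t\<bar> \<le> C"
  shows "(LINT t|leb_I 0 \<tau>. exp_conv l \<sigma> t * g t)
      + (LINT t|leb_I 0 \<tau>. (c * exp (- l * t) + exp_conv l \<sigma>' t) * g' t)
    = (LINT r|leb_I 0 \<tau>. exp (- l * r) *
        (c * g' r + (LINT t|leb_I r \<tau>. \<sigma> (t - r) * g t)
          + (LINT t|leb_I r \<tau>. \<sigma>' (t - r) * g' t)))"
proof -
  let ?T = "leb_I 0 \<tau>" and ?e = "\<lambda>r. exp (- l * r)"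
  have ec: "continuous_on {0..\<tau>} ?e" by (intro continuous_intros)
  note e = continuous_integrable_open_interval[OF ec]
  have D: "{0<..<\<tau> - 0} = {0<..<\<tau>}" by simp
  note F1 = Fubini_triangle[OF e g, unfolded D, OF \<sigma>]
  note F2 = Fubini_triangle[OF e g', unfolded D, OF \<sigma>']
  have g'e: "integrable ?T (\<lambda>t. g' t * ?e t)" by (rule bounded_mult_integrable[OF g' ec])
  have "(LINT t|?T. (c * ?e t + exp_conv l \<sigma>' t) * g' t)
      = (LINT t|?T. c * (g' t * ?e t) + g' t * (LINT r|leb_I 0 t. \<sigma>' (t - r) * ?e r))"
  proof -
    have "(c * y + x) * z = c * (z * y) + z * x" for x y z :: real by (simp add: algebra_simps)
    then show ?thesis by (simp only: exp_conv_def)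
  qed
  also have "\<dots> = c * (LINT t|?T. g' t * ?e t) + (LINT t|?T. g' t * (LINT r|leb_I 0 t. \<sigma>' (t - r) * ?e r))"
    using g'e F2(2) by simp
  finally have 1: "(LINT t|?T. (c * ?e t + exp_conv l \<sigma>' t) * g' t)
    = c * (LINT t|?T. g' t * ?e t) + (LINT r|?T. ?e r * (LINT t|leb_I r \<tau>. \<sigma>' (t - r) * g' t))"
    unfolding F2(1) .
  have 2: "(LINT t|?T. exp_conv l \<sigma> t * g t) = (LINT r|?T. ?e r * (LINT t|leb_I r \<tau>. \<sigma> (t - r) * g t))"
    using F1(1) by (simp add: exp_conv_def mult.commute)
  have "(LINT r|?T. ?e r * (c * g' r + (LINT t|leb_I r \<tau>. \<sigma> (t - r) * g t)
          + (LINT t|leb_I r \<tau>. \<sigma>' (t - r) * g' t)))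
    = (LINT r|?T. c * (g' r * ?e r) + ?e r * (LINT t|leb_I r \<tau>. \<sigma> (t - r) * g t)
          + ?e r * (LINT t|leb_I r \<tau>. \<sigma>' (t - r) * g' t))"
    by (simp only: distrib_left mult_ac)
  also have "\<dots> = c * (LINT t|?T. g' t * ?e t)
      + (LINT r|?T. ?e r * (LINT t|leb_I r \<tau>. \<sigma> (t - r) * g t))
      + (LINT r|?T. ?e r * (LINT t|leb_I r \<tau>. \<sigma>' (t - r) * g' t))"
    using g'e F1(3) F2(3) by simp
  finally show ?thesis using 1 2 by simp
qed

text \<open>The equation holds on all of \<open>(-1, 1)\<close>, with \<open>h\<close> extended by zero; the cut-off test function \<open>W\<close>
  retains the part on \<open>\<omega>\<close>.\<close>

lemma volterra_solution_tested:
  assumes \<omega>: "\<omega> \<subseteq> {-1<..<1}" "\<omega> \<in> sets lebesgue" and e: "e \<in> L2_space leb_D"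
    and \<sigma>: "\<sigma> \<in> borel_measurable (leb_I 0 \<tau>)" "AE t in leb_I 0 \<tau>. \<bar>\<sigma> t\<bar> \<le> C"
    and \<sigma>': "\<sigma>' \<in> borel_measurable (leb_I 0 \<tau>)" "AE t in leb_I 0 \<tau>. \<bar>\<sigma>' t\<bar> \<le> C"
    and h: "h \<in> bochner_L2_L2 (lebesgue_on \<omega>) 0 \<tau>"
    and \<theta>: "\<theta> \<in> bochner_L2_L2 leb_D 0 \<tau>" and \<theta>': "has_time_deriv_L2 leb_D 0 \<tau> \<theta> \<theta>'"
    and volterra: "AE t in leb_I 0 \<tau>. \<exists>J. L2_has_integral leb_D {t<..<\<tau>}
                 (\<lambda>r x. \<sigma> (r - t) * \<theta> r x + \<sigma>' (r - t) * \<theta>' r x) J \<and>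
              (AE x in leb_D. indicator \<omega> x * h t x = \<sigma> 0 * \<theta>' t x + J x)"
  defines "W \<equiv> \<lambda>x. indicator \<omega> x * e x"
  shows "AE t in leb_I 0 \<tau>. L2_inner (lebesgue_on \<omega>) (h t) e
    = \<sigma> 0 * L2_inner leb_D (\<theta>' t) W
      + (LINT r|leb_I t \<tau>. \<sigma> (r - t) * L2_inner leb_D (\<theta> r) W)
      + (LINT r|leb_I t \<tau>. \<sigma>' (r - t) * L2_inner leb_D (\<theta>' r) W)"
proof -
  let ?T = "leb_I 0 \<tau>"
  have D: "{-1<..<1::real} \<in> sets lebesgue" by simp
  have W: "W \<in> L2_space leb_D"
    unfolding W_def by (rule L2_zero_extension[OF \<omega> D]) (rule L2_restrict[OF \<omega> D e])
  have \<theta>'B: "\<theta>' \<in> bochner_L2_L2 leb_D 0 \<tau>" using \<theta>' by (simp add: has_time_deriv_L2_def)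
  note g = bochner_L2_L2D(4)[OF \<theta> W] and g' = bochner_L2_L2D(4)[OF \<theta>'B W]
  have E: "{0<..<\<tau> - 0} = {0<..<\<tau>}" by simp
  note K = integrable_shifted_kernel[OF g, unfolded E, OF \<sigma>]
  note K' = integrable_shifted_kernel[OF g', unfolded E, OF \<sigma>']
  have both: "AE r in ?T. \<theta> r \<in> L2_space leb_D \<and> \<theta>' r \<in> L2_space leb_D"
    using bochner_L2_L2D(1)[OF \<theta>] bochner_L2_L2D(1)[OF \<theta>'B] by eventually_elim simp
  show ?thesis
    using volterra bochner_L2_L2D(1)[OF h] bochner_L2_L2D(1)[OF \<theta>'B] AE_space
  proof eventually_elim
    case (elim t)
    then have t: "0 < t" "t < \<tau>" by auto
    obtain J where J: "L2_has_integral leb_D {t<..<\<tau>} (\<lambda>r x. \<sigma> (r - t) * \<theta> r x + \<sigma>' (r - t) * \<theta>' r x) J"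
      "AE x in leb_D. indicator \<omega> x * h t x = \<sigma> 0 * \<theta>' t x + J x"
      using elim(1) by blast
    have JL: "J \<in> L2_space leb_D" using J(1) by (simp add: L2_has_integral_def)
    have "(\<lambda>x. indicator \<omega> x * (indicator \<omega> x * e x)) = (\<lambda>x. indicator \<omega> x * e x)"
      by (auto simp: indicator_def fun_eq_iff)
    then have "L2_inner (lebesgue_on \<omega>) (h t) e = L2_inner (lebesgue_on \<omega>) W (h t)"
      using L2_inner_restrict[OF \<omega> D, of "h t" W] L2_inner_restrict[OF \<omega> D, of "h t" e]
      by (simp add: W_def L2_inner_commute[of _ "h t"])
    also have "\<dots> = L2_inner leb_D (\<lambda>x. indicator \<omega> x * h t x) W"
      by (simp only: L2_inner_restrict[OF \<omega> D] L2_inner_commute[of leb_D W])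
    also have "\<dots> = L2_inner leb_D (\<lambda>x. \<sigma> 0 * \<theta>' t x + J x) W"
      by (rule L2_inner_cong_AE[OF L2_zero_extension[OF \<omega> D elim(2)] _ J(2) W])
        (intro L2_space_add L2_space_scale elim(3) JL)
    also have "\<dots> = \<sigma> 0 * L2_inner leb_D (\<theta>' t) W + L2_inner leb_D J W"
      using L2_inner_add_left[OF L2_space_scale[OF elim(3)] JL W] by (simp add: L2_inner_scale_left)
    also have "L2_inner leb_D J W = (LINT r|leb_I t \<tau>.
        L2_inner leb_D (\<lambda>x. \<sigma> (r - t) * \<theta> r x + \<sigma>' (r - t) * \<theta>' r x) W)"
      using J(1) W by (simp add: L2_has_integral_def)
    also have "\<dots> = (LINT r|leb_I t \<tau>. \<sigma> (r - t) * L2_inner leb_D (\<theta> r) W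
        + \<sigma>' (r - t) * L2_inner leb_D (\<theta>' r) W)"
    proof (rule lebesgue_on_integral_cong_AE(1))
      have "AE r in leb_I t \<tau>. \<theta> r \<in> L2_space leb_D \<and> \<theta>' r \<in> L2_space leb_D"
        using AE_subinterval[OF both] t by simp
      then show "AE r in leb_I t \<tau>.
          L2_inner leb_D (\<lambda>x. \<sigma> (r - t) * \<theta> r x + \<sigma>' (r - t) * \<theta>' r x) W
          = \<sigma> (r - t) * L2_inner leb_D (\<theta> r) W + \<sigma>' (r - t) * L2_inner leb_D (\<theta>' r) W"
        by eventually_elim (simp add: L2_inner_add_left L2_space_scale W L2_inner_scale_left)
    qed simp
    also have "\<dots> = (LINT r|leb_I t \<tau>. \<sigma> (r - t) * L2_inner leb_D (\<theta> r) W)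
        + (LINT r|leb_I t \<tau>. \<sigma>' (r - t) * L2_inner leb_D (\<theta>' r) W)"
      using K[of t] K'[of t] t by simp
    finally show ?case by (simp only: add.assoc)
  qed
qed

text \<open>The choice of time derivatives in \<^const>\<open>H1_L2_inner\<close> is immaterial, since weak derivatives are
  unique almost everywhere.\<close>

lemma H1_L2_inner_eq:
  fixes A :: "real set"
  assumes T: "0 < T" and A: "A \<in> sets lebesgue"
    and v: "AE t in leb_I 0 T. v t \<in> L2_space (lebesgue_on A)"
    and w: "AE t in leb_I 0 T. w t \<in> L2_space (lebesgue_on A)"
    and v': "has_time_deriv_L2 (lebesgue_on A) 0 T v v'" and w': "has_time_deriv_L2 (lebesgue_on A) 0 T w w'"
  shows "H1_L2_inner (lebesgue_on A) 0 T v w = (LINT t|leb_I 0 T.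
    L2_inner (lebesgue_on A) (v t) (w t) + L2_inner (lebesgue_on A) (v' t) (w' t))"
  unfolding H1_L2_inner_def
proof (rule lebesgue_on_integral_cong_AE(1))
  let ?A = "lebesgue_on A" and ?T = "leb_I 0 T"
  have L: "AE t in ?T. v' t \<in> L2_space ?A" "AE t in ?T. w' t \<in> L2_space ?A"
    using v' w' by (auto simp: has_time_deriv_L2_def dest: bochner_L2_L2D(1))
  show "AE t in ?T. (LINT x|?A. v t x * w t x + time_deriv ?A 0 T v t x * time_deriv ?A 0 T w t x)
      = L2_inner ?A (v t) (w t) + L2_inner ?A (v' t) (w' t)"
    using v w L time_deriv_unique[OF T v'] time_deriv_unique[OF T w']
  proof eventually_elim
    case (elim t)
    have "(LINT x|?A. v t x * w t x + time_deriv ?A 0 T v t x * time_deriv ?A 0 T w t x)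
        = (LINT x|?A. v t x * w t x + v' t x * w' t x)"
    proof (rule lebesgue_on_integral_cong_AE(1)[OF A])
      show "AE x in ?A. v t x * w t x + time_deriv ?A 0 T v t x * time_deriv ?A 0 T w t x
        = v t x * w t x + v' t x * w' t x"
        using elim(5,6) by eventually_elim simp
    qed
    also have "\<dots> = L2_inner ?A (v t) (w t) + L2_inner ?A (v' t) (w' t)"
      unfolding L2_inner_def
      by (rule Bochner_Integration.integral_add) (use elim in \<open>auto intro: L2_mult_integrable\<close>)
    finally show ?case .
  qed
qed simp

text \<open>The Volterra equation is made for this identity: tested against the eigenfunction expansion of
  \<open>u\<close>, it moves the convolution with \<open>\<sigma>\<close> from \<open>u\<close> to \<open>\<theta>\<close> and leaves the control \<open>h\<close> tested against
  \<open>exp(- \<lambda> r) \<phi>\<close>, of which only the mode \<open>n\<close> survives.\<close>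

lemma H1_L2_inner_control:
  assumes T: "0 < T" and \<omega>: "\<omega> \<subseteq> {-1<..<1}" "\<omega> \<in> sets lebesgue"
    and \<sigma>: "W1inf_with_deriv 0 T \<sigma> \<sigma>'" and f: "f \<in> L2_space leb_D"
    and u: "finite_energy_solution s T (\<lambda>t. pivot (\<lambda>x. f x * \<sigma> t)) (\<lambda>x. 0) u"
    and eigen: "dirichlet_eigensystem s lam \<phi>" and \<tau>: "0 < \<tau>" "\<tau> \<le> T"
    and h: "null_control s \<omega> \<tau> (\<phi> n) h" and \<theta>: "volterra_solution \<sigma> \<sigma>' \<omega> \<tau> h \<theta>"
  shows "H1_L2_inner (lebesgue_on \<omega>) 0 T u (extend_by_zero \<tau> \<theta>)
    = - (L2_inner leb_D f (\<phi> n) * exp (- lam n * \<tau>))"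
proof -
  let ?\<omega> = "lebesgue_on \<omega>" and ?T = "leb_I 0 T" and ?\<tau> = "leb_I 0 \<tau>"
  have D: "{-1<..<1::real} \<in> sets lebesgue" by simp
  have basis: "L2_orthonormal_basis leb_D \<phi>" using eigen by (simp add: dirichlet_eigensystem_def)
  note \<phi>L = orthonormal_basisD(1)[OF basis]
  obtain C where C: "continuous_on {0..T} \<sigma>" "\<And>t. t \<in> {0..T} \<Longrightarrow> \<bar>\<sigma> t\<bar> \<le> C"
    "\<sigma>' \<in> borel_measurable ?T" "AE t in ?T. \<bar>\<sigma>' t\<bar> \<le> C"
    by (rule W1inf_with_derivE[OF T \<sigma>]) (rule that)
  have \<sigma>\<tau>: "\<sigma> \<in> borel_measurable ?\<tau>"
    by (rule borel_measurable_integrable, rule continuous_integrable_open_interval)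
      (use \<tau> in \<open>auto intro: continuous_on_subset[OF C(1)]\<close>)
  have \<sigma>C: "AE t in ?\<tau>. \<bar>\<sigma> t\<bar> \<le> C" using C(2) \<tau> by (auto intro!: AE_I2)
  have \<sigma>'\<tau>: "\<sigma>' \<in> borel_measurable ?\<tau>" by (rule measurable_restrict_mono[OF C(3)]) (use \<tau> in auto)
  have \<sigma>'C: "AE t in ?\<tau>. \<bar>\<sigma>' t\<bar> \<le> C" using AE_subinterval[OF C(4), of 0 \<tau>] \<tau> by simp
  obtain V where V: "has_time_deriv_L2 leb_D 0 T u V"
    "\<And>k. AE t in ?T. L2_inner leb_D (u t) (\<phi> k) = L2_inner leb_D f (\<phi> k) * exp_conv (lam k) \<sigma> t"
    "\<And>k t. t \<in> {0<..<T} \<Longrightarrow> L2_inner leb_D (V t) (\<phi> k)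
      = L2_inner leb_D f (\<phi> k) * (\<sigma> 0 * exp (- lam k * t) + exp_conv (lam k) \<sigma>' t)"
    by (rule source_solution_time_deriv[OF T f eigen \<sigma> u]) (rule that)
  have VB: "V \<in> bochner_L2_L2 leb_D 0 T" using V(1) by (simp add: has_time_deriv_L2_def)
  have uB: "u \<in> bochner_L2_L2 leb_D 0 T"
    using u by (auto simp: finite_energy_solution_def intro: bochner_H0s_imp_L2)
  define \<theta>' where "\<theta>' = time_deriv leb_D 0 \<tau> \<theta>"
  have \<theta>B: "\<theta> \<in> bochner_L2_L2 leb_D 0 \<tau>" and ex: "\<exists>v'. has_time_deriv_L2 leb_D 0 \<tau> \<theta> v'"
    and \<theta>0: "L2_has_value_at leb_D 0 \<tau> \<theta> \<tau> (\<lambda>x. 0)"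
    and volterra: "AE t in ?\<tau>. \<exists>J. L2_has_integral leb_D {t<..<\<tau>}
                 (\<lambda>r x. \<sigma> (r - t) * \<theta> r x + \<sigma>' (r - t) * \<theta>' r x) J \<and>
              (AE x in leb_D. indicator \<omega> x * h t x = \<sigma> 0 * \<theta>' t x + J x)"
    using \<theta> by (simp_all add: volterra_solution_def H1_L2_def Let_def \<theta>'_def)
  have \<theta>': "has_time_deriv_L2 leb_D 0 \<tau> \<theta> \<theta>'"
    using someI_ex[OF ex] by (simp add: \<theta>'_def time_deriv_def)
  have \<theta>'B: "\<theta>' \<in> bochner_L2_L2 leb_D 0 \<tau>" using \<theta>' by (simp add: has_time_deriv_L2_def)
  have hB: "h \<in> bochner_L2_L2 ?\<omega> 0 \<tau>" using h by (simp add: null_control_def)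
  let ?x = "extend_by_zero \<tau> \<theta>" and ?x' = "extend_by_zero \<tau> \<theta>'"
  define w where "w t = (\<lambda>x. indicator \<omega> x * ?x t x)" for t
  define w' where "w' t = (\<lambda>x. indicator \<omega> x * ?x' t x)" for t
  have wB: "w \<in> bochner_L2_L2 leb_D 0 T"
    unfolding w_def[abs_def] by (rule bochner_L2_indicator[OF \<omega> D bochner_L2_restrict_extend[OF _ D D \<theta>B \<tau>]]) simp
  have w'B: "w' \<in> bochner_L2_L2 leb_D 0 T"
    unfolding w'_def[abs_def] by (rule bochner_L2_indicator[OF \<omega> D bochner_L2_restrict_extend[OF _ D D \<theta>'B \<tau>]]) simp
  note P = Parseval_integral[OF basis continuous_on_const[of _ "1::real"] uB wB]
  note P' = Parseval_integral[OF basis continuous_on_const[of _ "1::real"] VB w'B]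
  have "H1_L2_inner ?\<omega> 0 T u ?x
      = (LINT t|?T. L2_inner ?\<omega> (u t) (?x t) + L2_inner ?\<omega> (extend_by_zero T V t) (?x' t))"
  proof (rule H1_L2_inner_eq[OF T \<omega>(2)])
    show "AE t in ?T. u t \<in> L2_space ?\<omega>"
      using bochner_L2_L2D(1)[OF uB] by eventually_elim (rule L2_restrict[OF \<omega> D])
    show "AE t in ?T. ?x t \<in> L2_space ?\<omega>"
      by (rule bochner_L2_L2D(1)[OF bochner_L2_restrict_extend[OF \<omega> D \<theta>B \<tau>]])
    show "has_time_deriv_L2 ?\<omega> 0 T u (extend_by_zero T V)"
      by (rule has_time_deriv_L2_restrict[OF \<omega> D T V(1)])
    show "has_time_deriv_L2 ?\<omega> 0 T ?x ?x'"
      by (rule has_time_deriv_L2_extend[OF \<omega> D \<tau> \<theta>B \<theta>' \<theta>0])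
  qed
  also have "\<dots> = (LINT t|?T. L2_inner leb_D (u t) (w t) + L2_inner leb_D (V t) (w' t))"
    by (rule Bochner_Integration.integral_cong)
      (auto simp: L2_inner_restrict[OF \<omega> D] w_def w'_def extend_by_zero_def)
  also have "\<dots> = (LINT t|?T. 1 * L2_inner leb_D (u t) (w t)) + (LINT t|?T. 1 * L2_inner leb_D (V t) (w' t))"
    using P(2) P'(2) by simp
  finally have H1: "H1_L2_inner ?\<omega> 0 T u ?x
    = (LINT t|?T. 1 * L2_inner leb_D (u t) (w t)) + (LINT t|?T. 1 * L2_inner leb_D (V t) (w' t))" .
  have mode: "(LINT t|?T. 1 * (L2_inner leb_D (u t) (\<phi> k) * L2_inner leb_D (w t) (\<phi> k)))
      + (LINT t|?T. 1 * (L2_inner leb_D (V t) (\<phi> k) * L2_inner leb_D (w' t) (\<phi> k)))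
    = (if k = n then - (L2_inner leb_D f (\<phi> n) * exp (- lam n * \<tau>)) else 0)" for k
  proof -
    let ?a = "L2_inner leb_D f (\<phi> k)"
    define W where "W = (\<lambda>x. indicator \<omega> x * \<phi> k x)"
    have W: "W \<in> L2_space leb_D"
      unfolding W_def by (rule L2_zero_extension[OF \<omega> D L2_restrict[OF \<omega> D \<phi>L]])
    define g where "g t = L2_inner leb_D (\<theta> t) W" for t
    define g' where "g' t = L2_inner leb_D (\<theta>' t) W" for t
    have gi: "integrable ?\<tau> g" unfolding g_def[abs_def] by (rule bochner_L2_L2D(4)[OF \<theta>B W])
    have g'i: "integrable ?\<tau> g'" unfolding g'_def[abs_def] by (rule bochner_L2_L2D(4)[OF \<theta>'B W])
    have move: "L2_inner leb_D (\<lambda>x. indicator \<omega> x * v x) (\<phi> k) = L2_inner leb_D v W" for v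
      by (simp add: L2_inner_def W_def mult_ac)
    have "(LINT t|?T. 1 * (L2_inner leb_D (u t) (\<phi> k) * L2_inner leb_D (w t) (\<phi> k)))
        = (LINT t|?T. ?a * (exp_conv (lam k) \<sigma> t * L2_inner leb_D (?x t) W))"
    proof (rule lebesgue_on_integral_cong_AE(1))
      show "AE t in ?T. 1 * (L2_inner leb_D (u t) (\<phi> k) * L2_inner leb_D (w t) (\<phi> k))
          = ?a * (exp_conv (lam k) \<sigma> t * L2_inner leb_D (?x t) W)"
        using V(2)[of k] by eventually_elim (simp add: w_def move)
    qed simp
    also have "\<dots> = ?a * (LINT t|?\<tau>. exp_conv (lam k) \<sigma> t * g t)"
      unfolding integral_mult_right_zero
      by (subst LINT_extend_by_zero[OF \<tau>, where g="\<lambda>t. exp_conv (lam k) \<sigma> t * g t"])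
        (simp_all add: extend_by_zero_def g_def)
    finally have 1: "(LINT t|?T. 1 * (L2_inner leb_D (u t) (\<phi> k) * L2_inner leb_D (w t) (\<phi> k)))
      = ?a * (LINT t|?\<tau>. exp_conv (lam k) \<sigma> t * g t)" .
    let ?y = "\<lambda>t. \<sigma> 0 * exp (- lam k * t) + exp_conv (lam k) \<sigma>' t"
    have "(LINT t|?T. 1 * (L2_inner leb_D (V t) (\<phi> k) * L2_inner leb_D (w' t) (\<phi> k)))
        = (LINT t|?T. ?a * (?y t * L2_inner leb_D (?x' t) W))"
      by (rule Bochner_Integration.integral_cong) (simp_all add: V(3) w'_def move)
    also have "\<dots> = ?a * (LINT t|?\<tau>. ?y t * g' t)"
      unfolding integral_mult_right_zero
      by (subst LINT_extend_by_zero[OF \<tau>, where g="\<lambda>t. ?y t * g' t"])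
        (simp_all add: extend_by_zero_def g'_def)
    finally have 2: "(LINT t|?T. 1 * (L2_inner leb_D (V t) (\<phi> k) * L2_inner leb_D (w' t) (\<phi> k)))
      = ?a * (LINT t|?\<tau>. ?y t * g' t)" .
    have "(LINT t|?\<tau>. exp_conv (lam k) \<sigma> t * g t) + (LINT t|?\<tau>. ?y t * g' t)
        = (LINT r|?\<tau>. exp (- lam k * r) *
            (\<sigma> 0 * g' r + (LINT t|leb_I r \<tau>. \<sigma> (t - r) * g t)
              + (LINT t|leb_I r \<tau>. \<sigma>' (t - r) * g' t)))"
      by (rule LINT_exp_conv_duality[OF gi g'i \<sigma>\<tau> \<sigma>C \<sigma>'\<tau> \<sigma>'C])
    also have "\<dots> = (LINT r|?\<tau>. exp (- lam k * r) * L2_inner ?\<omega> (h r) (\<phi> k))"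
    proof (rule lebesgue_on_integral_cong_AE(1))
      show "AE r in ?\<tau>. exp (- lam k * r) *
            (\<sigma> 0 * g' r + (LINT t|leb_I r \<tau>. \<sigma> (t - r) * g t)
              + (LINT t|leb_I r \<tau>. \<sigma>' (t - r) * g' t))
          = exp (- lam k * r) * L2_inner ?\<omega> (h r) (\<phi> k)"
        using volterra_solution_tested[OF \<omega> \<phi>L \<sigma>\<tau> \<sigma>C \<sigma>'\<tau> \<sigma>'C hB \<theta>B \<theta>' volterra, of k]
        by eventually_elim (simp add: g_def g'_def W_def)
    qed simp
    also have "\<dots> = - (if k = n then exp (- lam k * \<tau>) else 0)"
      by (rule null_control_moment[OF \<tau>(1) eigen \<omega> h])
    finally show ?thesis
      unfolding 1 2 distrib_left[symmetric] by auto
  qed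
  have "(\<lambda>k. if k = n then - (L2_inner leb_D f (\<phi> n) * exp (- lam n * \<tau>)) else 0)
      sums H1_L2_inner ?\<omega> 0 T u ?x"
    using sums_add[OF P(1) P'(1)] unfolding mode H1 .
  moreover have "(\<lambda>k. if k = n then - (L2_inner leb_D f (\<phi> n) * exp (- lam n * \<tau>)) else 0)
      sums - (L2_inner leb_D f (\<phi> n) * exp (- lam n * \<tau>))"
    using sums_single[of n "\<lambda>_. - (L2_inner leb_D f (\<phi> n) * exp (- lam n * \<tau>))"] by simp
  ultimately show ?thesis by (rule sums_unique2)
qed

theorem theorem3p2:
  fixes T s :: real
    and \<omega> :: "real set"
    and \<sigma> \<sigma>' f :: "real \<Rightarrow> real"
    and u :: "real \<Rightarrow> real \<Rightarrow> real"
    and lam :: "nat \<Rightarrow> real"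
    and \<phi> :: "nat \<Rightarrow> real \<Rightarrow> real"
    and h \<theta> :: "nat \<Rightarrow> real \<Rightarrow> real \<Rightarrow> real \<Rightarrow> real"
  assumes T: "0 < T"
    and s: "1 / 2 < s" "s < 1"
    and \<omega>: "\<omega> \<subseteq> {-1<..<1}" "\<omega> \<in> sets lebesgue" "interior \<omega> \<noteq> {}"
    and \<sigma>: "W1inf_with_deriv 0 T \<sigma> \<sigma>'" "\<sigma> T \<noteq> 0"
    and f: "f \<in> L2_space leb_D"
    and u: "finite_energy_solution s T (\<lambda>t. pivot (\<lambda>x. f x * \<sigma> t)) (\<lambda>x. 0) u"
    and eigen: "dirichlet_eigensystem s lam \<phi>"
    and h: "\<And>n \<tau>. 0 < \<tau> \<Longrightarrow> \<tau> \<le> T \<Longrightarrow> null_control s \<omega> \<tau> (\<phi> n) (h n \<tau>)"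
    and \<theta>: "\<And>n \<tau>. 0 < \<tau> \<Longrightarrow> \<tau> \<le> T \<Longrightarrow> volterra_solution \<sigma> \<sigma>' \<omega> \<tau> (h n \<tau>) (\<theta> n \<tau>)"
    and c: "\<And>n. source_coeff T \<sigma> (lam n) \<noteq> 0"
  shows "\<forall>n. L2_inner leb_D f (\<phi> n) =
    inverse (source_coeff T \<sigma> (lam n)) *
      (- \<sigma> 0 * H1_L2_inner (lebesgue_on \<omega>) 0 T u (extend_by_zero T (\<theta> n T))
       - (LINT \<tau>|lebesgue_on {0<..<T}.
            \<sigma>' (T - \<tau>) * H1_L2_inner (lebesgue_on \<omega>) 0 T u (extend_by_zero \<tau> (\<theta> n \<tau>))))"
proof
  fix n
  let ?a = "L2_inner leb_D f (\<phi> n)" and ?T = "leb_I 0 T"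
  have H1: "H1_L2_inner (lebesgue_on \<omega>) 0 T u (extend_by_zero \<tau> (\<theta> n \<tau>)) = - (?a * exp (- lam n * \<tau>))"
    if "0 < \<tau>" "\<tau> \<le> T" for \<tau>
    by (rule H1_L2_inner_control[OF T \<omega>(1,2) \<sigma>(1) f u eigen that h[OF that] \<theta>[OF that]])
  obtain C where C: "integrable ?T \<sigma>'"
    "\<And>t. t \<in> {0..T} \<Longrightarrow> \<sigma> t = \<sigma> 0 + (LINT r|leb_I 0 t. \<sigma>' r)"
    by (rule W1inf_with_derivE[OF T \<sigma>(1)]) (rule that)
  have "(LINT r|?T. exp (lam n * (r - T)) * \<sigma> r) = exp_conv (lam n) \<sigma> T"
    unfolding exp_conv_reflect by (simp add: mult.commute minus_diff_eq[of T, symmetric] del: minus_diff_eq)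
  then have coeff: "source_coeff T \<sigma> (lam n) = \<sigma> 0 * exp (- lam n * T) + exp_conv (lam n) \<sigma>' T"
    using exp_conv_deriv[OF C, of T "lam n"] T by (simp add: source_coeff_def)
  have "(LINT \<tau>|?T. \<sigma>' (T - \<tau>) * H1_L2_inner (lebesgue_on \<omega>) 0 T u (extend_by_zero \<tau> (\<theta> n \<tau>)))
      = (LINT \<tau>|?T. - ?a * (\<sigma>' (T - \<tau>) * exp (- lam n * \<tau>)))"
    by (rule Bochner_Integration.integral_cong) (simp_all add: H1)
  also have "\<dots> = - ?a * exp_conv (lam n) \<sigma>' T"
    by (simp only: integral_mult_right_zero exp_conv_def)
  finally have "- \<sigma> 0 * H1_L2_inner (lebesgue_on \<omega>) 0 T u (extend_by_zero T (\<theta> n T))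
       - (LINT \<tau>|?T. \<sigma>' (T - \<tau>) * H1_L2_inner (lebesgue_on \<omega>) 0 T u (extend_by_zero \<tau> (\<theta> n \<tau>)))
      = source_coeff T \<sigma> (lam n) * ?a"
    using H1[OF T order_refl] by (simp add: coeff algebra_simps)
  then show "?a = inverse (source_coeff T \<sigma> (lam n)) *
      (- \<sigma> 0 * H1_L2_inner (lebesgue_on \<omega>) 0 T u (extend_by_zero T (\<theta> n T))
       - (LINT \<tau>|?T. \<sigma>' (T - \<tau>) * H1_L2_inner (lebesgue_on \<omega>) 0 T u (extend_by_zero \<tau> (\<theta> n \<tau>))))"
    using c[of n] by (simp add: mult.assoc[symmetric])
qed

end
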